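(* Let $j$ denote Klein's modular $j$-function on the upper half-plane $\mathbb{H}$. Let $\rho=e^{\pi i/3}$, and for $\tau_*\in\{\rho,i\}$ define $$s_{\tau_*}^{-1}(w)=\frac{\tau_*-\overline{\tau_*}\,W}{1-W},\qquad W=\frac{w}{2\pi\Omega_{\tau_*}^2},$$ where $$\Omega_\rho=\frac{1}{\sqrt{6\pi}}\left(\frac{\Gamma(1/3)}{\Gamma(2/3)}\right)^{3/2},\qquad \Omega_i=\frac{1}{\sqrt{8\pi}}\cdot\frac{\Gamma(1/4)}{\Gamma(3/4)}.$$ Define the power series $$h_\rho(t)=\sum_{n\ge0}(-1)^n\frac{\left(\prod_{m=1}^n(3m-1)\right)^3}{(3n+1)!}t^{3n+1},\qquad g_\rho(t)=\sum_{n\ge0}(-1)^n\frac{\left(\prod_{m=1}^n(3m-2)\right)^3}{(3n)!}t^{3n},$$ $$h_i(t)=\sum_{n\ge0}\frac{\left(\prod_{m=1}^n(4m-1)\right)^2}{(2n+1)!}t^{2n+1},\qquad g_i(t)=\sum_{n\ge0}\frac{\left(\prod_{m=1}^n(4m-3)\right)^2}{(2n)!}t^{2n},$$ (empty products equal $1$), and set $c_\rho(t)=h_\rho(t)/g_\rho(t)$ and $c_i(t)=h_i(t)/g_i(t)$. Then: (1) for every complex $t$ with $|t|<1$, $$j\left(\frac{s_\rho^{-1}(c_\rho(t))+1}{3}\right)=27t^3\left(\frac{8-t^3}{1+t^3}\right)^3;$$ (2) for every complex $t$ with $|t|<1/2$, $$j\left(s_i^{-1}(c_i(t))\right)=64\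cdot\frac{(3+4t^2)^3}{(1-4t^2)^2}.$$
   Context: Klein's $j$-function is the $\mathrm{SL}_2(\mathbb{Z})$-invariant Hauptmodul $j(\tau)=q^{-1}+744+196884q+\cdots$ with $q=e^{2\pi i\tau}$, $\tau\in\mathbb{H}$; it satisfies $j(\rho)=0$ and $j(i)=1728$. The functions $c_\rho$ and $c_i$ are the normalized flat coordinates on the moduli spaces of versal deformations of the Fermat cubic $x^3+y^3+z^3=0$ (the Hesse pencil $x^3+y^3+z^3+3txyz=0$) and of the quartic $x^4+y^4+z^2=0$ in $\mathbb{P}^2_{1,1,2}$, respectively, given explicitly by the series above. *)

theory Defs
  imports "HOL-Analysis.Analysis"
begin

(* Unordered sum over the nonzero lattice points m + n * tau; it converges absolutely for k >= 3
   when tau is not real. *)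
definition eisenstein_G :: "nat \<Rightarrow> complex \<Rightarrow> complex" where
  "eisenstein_G k \<tau> =
     (\<Sum>\<^sub>\<infinity>(m, n)\<in>(UNIV :: (int \<times> int) set) - {(0, 0)}. 1 / (of_int m + of_int n * \<tau>) ^ k)"

definition invariant_g2 :: "complex \<Rightarrow> complex" where
  "invariant_g2 \<tau> = 60 * eisenstein_G 4 \<tau>"

definition invariant_g3 :: "complex \<Rightarrow> complex" where
  "invariant_g3 \<tau> = 140 * eisenstein_G 6 \<tau>"

(* Klein's j-function in the normalisation j(i) = 1728, j = 1/q + 744 + 196884 q + ....
   It is meaningful for Im tau > 0 only. *)
definition klein_j :: "complex \<Rightarrow> complex" where
  "klein_j \<tau> =
     1728 * invariant_g2 \<tau> ^ 3 / (invariant_g2 \<tau> ^ 3 - 27 * invariant_g3 \<tau> ^ 2)"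

definition rho :: complex where
  "rho = exp (of_real pi * \<i> / 3)"

definition Omega_rho :: real where
  "Omega_rho = 1 / sqrt (6 * pi) * (Gamma (1 / 3) / Gamma (2 / 3)) powr (3 / 2)"

definition Omega_i :: real where
  "Omega_i = 1 / sqrt (8 * pi) * (Gamma (1 / 4) / Gamma (3 / 4))"

definition s_inv :: "complex \<Rightarrow> real \<Rightarrow> complex \<Rightarrow> complex" where
  "s_inv \<tau> \<Omega> w =
     (let W = w / of_real (2 * pi * \<Omega>\<^sup>2) in (\<tau> - cnj \<tau> * W) / (1 - W))"

definition h_rho :: "complex \<Rightarrow> complex" where
  "h_rho t = (\<Sum>n. (-1) ^ n * (\<Prod>m=1..n. 3 * of_nat m - 1) ^ 3 / fact (3 * n + 1) * t ^ (3 * n + 1))"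

definition g_rho :: "complex \<Rightarrow> complex" where
  "g_rho t = (\<Sum>n. (-1) ^ n * (\<Prod>m=1..n. 3 * of_nat m - 2) ^ 3 / fact (3 * n) * t ^ (3 * n))"

definition h_i :: "complex \<Rightarrow> complex" where
  "h_i t = (\<Sum>n. (\<Prod>m=1..n. 4 * of_nat m - 1) ^ 2 / fact (2 * n + 1) * t ^ (2 * n + 1))"

definition g_i :: "complex \<Rightarrow> complex" where
  "g_i t = (\<Sum>n. (\<Prod>m=1..n. 4 * of_nat m - 3) ^ 2 / fact (2 * n) * t ^ (2 * n))"

definition c_rho :: "complex \<Rightarrow> complex" where
  "c_rho t = h_rho t / g_rho t"

definition c_i :: "complex \<Rightarrow> complex" where
  "c_i t = h_i t / g_i t"

end

theory Submission
  imports Defs "HOL-Complex_Analysis.Complex_Analysis"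
begin

text \<open>
  With rows summed first, \<open>Z(z) = \<Sum>\<^sub>n \<pi> cot (\<pi>(z + n\<tau>))\<close> has periods 1 and (up to the additive
  constant \<open>-2\<pi>i\<close>) \<open>\<tau>\<close>, and its Laurent coefficients at 0 are the Eisenstein series \<open>E\<^sub>2, E\<^sub>4, E\<^sub>6, \<dots>\<close>.
  The functions \<open>2\<pi>i \<partial>\<^sub>\<tau>Z - Z Z' - Z''/2\<close> and \<open>Z\<^sup>(\<^sup>3\<^sup>) + 6 (Z' + E\<^sub>2)\<^sup>2\<close> are
  elliptic with at most a double pole, hence constant up to a multiple of \<open>Z'\<close>; comparing coefficients
  gives Ramanujan's differential equations for \<open>E\<^sub>2, E\<^sub>4, E\<^sub>6\<close>.

  Both pairs \<open>(g, h)\<close> solve a linear equation \<open>(D y')' = E y\<close> with \<open>y(0), y'(0)\<close> equal to \<open>(1, 0)\<close> and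
  \<open>(0, 1)\<close>.  For any \<open>\<kappa> > 0\<close> put \<open>W = \<kappa> h / g\<close>, \<open>F = g - \<kappa> h\<close> and let \<open>\<tau>\<close> be the point of the half-plane
  with disc coordinate \<open>W\<close>.  The Wronskian gives \<open>\<tau>' = const / (D F\<^sup>2)\<close>, so that
  \<open>E\<^sub>4(\<tau>) / F\<^sup>4\<close>, \<open>E\<^sub>6(\<tau>) / F\<^sup>6\<close> and \<open>E\<^sub>2(\<tau>) / F\<^sup>2\<close> corrected by \<open>F' / F\<close> satisfy a
  polynomial differential system.  This system has an explicit polynomial solution, whose initial values agree
  with those at the elliptic point for exactly one \<open>\<kappa>\<close>; hence the two solutions coincide where
  \<open>\<bar>W\<bar> < 1\<close>.  The condition \<open>\<bar>W\<bar> < 1\<close> holds on the whole disc: otherwise \<open>W\<close> would map a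
  neighbourhood of some point onto a neighbourhood of a boundary point, and \<open>E\<^sub>4\<close> would stay bounded
  near some cusp.  At the singular point on the boundary \<open>g\<close> diverges, so \<open>\<bar>W\<bar> \<rightarrow> 1\<close> there, and
  comparing coefficients of \<open>h\<close> and \<open>g\<close> identifies \<open>1 / \<kappa>\<close> as \<open>2\<pi>\<Omega>\<^sup>2\<close>.
\<close>

section \<open>The cotangent and its derivatives\<close>

text \<open>The values E4(i) and E6(\<rho>) are never computed. Only their reality and sign enter,
  so that the scale \<kappa> is a positive real; the constant \<Omega> appears solely through the
  growth of the coefficients towards the singular point. The value of E2 at an elliptic point comes
  from differentiating the modular relation of a series of higher weight at the fixed point, which
  takes the place of a transformation law for E2.

  The polynomial solutions have a classical origin: up to powers of one constant, E4 / F^4 and E6 /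
  F^6 become the invariants S and T of the Hesse cubic, respectively the invariants I and J of a
  binary quartic. Since j has weight 0, the powers of F cancel, and the right-hand sides of the
  theorem are quotients of such invariants.

  The obstacle is that modular functions can be pulled back only where |W| < 1, while nothing says
  beforehand that this region is the whole disc or even connected. The differential system therefore
  gives information only on the component of 0, and that component has to be shown to be
  everything.\<close>

text \<open>By the reflection formula \<open>pcot 0 w = \<pi> cot (\<pi> w)\<close>, and \<open>pcot k\<close> is its \<open>k\<close>-th derivative;
  \<open>pcot_reg k\<close> omits the polar part at 0.\<close>

definition pcot :: "nat \<Rightarrow> complex \<Rightarrow> complex" where
  "pcot k w = (-1) ^ k * Polygamma k (1 - w) - Polygamma k w"

definition pcot_reg :: "nat \<Rightarrow> complex \<Rightarrow> complex" where
  "pcot_reg k w = (-1) ^ k * Polygamma k (1 - w) - Polygamma k (1 + w)"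

lemma not_Ints_imp_not_nonpos_Ints:
  fixes w :: complex
  assumes "w \<notin> \<int>"
  shows "w \<notin> \<int>\<^sub>\<le>\<^sub>0" "1 - w \<notin> \<int>\<^sub>\<le>\<^sub>0" "w \<noteq> 0" "1 - w \<noteq> 0" "1 + w \<noteq> 0"
proof -
  have "1 - w \<notin> \<int>"
    using Ints_diff[of 1 "1 - w"] assms by auto
  moreover have "1 + w \<notin> \<int>"
    using Ints_diff[of "1 + w" 1] assms by auto
  ultimately show "w \<notin> \<int>\<^sub>\<le>\<^sub>0" "1 - w \<notin> \<int>\<^sub>\<le>\<^sub>0" "w \<noteq> 0" "1 - w \<noteq> 0" "1 + w \<noteq> 0"
    using assms by (metis Ints_0 nonpos_Ints_Int)+
qed

lemma pcot_eq_reg: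
  assumes "w \<noteq> 0"
  shows "pcot k w = pcot_reg k w + (-1) ^ k * fact k / w ^ Suc k"
  using Polygamma_plus1[OF assms, of k] unfolding pcot_def pcot_reg_def
  by (simp add: add.commute)

lemma has_field_derivative_pcot:
  assumes "w \<notin> \<int>"
  shows "(pcot k has_field_derivative pcot (Suc k) w) (at w within A)"
  unfolding pcot_def [abs_def]
  by (rule derivative_eq_intros refl DERIV_chain2[where f = "Polygamma k"] has_field_derivative_Polygamma
       not_Ints_imp_not_nonpos_Ints[OF assms] | simp)+

lemma has_field_derivative_pcot_reg:
  assumes "1 - w \<notin> \<int>\<^sub>\<le>\<^sub>0" "1 + w \<notin> \<int>\<^sub>\<le>\<^sub>0"
  shows "(pcot_reg k has_field_derivative pcot_reg (Suc k) w) (at w within A)"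
  unfolding pcot_reg_def [abs_def]
  by (rule derivative_eq_intros refl DERIV_chain2[where f = "Polygamma k"] has_field_derivative_Polygamma
       assms | simp)+

lemmas has_field_derivative_pcot' = has_field_derivative_pcot[THEN DERIV_chain2]

lemma holomorphic_on_pcot: "A \<inter> \<int> = {} \<Longrightarrow> pcot k holomorphic_on A"
  unfolding holomorphic_on_def field_differentiable_def
  using has_field_derivative_pcot by blast

lemma pcot_one_minus: "pcot k (1 - w) = (-1) ^ Suc k * pcot k w"
  by (simp add: pcot_def algebra_simps)

lemma pcot_plus_1:
  assumes "w \<notin> \<int>"
  shows "pcot k (w + 1) = pcot k w"
proof -
  have [simp]: "w \<noteq> 0" using not_Ints_imp_not_nonpos_Ints(3)[OF assms] .
  have "Polygamma k ((-w) + 1) = Polygamma k (-w) + (-1) ^ k * fact k / (-w) ^ Suc k"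
    by (rule Polygamma_plus1) simp
  moreover have "Polygamma k (w + 1) = Polygamma k w + (-1) ^ k * fact k / w ^ Suc k"
    by (rule Polygamma_plus1) simp
  moreover have "(-1) ^ k * fact k / (-w) ^ Suc k = - (fact k / w ^ Suc k)"
    by (cases "even k") simp_all
  ultimately have "Polygamma k (-w) = Polygamma k (1 - w) + fact k / w ^ Suc k"
    "Polygamma k (w + 1) = Polygamma k w + (-1) ^ k * (fact k / w ^ Suc k)" by simp_all
  moreover have "1 - (w + 1) = -w" by simp
  ultimately show ?thesis unfolding pcot_def by (simp only: distrib_left) simp
qed

lemma pcot_minus:
  assumes "w \<notin> \<int>"
  shows "pcot k (-w) = (-1) ^ Suc k * pcot k w"
proof -
  have "-w \<notin> \<int>" using assms by (metis Ints_minus add.inverse_inverse)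
  from pcot_plus_1[OF this, of k] show ?thesis
    using pcot_one_minus[of k w] by (simp add: algebra_simps)
qed

lemma sin_pi_eq_0_iff: "sin (of_real pi * w) = 0 \<longleftrightarrow> (w :: complex) \<in> \<int>"
proof
  assume "sin (of_real pi * w) = 0"
  then obtain n :: int where "of_real pi * w = of_real (n * pi)"
    by (auto simp: sin_eq_0)
  hence "w = of_int n" by (simp add: field_simps)
  thus "w \<in> \<int>" by simp
next
  assume "w \<in> \<int>"
  thus "sin (of_real pi * w) = 0"
    by (auto elim!: Ints_cases simp: sin_eq_0 mult.commute)
qed

lemma pcot_0:
  assumes w: "w \<notin> \<int>"
  shows "pcot 0 w = of_real pi * cot (of_real pi * w)"
proof -
  note nz = not_Ints_imp_not_nonpos_Ints[OF w]
  have sin_nz: "sin (of_real pi * w) \<noteq> 0" using w by (simp add: sin_pi_eq_0_iff)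
  \<comment> \<open>The product is differentiated once factor by factor and once as \<pi> / sin
    (\<pi> w).\<close>
  have "((\<lambda>z. Gamma z * Gamma (1 - z)) has_field_derivative
          Gamma w * Gamma (1 - w) * (Digamma w - Digamma (1 - w))) (at w)"
    by (rule derivative_eq_intros nz refl | simp add: algebra_simps nz)+
  moreover have "((\<lambda>z. Gamma z * Gamma (1 - z)) has_field_derivative
          - (of_real pi * (of_real pi * cos (of_real pi * w)) / sin (of_real pi * w) ^ 2)) (at w)"
    unfolding Gamma_reflection_complex
    by (rule derivative_eq_intros refl | use sin_nz in \<open>simp add: power2_eq_square\<close>)+
  ultimately have "Gamma w * Gamma (1 - w) * (Digamma w - Digamma (1 - w)) =
      - (of_real pi * (of_real pi * cos (of_real pi * w)) / sin (of_real pi * w) ^ 2)"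
    by (rule DERIV_unique)
  hence "of_real pi * sin (of_real pi * w) *
      (sin (of_real pi * w) * (Digamma w - Digamma (1 - w)) + of_real pi * cos (of_real pi * w)) = 0"
    using sin_nz by (simp add: Gamma_reflection_complex field_simps power2_eq_square)
  hence "sin (of_real pi * w) * (Digamma w - Digamma (1 - w)) + of_real pi * cos (of_real pi * w) = 0"
    using sin_nz by simp
  thus ?thesis using sin_nz by (simp add: pcot_def cot_def field_simps)
qed

lemma Im_not_Ints: "Im w \<noteq> 0 \<Longrightarrow> w \<notin> \<int>"
  by (auto elim!: Ints_cases)

text \<open>With x = exp (2 \<pi> i w) one has cot (\<pi> w) + i = -2 i x / (1 - x), and Im w \<ge>
  1 gives |x| \<le> 1/2, so the denominator costs only a factor 2.\<close>

lemma pcot_0_bound_upper: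
  assumes "Im w \<ge> 1"
  shows "norm (pcot 0 w + of_real pi * \<i>) \<le> 4 * pi * exp (-2 * pi * Im w)"
proof -
  define x where "x = exp (2 * of_real pi * \<i> * w)"
  have wZ: "w \<notin> \<int>" using assms by (intro Im_not_Ints) auto
  have nx: "norm x = exp (-2 * pi * Im w)" by (simp add: x_def)
  have "exp (-2 * pi * Im w) \<le> exp (-1)"
    using assms pi_gt3 mult_mono[of 1 "2*pi" 1 "Im w"] by simp
  also have "exp (-1::real) \<le> 1/2" using exp_ge_add_one_self[of 1] by (simp add: exp_minus field_simps)
  finally have nx2: "norm x \<le> 1/2" by (simp add: nx)
  have "1 - norm x \<le> norm (1 - x)" using norm_triangle_ineq2[of 1 x] by simp
  hence n1x: "norm (1 - x) \<ge> 1/2" using nx2 by linarith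
  hence x1: "x \<noteq> 1" by auto
  define y where "y = exp (of_real pi * \<i> * w)"
  have y0: "y \<noteq> 0" by (simp add: y_def)
  have xy: "x = y ^ 2" by (simp add: x_def y_def mult_ac flip: exp_double)
  have e1: "exp (\<i> * (of_real pi * w)) = y" by (simp add: y_def mult_ac)
  have e2: "exp (- (\<i> * (of_real pi * w))) = 1 / y" by (simp only: exp_minus e1 inverse_eq_divide)
  have s: "sin (of_real pi * w) = (y - 1 / y) / (2 * \<i>)"
    unfolding sin_exp_eq e1 e2 ..
  have c: "cos (of_real pi * w) = (y + 1 / y) / 2"
    unfolding cos_exp_eq e1 e2 ..
  have "y\<^sup>2 - 1 \<noteq> 0" using x1 xy by auto
  hence "cot (of_real pi * w) + \<i> = -2 * \<i> * x / (1 - x)"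
    using y0 x1 unfolding cot_def s c xy by (simp add: field_simps power2_eq_square)
  hence "pcot 0 w + of_real pi * \<i> = of_real pi * (-2 * \<i> * x / (1 - x))"
    unfolding pcot_0[OF wZ] by (simp flip: distrib_left)
  also have "norm \<dots> = 2 * pi * norm x / norm (1 - x)" by (simp add: norm_mult norm_divide)
  also have "\<dots> \<le> 2 * pi * norm x / (1/2)"
    by (rule divide_left_mono) (use n1x in \<open>auto intro!: mult_nonneg_nonneg mult_pos_pos\<close>)
  finally show ?thesis by (simp add: nx)
qed

text \<open>Only the cotangent itself has non-zero limits as Im w tends to plus or minus infinity;
  their opposite signs are the source of the period constant -2 \<pi> i.\<close>

definition pcot_lim :: "nat \<Rightarrow> complex \<Rightarrow> complex" where
  "pcot_lim k w = (if k = 0 then - of_real (sgn (Im w) * pi) * \<i> else 0)"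

lemma higher_deriv_pcot:
  assumes "w \<notin> \<int>"
  shows "(deriv ^^ n) (pcot k) w = pcot (k + n) w"
  using assms
proof (induction n arbitrary: w)
  case (Suc n)
  have op: "open (- \<int> :: complex set)" using closed_Ints by blast
  have "deriv ((deriv ^^ n) (pcot k)) w = deriv (pcot (k + n)) w"
    by (rule deriv_cong_ev)
       (use Suc in \<open>auto intro!: eventually_mono[OF eventually_nhds_in_open[OF op]]\<close>)
  also have "\<dots> = pcot (k + Suc n) w"
    using has_field_derivative_pcot[OF Suc.prems, of "k + n" UNIV] by (simp add: DERIV_imp_deriv)
  finally show ?case by simp
qed simp

text \<open>The bound for the cotangent passes to its derivatives by Cauchy's inequality on unit
  discs, and to the lower half-plane by parity.\<close>

lemma pcot_bound:
  obtains C where "C \<ge> 0"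
    "\<And>w. \<bar>Im w\<bar> \<ge> 2 \<Longrightarrow> norm (pcot k w - pcot_lim k w) \<le> C * exp (-2 * pi * \<bar>Im w\<bar>)"
proof -
  \<comment> \<open>\<open>fact k\<close> comes from Cauchy's inequality,
    \<open>exp (2 * pi)\<close> from the loss of 1 in the imaginary part across the disc.\<close>
  define C where "C = fact k * (4 * pi * exp (2 * pi))"
  have C: "C \<ge> 4 * pi"
    using mult_mono[of 1 "fact k" "4 * pi * 1" "4 * pi * exp (2 * pi)"] by (simp add: C_def)
  have 1: "norm (pcot k w - pcot_lim k w) \<le> C * exp (-2 * pi * Im w)" if w: "Im w \<ge> 2" for w
  proof (cases "k = 0")
    case True
    have "norm (pcot 0 w + of_real pi * \<i>) \<le> 4 * pi * exp (-2 * pi * Im w)"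
      using pcot_0_bound_upper[of w] w by simp
    also have "\<dots> \<le> C * exp (-2 * pi * Im w)" using C by simp
    finally show ?thesis using w True by (simp add: pcot_lim_def sgn_if)
  next
    case False
    have far: "Im x \<ge> Im w - 1" if "norm (w - x) \<le> 1" for x
      using abs_Im_le_cmod[of "w - x"] that by simp
    have nz: "cball w 1 \<inter> \<int> = {}"
    proof -
      have "x \<notin> \<int>" if "x \<in> cball w 1" for x
        using far[of x] that w by (intro Im_not_Ints) (auto simp: dist_norm)
      thus ?thesis by blast
    qed
    have nz': "ball w 1 \<inter> \<int> = {}" using nz ball_subset_cball by blast
    have "norm ((deriv ^^ k) (\<lambda>z. pcot 0 z + of_real pi * \<i>) w)
            \<le> fact k * (4 * pi * exp (-2 * pi * (Im w - 1))) / 1 ^ k"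
    proof (rule Cauchy_inequality)
      show "(\<lambda>z. pcot 0 z + of_real pi * \<i>) holomorphic_on ball w 1"
        by (intro holomorphic_intros holomorphic_on_pcot) (use nz ball_subset_cball[of w 1] in blast)
      have "(\<lambda>z. pcot 0 z + of_real pi * \<i>) holomorphic_on cball w 1"
        by (intro holomorphic_intros holomorphic_on_pcot) (use nz in auto)
      thus "continuous_on (cball w 1) (\<lambda>z. pcot 0 z + of_real pi * \<i>)"
        by (rule holomorphic_on_imp_continuous_on)
      fix x assume x: "norm (w - x) = 1"
      have "norm (pcot 0 x + of_real pi * \<i>) \<le> 4 * pi * exp (-2 * pi * Im x)"
        by (rule pcot_0_bound_upper) (use far[of x] x w in simp)
      also have "\<dots> \<le> 4 * pi * exp (-2 * pi * (Im w - 1))"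
        using far[of x] x by simp
      finally show "norm (pcot 0 x + of_real pi * \<i>) \<le> 4 * pi * exp (-2 * pi * (Im w - 1))" .
    qed simp
    also have "(deriv ^^ k) (\<lambda>z. pcot 0 z + of_real pi * \<i>) w =
               (deriv ^^ k) (pcot 0) w + (deriv ^^ k) (\<lambda>z. of_real pi * \<i>) w"
      by (rule higher_deriv_add[where S = "ball w 1"])
         (use nz' in \<open>auto intro!: holomorphic_on_pcot\<close>)
    also have "\<dots> = pcot k w"
      using False higher_deriv_pcot[of w k 0] w by (simp add: Im_not_Ints)
    finally show ?thesis using False
      by (simp add: pcot_lim_def C_def exp_diff exp_minus field_simps exp_add[symmetric])
  qed
  have 2: "norm (pcot k w - pcot_lim k w) \<le> C * exp (-2 * pi * \<bar>Im w\<bar>)" if w: "\<bar>Im w\<bar> \<ge> 2" for w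
  proof (cases "Im w \<ge> 0")
    case True
    thus ?thesis using 1[of w] w by simp
  next
    case False
    have "pcot k (-w) - pcot_lim k (-w) = (-1) ^ Suc k * (pcot k w - pcot_lim k w)"
      using pcot_minus[of w k] False
      by (cases "k = 0") (auto simp: pcot_lim_def Im_not_Ints sgn_if algebra_simps)
    hence "norm (pcot k (-w) - pcot_lim k (-w)) = norm (pcot k w - pcot_lim k w)"
      by (simp only: norm_mult norm_power) simp
    thus ?thesis using 1[of "-w"] False w by simp
  qed
  have "C \<ge> 0" unfolding C_def by (intro mult_nonneg_nonneg) auto
  from that[OF this 2] show thesis .
qed

lemma Polygamma_has_sum:
  fixes z :: complex
  assumes "z \<noteq> 0" and k: "k > 0"
  shows "((\<lambda>j. 1 / (z + of_nat j) ^ Suc k) has_sum ((-1) ^ Suc k * Polygamma k z / fact k)) UNIV"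
proof (rule norm_summable_imp_has_sum)
    show "(\<lambda>j. 1 / (z + of_nat j) ^ Suc k) sums ((-1) ^ Suc k * Polygamma k z / fact k)"
      using Polygamma_LIMSEQ[OF assms] by (simp add: inverse_eq_divide)
    \<comment> \<open>For such j the base has modulus at least j / 2 and at least 1, so the term is
      at most 4 / j^2.\<close>
    have "norm (norm (1 / (z + of_nat j) ^ Suc k)) \<le> 4 * inverse (of_nat j ^ 2)"
      if j: "j \<ge> nat \<lceil>2 * norm z + 2\<rceil>" for j
    proof -
      have j': "real j \<ge> 2 * norm z + 2" using j by linarith
      have n: "norm (z + of_nat j) \<ge> real j / 2"
        using norm_triangle_ineq2[of "of_nat j" "-z"] j' by (simp add: add.commute)
      hence n1: "norm (z + of_nat j) \<ge> 1" using j' norm_ge_zero[of z] by linarith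
      have "(real j / 2) ^ 2 \<le> norm (z + of_nat j) ^ 2"
        using n by (intro power_mono) auto
      also have "\<dots> \<le> norm (z + of_nat j) ^ Suc k"
        using n1 k by (intro power_increasing) auto
      finally have *: "(real j / 2) ^ 2 \<le> norm (z + of_nat j) ^ Suc k" .
      have "real j > 0" using j' norm_ge_zero[of z] by linarith
      hence "1 / norm (z + of_nat j) ^ Suc k \<le> 1 / (real j / 2) ^ 2"
        by (intro divide_left_mono * mult_pos_pos zero_less_power) (use n1 in linarith)+
      thus ?thesis by (simp add: norm_divide norm_power norm_mult field_simps del: power_Suc)
    qed
    moreover have "summable (\<lambda>j. 4 * inverse (real j ^ 2))"
      by (intro summable_mult inverse_power_summable) auto
    ultimately show "summable (\<lambda>j. norm (1 / (z + of_nat j) ^ Suc k))"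
      by (rule summable_comparison_test'[rotated])
  qed

text \<open>The sum over the integers splits at m = 0; m = -j - 1 turns the negative half into the
  Polygamma series at 1 - w.\<close>

lemma pcot_sums:
  assumes w: "w \<notin> \<int>" and k: "k > 0"
  shows "((\<lambda>m::int. 1 / (of_int m + w) ^ Suc k) has_sum ((-1) ^ k / fact k * pcot k w)) UNIV"
proof -
  note nz = not_Ints_imp_not_nonpos_Ints[OF w]
  let ?f = "\<lambda>m::int. 1 / (of_int m + w) ^ Suc k"
  have "(?f has_sum ((-1) ^ Suc k * Polygamma k w / fact k)) (range int)"
    by (subst has_sum_reindex) (use Polygamma_has_sum[OF nz(3) k] in \<open>auto simp: o_def add.commute\<close>)
  moreover have "(?f has_sum ((-1) ^ Suc k * ((-1) ^ Suc k * Polygamma k (1 - w) / fact k)))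
      (range (\<lambda>j. - int j - 1))"
  proof (subst has_sum_reindex)
    have "(?f \<circ> (\<lambda>j. - int j - 1)) = (\<lambda>j. (-1) ^ Suc k * (1 / ((1 - w) + of_nat j) ^ Suc k))"
    proof
      fix j
      have "of_int (- int j - 1) + w = - ((1 - w) + of_nat j)" by simp
      hence "(of_int (- int j - 1) + w) ^ Suc k = (-1) ^ Suc k * ((1 - w) + of_nat j) ^ Suc k"
        by (metis power_minus)
      thus "(?f \<circ> (\<lambda>j. - int j - 1)) j = (-1) ^ Suc k * (1 / ((1 - w) + of_nat j) ^ Suc k)"
        by (cases "even k") (simp_all add: o_def)
    qed
    thus "((?f \<circ> (\<lambda>j. - int j - 1)) has_sum
        ((-1) ^ Suc k * ((-1) ^ Suc k * Polygamma k (1 - w) / fact k))) UNIV"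
      by (simp only:) (intro has_sum_cmult_right Polygamma_has_sum nz k)
  qed (auto simp: inj_on_def)
  ultimately have "(?f has_sum ((-1) ^ Suc k * Polygamma k w / fact k +
      (-1) ^ Suc k * ((-1) ^ Suc k * Polygamma k (1 - w) / fact k)))
      (range int \<union> range (\<lambda>j. - int j - 1))"
    by (rule has_sum_Un_disjoint) auto
  moreover have "m \<in> range int \<union> range (\<lambda>j. - int j - 1)" for m
  proof (cases "m \<ge> 0")
    case True
    hence "m = int (nat m)" by simp
    thus ?thesis by blast
  next
    case False
    hence "m = - int (nat (-m - 1)) - 1" by simp
    thus ?thesis by blast
  qed
  hence "range int \<union> range (\<lambda>j. - int j - 1) = UNIV" by blast
  moreover have "(-1) ^ Suc k * Polygamma k w / fact k +
      (-1) ^ Suc k * ((-1) ^ Suc k * Polygamma k (1 - w) / fact k) = (-1) ^ k / fact k * pcot k w"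
    by (cases "even k") (simp_all add: pcot_def diff_divide_distrib add_divide_distrib)
  ultimately show ?thesis by (simp only:)
qed

lemma pcot_reg_0: "even k \<Longrightarrow> pcot_reg k 0 = 0"
  by (simp add: pcot_reg_def)

text \<open>This is the row through 0 of an Eisenstein sum. For odd \<open>k\<close> the exponent
  \<open>Suc k\<close> is even and the two half-rows agree.\<close>

lemma pcot_reg_0_sums:
  assumes k: "odd k"
  shows "((\<lambda>m::int. 1 / (of_int m) ^ Suc k) has_sum (- pcot_reg k 0 / fact k)) (- {0})"
proof -
  let ?f = "\<lambda>m::int. 1 / (of_int m :: complex) ^ Suc k"
  let ?P = "Polygamma k 1 / fact k :: complex"
  have k0: "k > 0" using k by (cases k) auto
  have A: "((\<lambda>j. 1 / (1 + of_nat j :: complex) ^ Suc k) has_sum ?P) UNIV"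
    using Polygamma_has_sum[of 1, OF _ k0] k by simp
  have "(?f has_sum ?P) (range (\<lambda>j. int j + 1))"
    by (subst has_sum_reindex) (use A in \<open>auto simp: o_def add.commute inj_on_def\<close>)
  moreover have "(?f has_sum ?P) (range (\<lambda>j. - int j - 1))"
  proof (subst has_sum_reindex)
    have "(?f \<circ> (\<lambda>j. - int j - 1)) = (\<lambda>j. 1 / (1 + of_nat j :: complex) ^ Suc k)"
    proof
      fix j
      have "(of_int (- int j - 1) :: complex) = - (1 + of_nat j)" by simp
      hence "(of_int (- int j - 1) :: complex) ^ Suc k = (1 + of_nat j) ^ Suc k"
        using k by (metis even_Suc power_minus_even)
      thus "(?f \<circ> (\<lambda>j. - int j - 1)) j = 1 / (1 + of_nat j :: complex) ^ Suc k"
        by (simp only: o_def)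
    qed
    thus "((?f \<circ> (\<lambda>j. - int j - 1)) has_sum ?P) UNIV"
      using A by (simp only:)
  qed (auto simp: inj_on_def)
  ultimately have "(?f has_sum (?P + ?P)) (range (\<lambda>j. int j + 1) \<union> range (\<lambda>j. - int j - 1))"
    by (rule has_sum_Un_disjoint) auto
  moreover have "m \<in> range (\<lambda>j. int j + 1) \<union> range (\<lambda>j. - int j - 1)" if "m \<noteq> 0" for m
  proof (cases "m \<ge> 0")
    case True
    hence "m = int (nat (m - 1)) + 1" using that by simp
    thus ?thesis by blast
  next
    case False
    hence "m = - int (nat (-m - 1)) - 1" by simp
    thus ?thesis by blast
  qed
  hence "range (\<lambda>j. int j + 1) \<union> range (\<lambda>j. - int j - 1) = - {0}" by auto
  ultimately show ?thesis
    using k by (simp add: pcot_reg_def)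
qed

section \<open>Cotangent series over a lattice\<close>

text \<open>Rows n and -n are taken together because for k = 0 a single row does not tend to 0. The
  weight n^j and the sign are what j derivatives with respect to \<tau> bring down from z + n \<tau>
  and z - n \<tau>. \<open>Suc n\<close> starts the rows at 1 and leaves row 0 to
  \<open>pcot\<close>.\<close>

definition cot_term :: "nat \<Rightarrow> nat \<Rightarrow> complex \<Rightarrow> complex \<Rightarrow> nat \<Rightarrow> complex" where
  "cot_term j k \<tau> z n =
     of_nat (Suc n) ^ j * (pcot k (z + of_nat (Suc n) * \<tau>) + (-1) ^ j * pcot k (z - of_nat (Suc n) * \<tau>))"

definition cot_series :: "nat \<Rightarrow> nat \<Rightarrow> complex \<Rightarrow> complex \<Rightarrow> complex" where
  "cot_series j k \<tau> z = (\<Sum>n. cot_term j k \<tau> z n)"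

text \<open>The hypothesis \<open>j \<le> k\<close> leaves j = 0 as the only case with k = 0, and
  there the two limits of the cotangent cancel; for k > 0 both are 0. The number \<delta> bounds
  from below the distance of both arguments from the real axis.\<close>

lemma cot_term_bound:
  assumes "j \<le> k"
  obtains C where "C \<ge> 0"
    "\<And>\<tau> z n \<delta>. real (Suc n) * Im \<tau> - \<bar>Im z\<bar> \<ge> \<delta> \<Longrightarrow> \<delta> \<ge> 2 \<Longrightarrow>
       norm (cot_term j k \<tau> z n) \<le> C * real (Suc n) ^ j * exp (-2 * pi * \<delta>)"
proof -
  obtain C where C: "C \<ge> 0"
    "\<And>w. \<bar>Im w\<bar> \<ge> 2 \<Longrightarrow> norm (pcot k w - pcot_lim k w) \<le> C * exp (-2 * pi * \<bar>Im w\<bar>)"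
    using pcot_bound by metis
  have "norm (cot_term j k \<tau> z n) \<le> 2 * C * real (Suc n) ^ j * exp (-2 * pi * \<delta>)"
    if *: "real (Suc n) * Im \<tau> - \<bar>Im z\<bar> \<ge> \<delta>" "\<delta> \<ge> 2" for \<tau> z n \<delta>
  proof -
    define u where "u = z + of_nat (Suc n) * \<tau>"
    define v where "v = z - of_nat (Suc n) * \<tau>"
    have u: "Im u \<ge> \<delta>" and v: "Im v \<le> -\<delta>"
      using * abs_ge_self[of "Im z"] abs_ge_minus_self[of "Im z"]
      unfolding u_def v_def plus_complex.sel minus_complex.sel times_complex.sel by auto
    have lim: "pcot_lim k u + (-1) ^ j * pcot_lim k v = 0"
      using u v * assms by (auto simp: pcot_lim_def)
    have e: "C * exp (-2 * pi * \<bar>Im w\<bar>) \<le> C * exp (-2 * pi * \<delta>)" if "\<bar>Im w\<bar> \<ge> \<delta>" for w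
      using that C(1) by (intro mult_left_mono) auto
    have "pcot k u + (-1) ^ j * pcot k v =
      (pcot k u - pcot_lim k u) + (-1) ^ j * (pcot k v - pcot_lim k v)"
      using lim by (simp add: algebra_simps)
    also have "norm \<dots> \<le> norm (pcot k u - pcot_lim k u) + norm (pcot k v - pcot_lim k v)"
      by (rule order_trans[OF norm_triangle_ineq]) (simp add: norm_mult norm_power)
    also have "\<dots> \<le> C * exp (-2 * pi * \<delta>) + C * exp (-2 * pi * \<delta>)"
      by (intro add_mono order_trans[OF C(2) e]) (use u v * in auto)
    finally have "norm (pcot k u + (-1) ^ j * pcot k v) \<le> 2 * C * exp (-2 * pi * \<delta>)" by simp
    hence "real (Suc n) ^ j * norm (pcot k u + (-1) ^ j * pcot k v) \<le>
             real (Suc n) ^ j * (2 * C * exp (-2 * pi * \<delta>))"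
      by (rule mult_left_mono) auto
    thus ?thesis unfolding cot_term_def u_def[symmetric] v_def[symmetric] norm_mult norm_power norm_of_nat
      by (simp only: mult_ac)
  qed
  thus thesis using that[of "2 * C"] C(1) by (simp add: mult_ac)
qed

lemma summable_power_times_exp:
  fixes c :: real
  assumes "c > 0"
  shows "summable (\<lambda>n. real (Suc n) ^ j * exp (- c * real (Suc n)))"
proof -
  \<comment> \<open>Since d m \<le> exp (d m), the factor m^j costs at most a constant times exp (j
    d m); this d keeps that below exp (c m / 2).\<close>
  define d where "d = c / (2 * (real j + 1))"
  have d: "d > 0" using assms by (simp add: d_def)
  have "j * d \<le> c / 2" using assms by (simp add: d_def field_simps)
  have bound: "real (Suc n) ^ j * exp (- c * real (Suc n)) \<le> (1 / d) ^ j * exp (- c / 2) ^ Suc n" for n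
  proof -
    define m where "m = real (Suc n)"
    have m: "m > 0" by (simp add: m_def)
    have "d * m \<le> exp (d * m)" using exp_ge_add_one_self[of "d * m"] by linarith
    hence "m \<le> (1 / d) * exp (d * m)" using d by (simp add: field_simps)
    hence "m ^ j \<le> ((1 / d) * exp (d * m)) ^ j" using m by (intro power_mono) auto
    also have "\<dots> = (1 / d) ^ j * exp (j * d * m)"
      by (simp only: power_mult_distrib exp_of_nat_mult[symmetric]) (simp add: mult_ac)
    also have "\<dots> \<le> (1 / d) ^ j * exp (c / 2 * m)"
      using d \<open>j * d \<le> c / 2\<close> m by (intro mult_left_mono) auto
    finally have "m ^ j * exp (- c * m) \<le> (1 / d) ^ j * exp (c / 2 * m) * exp (- c * m)"
      by (intro mult_right_mono) auto
    also have "\<dots> = (1 / d) ^ j * exp (- c / 2 * m)"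
      by (simp add: mult.assoc exp_add[symmetric])
    also have "exp (- c / 2 * m) = exp (- c / 2) ^ Suc n"
      unfolding m_def by (metis exp_of_nat_mult mult.commute)
    finally show ?thesis by (simp add: m_def)
  qed
  have "summable (\<lambda>n. (1 / d) ^ j * exp (- c / 2) ^ Suc n)"
    by (intro summable_mult summable_ignore_initial_segment[of _ 1, simplified] summable_geometric)
       (use assms in auto)
  thus ?thesis
    by (rule summable_comparison_test'[where N = 0]) (use bound in auto)
qed

text \<open>One majorant, uniform in \<tau> and z, serves the differentiation in both variables. It
  holds only eventually because low rows may come close to the strip |Im z| \<le> A.\<close>

lemma cot_term_bound_summable:
  assumes "j \<le> k" "\<delta> > 0"
  obtains M where "summable M"
    "eventually (\<lambda>n. \<forall>\<tau> z. Im \<tau> \<ge> \<delta> \<longrightarrow> \<bar>Im z\<bar> \<le> A \<longrightarrow> norm (cot_term j k \<tau> z n) \<le> M n) sequentially"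
proof -
  obtain C where C: "C \<ge> 0"
    "\<And>\<tau> z n \<delta>. real (Suc n) * Im \<tau> - \<bar>Im z\<bar> \<ge> \<delta> \<Longrightarrow> \<delta> \<ge> 2 \<Longrightarrow>
       norm (cot_term j k \<tau> z n) \<le> C * real (Suc n) ^ j * exp (-2 * pi * \<delta>)"
    using cot_term_bound[OF assms(1)] by metis
  define M where "M = (\<lambda>n. C * exp (2 * pi * A) * (real (Suc n) ^ j * exp (- (2 * pi * \<delta>) * real (Suc n))))"
  have "summable M"
    unfolding M_def by (intro summable_mult summable_power_times_exp) (use assms in auto)
  moreover have "norm (cot_term j k \<tau> z n) \<le> M n"
    if "n \<ge> nat \<lceil>(A + 2) / \<delta>\<rceil>" "Im \<tau> \<ge> \<delta>" "\<bar>Im z\<bar> \<le> A" for n \<tau> z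
  proof -
    have "real (Suc n) \<ge> (A + 2) / \<delta>" using that by linarith
    hence "real (Suc n) * \<delta> \<ge> A + 2" using assms(2) by (simp add: field_simps)
    moreover have "real (Suc n) * Im \<tau> \<ge> real (Suc n) * \<delta>" using that by (intro mult_left_mono) auto
    ultimately have "norm (cot_term j k \<tau> z n) \<le>
        C * real (Suc n) ^ j * exp (-2 * pi * (real (Suc n) * \<delta> - A))"
      using that by (intro C(2)) linarith+
    also have "exp (-2 * pi * (real (Suc n) * \<delta> - A)) = exp (2 * pi * A) * exp (- (2 * pi * \<delta>) * real (Suc n))"
      by (simp add: exp_add[symmetric] algebra_simps del: of_nat_Suc)
    finally show ?thesis by (simp only: M_def mult_ac)
  qed
  ultimately show thesis
    by (intro that[of M] eventually_sequentiallyI[of "nat \<lceil>(A + 2) / \<delta>\<rceil>"]) blast+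
qed

lemma summable_cot_term:
  assumes "j \<le> k" "Im \<tau> > 0"
  shows "summable (cot_term j k \<tau> z)"
proof -
  obtain M where M: "summable M"
    "eventually (\<lambda>n. \<forall>t w. Im t \<ge> Im \<tau> \<longrightarrow> \<bar>Im w\<bar> \<le> \<bar>Im z\<bar> \<longrightarrow> norm (cot_term j k t w n) \<le> M n) sequentially"
    using cot_term_bound_summable[OF assms, of "\<bar>Im z\<bar>"] by auto
  show ?thesis
    by (rule summable_comparison_test_ev[OF eventually_mono[OF M(2)] M(1)]) auto
qed

lemma cot_series_LIMSEQ:
  assumes "j \<le> k" "Im \<tau> > 0"
  shows "(\<lambda>N. \<Sum>n<N. cot_term j k \<tau> z n) \<longlonglongrightarrow> cot_series j k \<tau> z"
  unfolding cot_series_def using summable_cot_term[OF assms] by (rule summable_LIMSEQ)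

text \<open>Row 0 is left out on purpose: the pole at 0 belongs to it, and the expansions at 0 need
  the remaining rows to be holomorphic there.\<close>

definition off_rows :: "complex \<Rightarrow> complex set" where
  "off_rows \<tau> = {z. \<forall>n. z + of_nat (Suc n) * \<tau> \<notin> \<int> \<and> z - of_nat (Suc n) * \<tau> \<notin> \<int>}"

lemma zero_in_off_rows: "Im \<tau> > 0 \<Longrightarrow> 0 \<in> off_rows \<tau>"
  unfolding off_rows_def by (auto intro!: Im_not_Ints simp del: of_nat_Suc)

text \<open>There are infinitely many conditions, but near a given point the rows with large n are
  excluded by their imaginary part alone, so finitely many open conditions remain.\<close>

lemma open_off_rows:
  assumes "Im \<tau> > 0"
  shows "open (off_rows \<tau>)"
proof (subst open_subopen, intro ballI)
  fix z0 assume z0: "z0 \<in> off_rows \<tau>"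
  define A where "A = \<bar>Im z0\<bar> + 1"
  define N where "N = nat \<lceil>A / Im \<tau>\<rceil>"
  define U where "U = ball z0 1 \<inter>
    (\<Inter>n\<in>{..<N}. (\<lambda>z. z + of_nat (Suc n) * \<tau>) -` (-\<int>) \<inter> (\<lambda>z. z - of_nat (Suc n) * \<tau>) -` (-\<int>))"
  have "open U"
    unfolding U_def by (intro open_Int open_INT open_vimage continuous_intros ballI) (auto simp: closed_Ints)
  moreover have "z0 \<in> U" using z0 by (auto simp: U_def off_rows_def)
  moreover have "U \<subseteq> off_rows \<tau>"
  proof
    fix z assume z: "z \<in> U"
    have "norm (z0 - z) < 1" using z by (simp add: U_def dist_norm)
    hence Imz: "\<bar>Im z\<bar> < A"
      using abs_Im_le_cmod[of "z0 - z"] unfolding A_def minus_complex.sel by linarith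
    have "z + of_nat (Suc n) * \<tau> \<notin> \<int> \<and> z - of_nat (Suc n) * \<tau> \<notin> \<int>" for n
    proof (cases "n < N")
      case True
      thus ?thesis using z by (auto simp: U_def)
    next
      case False
      hence "real (Suc n) \<ge> A / Im \<tau>" unfolding N_def by linarith
      hence "real (Suc n) * Im \<tau> \<ge> A" using assms by (simp add: field_simps)
      with Imz have "Im (z + of_nat (Suc n) * \<tau>) \<noteq> 0" "Im (z - of_nat (Suc n) * \<tau>) \<noteq> 0"
        unfolding plus_complex.sel minus_complex.sel times_complex.sel by auto
      thus ?thesis using Im_not_Ints by blast
    qed
    thus "z \<in> off_rows \<tau>" by (simp add: off_rows_def)
  qed
  ultimately show "\<exists>T. open T \<and> z0 \<in> T \<and> T \<subseteq> off_rows \<tau>" by blast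
qed

lemma has_field_derivative_cot_series:
  assumes "j \<le> k" "Im \<tau> > 0" "z \<in> off_rows \<tau>"
  shows "(cot_series j k \<tau> has_field_derivative cot_series j (Suc k) \<tau> z) (at z)"
proof -
  obtain r where r: "r > 0" "ball z r \<subseteq> off_rows \<tau>"
    using open_off_rows[OF assms(2)] assms(3) open_contains_ball by blast
  obtain M where M: "summable M"
    "eventually (\<lambda>n. \<forall>t w. Im t \<ge> Im \<tau> \<longrightarrow> \<bar>Im w\<bar> \<le> \<bar>Im z\<bar> + r \<longrightarrow> norm (cot_term j (Suc k) t w n) \<le> M n) sequentially"
    using cot_term_bound_summable[of j "Suc k" "Im \<tau>" "\<bar>Im z\<bar> + r"] assms(1,2) by auto
  have Im: "\<bar>Im w\<bar> \<le> \<bar>Im z\<bar> + r" if "w \<in> ball z r" for w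
    using abs_Im_le_cmod[of "z - w"] that by (simp add: dist_norm)
  show ?thesis
    unfolding cot_series_def [abs_def]
  proof (rule has_field_derivative_series'(2))
    show "convex (ball z r)" by simp
    show "z \<in> ball z r" "z \<in> interior (ball z r)" using r by auto
    show "summable (cot_term j k \<tau> z)" by (rule summable_cot_term) fact+
    show "uniformly_convergent_on (ball z r) (\<lambda>n x. \<Sum>i<n. cot_term j (Suc k) \<tau> x i)"
      by (rule Weierstrass_m_test'_ev[OF eventually_mono[OF M(2)] M(1)]) (use Im in auto)
    show "((\<lambda>z. cot_term j k \<tau> z n) has_field_derivative cot_term j (Suc k) \<tau> w n) (at w within ball z r)"
      if "w \<in> ball z r" for n w
    proof -
      have w: "w + of_nat (Suc n) * \<tau> \<notin> \<int>" "w - of_nat (Suc n) * \<tau> \<notin> \<int>"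
        using that r(2) unfolding off_rows_def by blast+
      have 1: "((\<lambda>z. pcot k (z + of_nat (Suc n) * \<tau>)) has_field_derivative
              pcot (Suc k) (w + of_nat (Suc n) * \<tau>) * (1 + 0)) (at w within ball z r)"
        by (rule has_field_derivative_pcot', rule w(1), intro derivative_intros)
      have 2: "((\<lambda>z. pcot k (z - of_nat (Suc n) * \<tau>)) has_field_derivative
              pcot (Suc k) (w - of_nat (Suc n) * \<tau>) * (1 - 0)) (at w within ball z r)"
        by (rule has_field_derivative_pcot', rule w(2), intro derivative_intros)
      show ?thesis
        unfolding cot_term_def
        using DERIV_cmult[OF DERIV_add[OF 1 DERIV_cmult[OF 2, of "(-1) ^ j"]], of "of_nat (Suc n) ^ j"]
        by (simp del: of_nat_Suc)
    qed
  qed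
qed

lemma has_field_derivative_cot_series_tau:
  assumes "j \<le> k" "Im \<tau> > 0"
  shows "((\<lambda>t. cot_series j k t 0) has_field_derivative cot_series (Suc j) (Suc k) \<tau> 0) (at \<tau>)"
proof -
  define r where "r = Im \<tau> / 2"
  have r: "r > 0" using assms by (simp add: r_def)
  obtain M where M: "summable M"
    "eventually (\<lambda>n. \<forall>t w. Im t \<ge> Im \<tau> / 2 \<longrightarrow> \<bar>Im w\<bar> \<le> 0 \<longrightarrow> norm (cot_term (Suc j) (Suc k) t w n) \<le> M n) sequentially"
    using cot_term_bound_summable[of "Suc j" "Suc k" "Im \<tau> / 2" 0] assms(1,2) by auto
  have Im: "Im w \<ge> Im \<tau> / 2" if "w \<in> ball \<tau> r" for w
    using abs_Im_le_cmod[of "\<tau> - w"] that by (simp add: dist_norm r_def)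
  show ?thesis
    unfolding cot_series_def [abs_def]
  proof (rule has_field_derivative_series'(2))
    show "convex (ball \<tau> r)" by simp
    show "\<tau> \<in> ball \<tau> r" "\<tau> \<in> interior (ball \<tau> r)" using r by auto
    show "summable (cot_term j k \<tau> 0)" by (rule summable_cot_term) fact+
    show "uniformly_convergent_on (ball \<tau> r) (\<lambda>n x. \<Sum>i<n. cot_term (Suc j) (Suc k) x 0 i)"
      by (rule Weierstrass_m_test'_ev[OF eventually_mono[OF M(2)] M(1)]) (use Im in auto)
    show "((\<lambda>t. cot_term j k t 0 n) has_field_derivative cot_term (Suc j) (Suc k) w 0 n) (at w within ball \<tau> r)"
      if "w \<in> ball \<tau> r" for n w
    proof -
      have "Im w > 0" using Im[OF that] assms(2) by linarith
      hence "0 + of_nat (Suc n) * w \<notin> \<int>" "0 - of_nat (Suc n) * w \<notin> \<int>"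
        using zero_in_off_rows[of w] by (auto simp: off_rows_def simp del: of_nat_Suc)
      note w = this
      have 1: "((\<lambda>t. pcot k (0 + of_nat (Suc n) * t)) has_field_derivative
              pcot (Suc k) (0 + of_nat (Suc n) * w) * (0 + of_nat (Suc n) * 1)) (at w within ball \<tau> r)"
        by (rule has_field_derivative_pcot', rule w(1), intro derivative_intros DERIV_cmult DERIV_ident)
      have 2: "((\<lambda>t. pcot k (0 - of_nat (Suc n) * t)) has_field_derivative
              pcot (Suc k) (0 - of_nat (Suc n) * w) * (0 - of_nat (Suc n) * 1)) (at w within ball \<tau> r)"
        by (rule has_field_derivative_pcot', rule w(2), intro derivative_intros DERIV_cmult DERIV_ident)
      show ?thesis
        unfolding cot_term_def
        using DERIV_cmult[OF DERIV_add[OF 1 DERIV_cmult[OF 2, of "(-1) ^ j"]], of "of_nat (Suc n) ^ j"]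
        by (simp add: algebra_simps del: of_nat_Suc)
    qed
  qed
qed

section \<open>Behaviour of the cotangent series under translation by the lattice\<close>

definition lattice :: "complex \<Rightarrow> complex set" where
  "lattice \<tau> = {of_int m + of_int n * \<tau> |m n. True}"

lemma not_lattice_imp:
  assumes "z \<notin> lattice \<tau>"
  shows "z \<notin> \<int>" "z \<in> off_rows \<tau>" "z + of_int n * \<tau> \<notin> \<int>"
proof -
  have *: "z + of_int n * \<tau> \<notin> \<int>" for n
  proof
    assume "z + of_int n * \<tau> \<in> \<int>"
    then obtain m where "z + of_int n * \<tau> = of_int m" by (auto elim: Ints_cases)
    hence "z = of_int m + of_int (-n) * \<tau>" by (simp add: algebra_simps)
    thus False using assms unfolding lattice_def by blast
  qed
  show "z + of_int n * \<tau> \<notin> \<int>" by (rule *)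
  show "z \<notin> \<int>" using *[of 0] by simp
  have "z + of_nat (Suc n) * \<tau> \<notin> \<int>" "z - of_nat (Suc n) * \<tau> \<notin> \<int>" for n
    using *[of "int (Suc n)"] *[of "- int (Suc n)"] by (simp_all del: of_nat_Suc)
  thus "z \<in> off_rows \<tau>" by (simp add: off_rows_def)
qed

lemma lattice_add: "u \<in> lattice \<tau> \<Longrightarrow> v \<in> lattice \<tau> \<Longrightarrow> u + v \<in> lattice \<tau>"
  unfolding lattice_def mem_Collect_eq
  apply (elim exE conjE)
  subgoal for m m' n n'
    by (rule exI[of _ "m + m'"], rule exI[of _ "n + n'"]) (simp add: algebra_simps)
  done

lemma lattice_uminus: "u \<in> lattice \<tau> \<Longrightarrow> -u \<in> lattice \<tau>"
  unfolding lattice_def mem_Collect_eq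
  apply (elim exE conjE)
  subgoal for m n
    by (rule exI[of _ "-m"], rule exI[of _ "-n"]) (simp add: algebra_simps)
  done

lemma lattice_memI: "of_int m + of_int n * \<tau> \<in> lattice \<tau>"
  by (auto simp: lattice_def)

lemma lattice_basics: "0 \<in> lattice \<tau>" "1 \<in> lattice \<tau>" "\<tau> \<in> lattice \<tau>"
  using lattice_memI[of 0 0 \<tau>] lattice_memI[of 1 0 \<tau>] lattice_memI[of 0 1 \<tau>] by simp_all

lemma lattice_add_iff:
  assumes "u \<in> lattice \<tau>"
  shows "z + u \<in> lattice \<tau> \<longleftrightarrow> z \<in> lattice \<tau>"
  using lattice_add[OF _ assms, of z] lattice_add[OF _ lattice_uminus[OF assms], of "z + u"] by auto

lemma cot_series_plus_1:
  assumes "z \<notin> lattice \<tau>"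
  shows "cot_series j k \<tau> (z + 1) = cot_series j k \<tau> z"
proof -
  have "cot_term j k \<tau> (z + 1) n = cot_term j k \<tau> z n" for n
    using pcot_plus_1[of "z + of_nat (Suc n) * \<tau>" k] pcot_plus_1[of "z - of_nat (Suc n) * \<tau>" k]
      not_lattice_imp(2)[OF assms]
    by (simp add: cot_term_def off_rows_def add_ac add_diff_eq diff_add_eq del: of_nat_Suc)
  thus ?thesis by (simp add: cot_series_def)
qed

text \<open>The convergence is exponential, so the end rows left over by shifting a partial sum
  vanish in the limit even with a power of N in front.\<close>

lemma LIMSEQ_pcot_vertical:
  assumes "Im \<tau> > 0"
  shows "(\<lambda>N. real N ^ j * (pcot k (z + of_nat N * \<tau>) - (if k = 0 then - of_real pi * \<i> else 0))) \<longlonglongrightarrow> 0"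
    and "(\<lambda>N. real N ^ j * (pcot k (z - of_nat N * \<tau>) - (if k = 0 then of_real pi * \<i> else 0))) \<longlonglongrightarrow> 0"
proof -
  obtain C where C: "C \<ge> 0"
    "\<And>w. \<bar>Im w\<bar> \<ge> 2 \<Longrightarrow> norm (pcot k w - pcot_lim k w) \<le> C * exp (-2 * pi * \<bar>Im w\<bar>)"
    using pcot_bound by metis
  define c where "c = 2 * pi * Im \<tau>"
  define B where "B = (\<lambda>N. C * exp (2 * pi * \<bar>Im z\<bar>) * (real N ^ j * exp (- c * real N)))"
  have "(\<lambda>n. real (Suc n) ^ j * exp (- c * real (Suc n))) \<longlonglongrightarrow> 0"
    by (intro summable_LIMSEQ_zero summable_power_times_exp) (use assms in \<open>auto simp: c_def\<close>)
  hence "(\<lambda>n. real n ^ j * exp (- c * real n)) \<longlonglongrightarrow> 0" by (subst (asm) filterlim_sequentially_Suc)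
  hence B0: "B \<longlonglongrightarrow> 0" unfolding B_def by (rule tendsto_mult_right_zero)
  define N0 where "N0 = nat \<lceil>(\<bar>Im z\<bar> + 2) / Im \<tau>\<rceil>"
  have big: "real N * Im \<tau> \<ge> \<bar>Im z\<bar> + 2" if "N \<ge> N0" for N
  proof -
    have "real N \<ge> (\<bar>Im z\<bar> + 2) / Im \<tau>" using that unfolding N0_def by linarith
    thus ?thesis using assms by (simp add: field_simps)
  qed
  have bd: "norm (real N ^ j * (pcot k w - pcot_lim k w)) \<le> B N"
    if "N \<ge> N0" "\<bar>Im w\<bar> \<ge> real N * Im \<tau> - \<bar>Im z\<bar>" for w N
  proof -
    have "norm (pcot k w - pcot_lim k w) \<le> C * exp (-2 * pi * \<bar>Im w\<bar>)"
      using that big[of N] by (intro C) auto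
    also have "\<dots> \<le> C * exp (-2 * pi * (real N * Im \<tau> - \<bar>Im z\<bar>))"
      using that C(1) by (intro mult_left_mono) auto
    also have "\<dots> = C * exp (2 * pi * \<bar>Im z\<bar>) * exp (- c * real N)"
      by (simp add: mult.assoc exp_add[symmetric] c_def algebra_simps)
    finally have "real N ^ j * norm (pcot k w - pcot_lim k w) \<le> real N ^ j * (C * exp (2 * pi * \<bar>Im z\<bar>) * exp (- c * real N))"
      by (intro mult_left_mono) auto
    thus ?thesis by (simp add: norm_mult norm_power B_def mult_ac)
  qed
  show "(\<lambda>N. real N ^ j * (pcot k (z + of_nat N * \<tau>) - (if k = 0 then - of_real pi * \<i> else 0))) \<longlonglongrightarrow> 0"
  proof (rule Lim_null_comparison[OF _ B0], rule eventually_sequentiallyI)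
    fix N assume N: "N \<ge> N0"
    have "Im (z + of_nat N * \<tau>) > 0" using big[OF N] by simp
    hence "pcot_lim k (z + of_nat N * \<tau>) = (if k = 0 then - of_real pi * \<i> else 0)"
      by (simp add: pcot_lim_def)
    with bd[OF N, of "z + of_nat N * \<tau>"] big[OF N]
    show "norm (real N ^ j * (pcot k (z + of_nat N * \<tau>) - (if k = 0 then - of_real pi * \<i> else 0))) \<le> B N"
      by auto
  qed
  show "(\<lambda>N. real N ^ j * (pcot k (z - of_nat N * \<tau>) - (if k = 0 then of_real pi * \<i> else 0))) \<longlonglongrightarrow> 0"
  proof (rule Lim_null_comparison[OF _ B0], rule eventually_sequentiallyI)
    fix N assume N: "N \<ge> N0"
    have "Im (z - of_nat N * \<tau>) < 0" using big[OF N] by simp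
    hence "pcot_lim k (z - of_nat N * \<tau>) = (if k = 0 then of_real pi * \<i> else 0)"
      by (simp add: pcot_lim_def)
    with bd[OF N, of "z - of_nat N * \<tau>"] big[OF N]
    show "norm (real N ^ j * (pcot k (z - of_nat N * \<tau>) - (if k = 0 then of_real pi * \<i> else 0))) \<le> B N"
      by auto
  qed
qed

text \<open>\<open>zeta_fun 0\<close> is the series Z of rows and \<open>zeta_fun k\<close> its k-th
  derivative; Z plus \<open>eis 2 \<tau> * z\<close> is the Weierstrass zeta function.\<close>

definition zeta_fun :: "nat \<Rightarrow> complex \<Rightarrow> complex \<Rightarrow> complex" where
  "zeta_fun k \<tau> z = pcot k z + cot_series 0 k \<tau> z"

lemma zeta_fun_plus_1:
  assumes "z \<notin> lattice \<tau>"
  shows "zeta_fun k \<tau> (z + 1) = zeta_fun k \<tau> z"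
  using pcot_plus_1[OF not_lattice_imp(1)[OF assms]] cot_series_plus_1[OF assms]
  by (simp add: zeta_fun_def)

text \<open>A shift by \<tau> renumbers the rows from -N to N, so everything except the end rows
  cancels.\<close>

lemma cot_partial_sum_shift:
  "pcot k (z + \<tau>) + (\<Sum>n<N. cot_term 0 k \<tau> (z + \<tau>) n) =
   pcot k z + (\<Sum>n<N. cot_term 0 k \<tau> z n) + pcot k (z + of_nat (Suc N) * \<tau>) - pcot k (z - of_nat N * \<tau>)"
proof (induction N)
  case (Suc N)
  have "pcot k (z + \<tau> + of_nat (Suc N) * \<tau>) = pcot k (z + of_nat (Suc (Suc N)) * \<tau>)"
    "pcot k (z + \<tau> - of_nat (Suc N) * \<tau>) = pcot k (z - of_nat N * \<tau>)"
    by (rule arg_cong[where f = "pcot k"]; simp add: algebra_simps)+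
  hence "cot_term 0 k \<tau> (z + \<tau>) N = pcot k (z + of_nat (Suc (Suc N)) * \<tau>) + pcot k (z - of_nat N * \<tau>)"
    by (simp only: cot_term_def) simp
  moreover have "cot_term 0 k \<tau> z N = pcot k (z + of_nat (Suc N) * \<tau>) + pcot k (z - of_nat (Suc N) * \<tau>)"
    by (simp only: cot_term_def) simp
  ultimately show ?case using Suc unfolding sum.lessThan_Suc by (simp only: add_ac) algebra
qed simp

lemma zeta_fun_plus_tau:
  assumes "Im \<tau> > 0"
  shows "zeta_fun k \<tau> (z + \<tau>) = zeta_fun k \<tau> z - (if k = 0 then 2 * of_real pi * \<i> else 0)"
proof -
  define L where "L = (if k = 0 then of_real pi * \<i> else 0 :: complex)"
  have 1: "(\<lambda>N. pcot k (z + \<tau>) + (\<Sum>n<N. cot_term 0 k \<tau> (z + \<tau>) n)) \<longlonglongrightarrow> zeta_fun k \<tau> (z + \<tau>)"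
    unfolding zeta_fun_def by (intro tendsto_intros cot_series_LIMSEQ assms) auto
  have "(\<lambda>N. pcot k (z + of_nat N * \<tau>) - (- L)) \<longlonglongrightarrow> 0"
    using LIMSEQ_pcot_vertical(1)[OF assms, of 0 k z] unfolding L_def by (cases "k = 0") auto
  hence "(\<lambda>N. pcot k (z + of_nat N * \<tau>)) \<longlonglongrightarrow> - L" by (subst (asm) LIM_zero_iff)
  hence 2: "(\<lambda>N. pcot k (z + of_nat (Suc N) * \<tau>)) \<longlonglongrightarrow> - L" by (rule LIMSEQ_Suc)
  have "(\<lambda>N. pcot k (z - of_nat N * \<tau>) - L) \<longlonglongrightarrow> 0"
    using LIMSEQ_pcot_vertical(2)[OF assms, of 0 k z] unfolding L_def by (cases "k = 0") auto
  hence 3: "(\<lambda>N. pcot k (z - of_nat N * \<tau>)) \<longlonglongrightarrow> L" by (subst (asm) LIM_zero_iff)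
  \<comment> \<open>The two end rows contribute -\<open>L\<close> each, which adds up to the period
    constant.\<close>
  have "(\<lambda>N. pcot k (z + \<tau>) + (\<Sum>n<N. cot_term 0 k \<tau> (z + \<tau>) n)) \<longlonglongrightarrow> zeta_fun k \<tau> z + - L - L"
    unfolding cot_partial_sum_shift zeta_fun_def
    by (intro tendsto_intros cot_series_LIMSEQ assms 2 3) auto
  from LIMSEQ_unique[OF 1 this] show ?thesis by (simp add: L_def)
qed

text \<open>After the shift row n carries the weight n - 1 instead of n. This subtracts one
  unweighted sum over all rows; what is left over are end rows.\<close>

lemma weighted_cot_partial_sum_shift:
  "(\<Sum>n<N. cot_term 1 k \<tau> (z + \<tau>) n) =
   (\<Sum>n<N. cot_term 1 k \<tau> z n) - (pcot k z + (\<Sum>n<N. cot_term 0 k \<tau> z n)) +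
     of_nat N * pcot k (z + of_nat (Suc N) * \<tau>) + of_nat (Suc N) * pcot k (z - of_nat N * \<tau>)"
proof (induction N)
  case (Suc N)
  define p where "p = pcot k (z + of_nat (Suc N) * \<tau>)"
  define p' where "p' = pcot k (z + of_nat (Suc (Suc N)) * \<tau>)"
  define q where "q = pcot k (z - of_nat N * \<tau>)"
  define q' where "q' = pcot k (z - of_nat (Suc N) * \<tau>)"
  have "pcot k (z + \<tau> + of_nat (Suc N) * \<tau>) = p'"
    "pcot k (z + \<tau> - of_nat (Suc N) * \<tau>) = q"
    unfolding p'_def q_def
    by (rule arg_cong[where f = "pcot k"]; simp add: algebra_simps)+
  hence 1: "cot_term 1 k \<tau> (z + \<tau>) N = (of_nat N + 1) * (p' - q)"
    by (simp only: cot_term_def) simp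
  have 2: "cot_term 0 k \<tau> z N = p + q'" "cot_term 1 k \<tau> z N = (of_nat N + 1) * (p - q')"
    by (simp_all only: cot_term_def p_def q'_def) simp_all
  have 3: "of_nat (Suc (Suc N)) = (of_nat N + 2 :: complex)" "of_nat (Suc N) = (of_nat N + 1 :: complex)"
    by simp_all
  note IH = Suc[folded p_def q_def]
  show ?case
    unfolding sum.lessThan_Suc IH 1 2 p'_def[symmetric] q'_def[symmetric]
    unfolding 3 by (simp add: algebra_simps)
qed simp

lemma weighted_cot_series_plus_tau:
  assumes "Im \<tau> > 0" "k > 0"
  shows "cot_series 1 k \<tau> (z + \<tau>) = cot_series 1 k \<tau> z - zeta_fun k \<tau> z"
proof -
  have 1: "(\<lambda>N. \<Sum>n<N. cot_term 1 k \<tau> (z + \<tau>) n) \<longlonglongrightarrow> cot_series 1 k \<tau> (z + \<tau>)"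
    by (intro tendsto_intros cot_series_LIMSEQ assms) (use assms in auto)
  have 2: "(\<lambda>N. of_nat N ^ j * pcot k (z + of_nat N * \<tau>)) \<longlonglongrightarrow> 0"
       "(\<lambda>N. of_nat N ^ j * pcot k (z - of_nat N * \<tau>)) \<longlonglongrightarrow> 0" for j
    using LIMSEQ_pcot_vertical[OF assms(1), of j k z] assms(2) by auto
  have 3: "(\<lambda>N. of_nat (Suc N) ^ j * pcot k (z + of_nat (Suc N) * \<tau>)) \<longlonglongrightarrow> 0" for j
    by (rule LIMSEQ_Suc[OF 2(1)])
  have "(\<lambda>N. of_nat (Suc N) * pcot k (z + of_nat (Suc N) * \<tau>) - pcot k (z + of_nat (Suc N) * \<tau>)) \<longlonglongrightarrow> 0 - 0"
    by (intro tendsto_diff) (use 3[of 1] 3[of 0] in \<open>simp_all del: of_nat_Suc\<close>)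
  hence 4: "(\<lambda>N. of_nat N * pcot k (z + of_nat (Suc N) * \<tau>)) \<longlonglongrightarrow> 0"
    by (simp add: algebra_simps)
  have "(\<lambda>N. of_nat N * pcot k (z - of_nat N * \<tau>) + pcot k (z - of_nat N * \<tau>)) \<longlonglongrightarrow> 0 + 0"
    by (intro tendsto_add) (use 2(2)[of 1] 2(2)[of 0] in simp_all)
  hence 5: "(\<lambda>N. of_nat (Suc N) * pcot k (z - of_nat N * \<tau>)) \<longlonglongrightarrow> 0"
    by (simp add: algebra_simps)
  have "(\<lambda>N. \<Sum>n<N. cot_term 1 k \<tau> (z + \<tau>) n) \<longlonglongrightarrow> cot_series 1 k \<tau> z - zeta_fun k \<tau> z + 0 + 0"
    unfolding weighted_cot_partial_sum_shift zeta_fun_def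
    by (intro tendsto_intros cot_series_LIMSEQ assms 4 5) (use assms in auto)
  from LIMSEQ_unique[OF 1 this] show ?thesis by simp
qed

lemma has_field_derivative_zeta_fun:
  assumes "Im \<tau> > 0" "z \<notin> lattice \<tau>"
  shows "(zeta_fun k \<tau> has_field_derivative zeta_fun (Suc k) \<tau> z) (at z)"
  unfolding zeta_fun_def [abs_def]
  by (intro derivative_intros has_field_derivative_pcot has_field_derivative_cot_series assms
       not_lattice_imp[OF assms(2)]) auto

lemma has_fps_expansion_derivs:
  fixes f :: "nat \<Rightarrow> complex \<Rightarrow> complex"
  assumes A: "open A" "0 \<in> A"
    and f: "\<And>k z. z \<in> A \<Longrightarrow> (f k has_field_derivative f (Suc k) z) (at z)"
  shows "f k has_fps_expansion Abs_fps (\<lambda>n. f (k + n) 0 / fact n)"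
proof -
  have hd: "(deriv ^^ n) (f k) z = f (k + n) z" if "z \<in> A" for n z
    using that
  proof (induction n arbitrary: z)
    case (Suc n)
    have "deriv ((deriv ^^ n) (f k)) z = deriv (f (k + n)) z"
      by (rule deriv_cong_ev) (use Suc A in \<open>auto intro!: eventually_mono[OF eventually_nhds_in_open]\<close>)
    also have "\<dots> = f (k + Suc n) z"
      using f[OF Suc.prems, of "k + n"] by (simp add: DERIV_imp_deriv)
    finally show ?case by simp
  qed simp
  have "f k holomorphic_on A"
    using f by (auto simp: holomorphic_on_open[OF A(1)])
  from has_fps_expansion_fps_expansion[OF A this]
  have "f k has_fps_expansion fps_expansion (f k) 0" .
  also have "fps_expansion (f k) 0 = Abs_fps (\<lambda>n. f (k + n) 0 / fact n)"
    by (simp add: fps_expansion_def hd A)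
  finally show ?thesis .
qed

lemma not_lattice_iff: "z \<notin> lattice \<tau> \<longleftrightarrow> z \<notin> \<int> \<and> z \<in> off_rows \<tau>"
proof
  assume *: "z \<notin> \<int> \<and> z \<in> off_rows \<tau>"
  show "z \<notin> lattice \<tau>"
  proof
    assume "z \<in> lattice \<tau>"
    then obtain m n :: int where mn: "z = of_int m + of_int n * \<tau>" by (auto simp: lattice_def)
    consider "n = 0" | k where "n = int (Suc k)" | k where "n = - int (Suc k)"
      by (cases n rule: int_cases3) (metis gr0_implies_Suc)+
    thus False
    proof cases
      case (2 k)
      have "z - of_nat (Suc k) * \<tau> = of_int m" using mn 2 by simp
      moreover have "z - of_nat (Suc k) * \<tau> \<notin> \<int>" using * unfolding off_rows_def by blast
      ultimately show False by simp
    next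
      case (3 k)
      have "z + of_nat (Suc k) * \<tau> = of_int m" using mn 3 by (simp add: algebra_simps)
      moreover have "z + of_nat (Suc k) * \<tau> \<notin> \<int>" using * unfolding off_rows_def by blast
      ultimately show False by simp
    qed (use mn * in auto)
  qed
qed (auto dest: not_lattice_imp)

lemma open_minus_lattice:
  assumes "Im \<tau> > 0"
  shows "open (- lattice \<tau>)"
proof -
  have "- lattice \<tau> = - \<int> \<inter> off_rows \<tau>" using not_lattice_iff[of _ \<tau>] by blast
  thus ?thesis using open_off_rows[OF assms] by (simp add: open_Int closed_Ints open_Compl)
qed

lemma punctured_ball_not_lattice:
  assumes "Im \<tau> > 0"
  shows "\<exists>r>0. r \<le> 1 \<and> ball 0 r \<subseteq> off_rows \<tau> \<and> (\<forall>z\<in>ball 0 r. z \<noteq> 0 \<longrightarrow> z \<notin> lattice \<tau>)"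
proof -
  obtain r0 where r0: "r0 > 0" "ball 0 r0 \<subseteq> off_rows \<tau>"
    using open_off_rows[OF assms] zero_in_off_rows[OF assms] open_contains_ball by blast
  \<comment> \<open>A radius of at most 1 keeps the non-zero integers, the other poles of row 0,
    outside.\<close>
  define r where "r = min r0 1"
  have "r > 0" "r \<le> 1" "ball 0 r \<subseteq> off_rows \<tau>" using r0 by (auto simp: r_def)
  moreover have "z \<notin> lattice \<tau>" if "z \<in> ball 0 r" "z \<noteq> 0" for z
  proof -
    have "z \<notin> \<int>"
    proof
      assume "z \<in> \<int>"
      then obtain m where m: "z = of_int m" by (auto elim: Ints_cases)
      have "norm z < 1" using that by (simp add: r_def)
      thus False using m that(2) by simp
    qed
    thus ?thesis using not_lattice_iff that(1) \<open>ball 0 r \<subseteq> off_rows \<tau>\<close> by blast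
  qed
  ultimately show ?thesis by blast
qed

lemma periodic_lattice:
  assumes "\<And>z. z \<notin> lattice \<tau> \<Longrightarrow> V (z + 1) = V z"
    and "\<And>z. z \<notin> lattice \<tau> \<Longrightarrow> V (z + \<tau>) = V z"
    and "z \<notin> lattice \<tau>" "u \<in> lattice \<tau>"
  shows "V (z + u) = V z"
proof -
  have nl: "z + (of_int m + of_int n * \<tau>) \<notin> lattice \<tau>" for m n
    using assms(3) lattice_add_iff[OF lattice_memI] by blast
  have 1: "V (z + of_int m) = V z" for m
  proof (induction m rule: int_induct[where k = 0])
    case (step1 i)
    thus ?case using assms(1)[OF nl[of i 0]] by (simp add: add_ac)
  next
    case (step2 i)
    thus ?case using assms(1)[OF nl[of "i - 1" 0]] by (simp add: add_ac)
  qed simp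
  have 2: "V (z + (of_int m + of_int n * \<tau>)) = V z" for m n
  proof (induction n rule: int_induct[where k = 0])
    case base
    thus ?case using 1 by simp
  next
    case (step1 i)
    thus ?case using assms(2)[OF nl[of m i]] by (simp add: algebra_simps)
  next
    case (step2 i)
    thus ?case using assms(2)[OF nl[of m "i - 1"]] by (simp add: algebra_simps)
  qed
  thus ?thesis using assms(4) by (auto simp: lattice_def)
qed

section \<open>Ramanujan's differential equations\<close>

text \<open>V enters through z^2 V, which is regular at 0. The two vanishing coefficients make V
  itself regular there and, by periodicity, at every lattice point. The extension is bounded, so
  Liouville's theorem leaves only the coefficient of index 2, which is the constant value of
  V.\<close>

lemma elliptic_double_pole_coeffs:
  assumes \<tau>: "Im \<tau> > 0"
    and hol: "V holomorphic_on - lattice \<tau>"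
    and per: "\<And>z. z \<notin> lattice \<tau> \<Longrightarrow> V (z + 1) = V z" "\<And>z. z \<notin> lattice \<tau> \<Longrightarrow> V (z + \<tau>) = V z"
    and H: "H has_fps_expansion F" "fps_nth F 0 = 0" "fps_nth F 1 = 0"
    and VH: "eventually (\<lambda>z. z \<noteq> 0 \<longrightarrow> z ^ 2 * V z = H z) (nhds 0)"
    and n: "n \<ge> 3"
  shows "fps_nth F n = 0"
proof (cases "F = 0")
  case False
  have sd: "2 \<le> subdegree F"
    using False H(2,3) by (intro subdegree_geI) (auto simp: less_2_cases_iff)
  define c where "c = fps_nth F 2"
  define G where "G = (\<lambda>x. if x = 0 then c else H x / x ^ 2)"
  have G: "G has_fps_expansion fps_shift 2 F"
    unfolding G_def by (rule has_fps_expansion_shift[OF H(1) sd c_def])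
  obtain s where s: "open s" "0 \<in> s" "G holomorphic_on s"
    by (rule has_fps_expansion_imp_holomorphic[OF G]) auto
  obtain r1 where r1: "r1 > 0" "\<And>z. z \<in> ball 0 r1 \<Longrightarrow> z \<noteq> 0 \<Longrightarrow> z \<notin> lattice \<tau>"
    using punctured_ball_not_lattice[OF \<tau>] by blast
  obtain r2 where r2: "r2 > 0" "\<And>z. z \<in> ball 0 r2 \<Longrightarrow> z \<noteq> 0 \<Longrightarrow> z ^ 2 * V z = H z"
    using VH unfolding eventually_nhds_metric by (auto simp: dist_commute)
  obtain r3 where r3: "r3 > 0" "ball 0 r3 \<subseteq> s"
    using s open_contains_ball by blast
  define r where "r = min r1 (min r2 r3)"
  have r: "r > 0" using r1 r2 r3 by (simp add: r_def)
  have VG: "V z = G z" if "z \<in> ball 0 r" "z \<noteq> 0" for z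
    using r2(2)[of z] that by (auto simp: G_def r_def field_simps)
  \<comment> \<open>At lattice points V is whatever its formula happens to return, so the removable
    value is put in by hand.\<close>
  define E where "E = (\<lambda>z. if z \<in> lattice \<tau> then c else V z)"
  have E_lat: "E (z + u) = E z" if "u \<in> lattice \<tau>" for z u
    using periodic_lattice[of \<tau> V z u] per that by (auto simp: E_def lattice_add_iff)
  have EG: "E z = G z" if "z \<in> ball 0 r" for z
    using VG[OF that] r1(2)[of z] that lattice_basics(1)[of \<tau>] by (auto simp: E_def G_def r_def)
  have cong: "E field_differentiable at w"
    if f: "f field_differentiable at w" and ev: "eventually (\<lambda>z. f z = E z) (nhds w)" for f w
  proof -
    obtain D where "(f has_field_derivative D) (at w)"
      using f unfolding field_differentiable_def by blast
    hence "(E has_field_derivative D) (at w)"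
      by (rule DERIV_cong_ev[OF refl ev refl, THEN iffD1])
    thus ?thesis unfolding field_differentiable_def by blast
  qed
  have "E field_differentiable at w" for w
  proof (cases "w \<in> lattice \<tau>")
    case True
    have "(\<lambda>z. G (z - w)) field_differentiable at w"
    proof -
      have "G field_differentiable at 0"
        using s by (simp add: holomorphic_on_imp_differentiable_at)
      thus ?thesis
        using field_differentiable_compose[of "\<lambda>z. z - w" w G]
        by (simp add: o_def field_differentiable_diff)
    qed
    moreover have "eventually (\<lambda>z. G (z - w) = E z) (nhds w)"
    proof -
      have "eventually (\<lambda>z. z \<in> ball w r) (nhds w)" using r by (intro eventually_nhds_in_open) auto
      thus ?thesis
      proof eventually_elim
        case (elim z)
        hence "z - w \<in> ball 0 r" by (simp add: dist_norm norm_minus_commute)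
        from EG[OF this] E_lat[OF True, of "z - w"] show ?case by simp
      qed
    qed
    ultimately show ?thesis by (rule cong)
  next
    case False
    have "V field_differentiable at w"
      using hol False open_minus_lattice[OF \<tau>] by (auto intro: holomorphic_on_imp_differentiable_at)
    moreover have "eventually (\<lambda>z. V z = E z) (nhds w)"
      by (rule eventually_mono[OF eventually_nhds_in_open[OF open_minus_lattice[OF \<tau>]]])
         (use False in \<open>auto simp: E_def\<close>)
    ultimately show ?thesis by (rule cong)
  qed
  hence holE: "E holomorphic_on UNIV"
    by (auto simp: holomorphic_on_def intro: field_differentiable_at_within)
  \<comment> \<open>A closed period parallelogram: every point is moved into it by subtracting the
    integer parts of its two real coordinates.\<close>
  define P where "P = (\<lambda>(x, y). of_real x + of_real y * \<tau>) ` ({0..1} \<times> {0..1 :: real})"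
  have "compact P"
    unfolding P_def by (intro compact_continuous_image continuous_intros compact_Times)
       (auto simp: case_prod_unfold intro!: continuous_intros)
  hence "compact (E ` P)"
    by (intro compact_continuous_image)
       (use holE holomorphic_on_imp_continuous_on continuous_on_subset in blast)
  have "range E \<subseteq> E ` P"
  proof safe
    fix z
    define y where "y = Im z / Im \<tau>"
    define x where "x = Re z - y * Re \<tau>"
    have z: "z = of_real x + of_real y * \<tau>"
      using \<tau> by (simp add: complex_eq_iff x_def y_def)
    define u where "u = of_int (- \<lfloor>x\<rfloor>) + of_int (- \<lfloor>y\<rfloor>) * \<tau>"
    have "z + u = of_real (frac x) + of_real (frac y) * \<tau>"
      unfolding u_def z frac_def by (simp add: algebra_simps)
    moreover have "frac x \<in> {0..1}" "frac y \<in> {0..1}"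
      using frac_lt_1[of x] frac_lt_1[of y] by (auto simp: less_imp_le)
    ultimately have "z + u \<in> P" unfolding P_def by (auto intro!: image_eqI[of _ _ "(frac x, frac y)"])
    moreover have "E (z + u) = E z" by (rule E_lat) (unfold u_def, rule lattice_memI)
    ultimately show "E z \<in> E ` P" by (metis imageI)
  qed
  hence "bounded (range E)"
    using \<open>compact (E ` P)\<close> bounded_subset compact_imp_bounded by blast
  from Liouville_theorem[OF holE this] obtain c' where "E = (\<lambda>_. c')"
    by (auto simp: constant_on_def)
  hence "G z = c'" if "z \<in> ball 0 r" for z using EG[OF that] by simp
  hence "eventually (\<lambda>z. G z = c') (nhds 0)"
    using r unfolding eventually_nhds_metric by (intro exI[of _ r]) (auto simp: dist_norm)
  hence "(\<lambda>_. c') has_fps_expansion fps_shift 2 F"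
    using G has_fps_expansion_cong[of G "\<lambda>_. c'" "fps_shift 2 F" "fps_shift 2 F"] by simp
  hence "fps_shift 2 F = fps_const c'"
    by (rule fps_expansion_unique_complex) simp
  moreover obtain m where m: "n = m + 2" "m > 0"
    using n by (intro that[of "n - 2"]) auto
  ultimately have "fps_nth (fps_shift 2 F) m = 0" by simp
  thus ?thesis unfolding m(1) by simp
qed (use n in simp)

section \<open>Laurent coefficients at 0 and the relations between them\<close>

definition zeta_reg :: "nat \<Rightarrow> complex \<Rightarrow> complex \<Rightarrow> complex" where
  "zeta_reg k \<tau> z = pcot_reg k z + cot_series 0 k \<tau> z"

lemma zeta_fun_eq_reg:
  "z \<noteq> 0 \<Longrightarrow> zeta_fun k \<tau> z = zeta_reg k \<tau> z + (-1) ^ k * fact k / z ^ Suc k"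
  by (simp add: zeta_fun_def zeta_reg_def pcot_eq_reg)

lemma norm_less_1_imp_not_nonpos:
  assumes "norm (z :: complex) < 1"
  shows "1 + z \<notin> \<int>\<^sub>\<le>\<^sub>0"
proof
  assume "1 + z \<in> \<int>\<^sub>\<le>\<^sub>0"
  then obtain n where "1 + z = - of_nat n" by (auto elim: nonpos_Ints_cases')
  hence "z = - of_nat (Suc n)" by (simp add: algebra_simps eq_neg_iff_add_eq_0)
  hence "norm z = real (Suc n)" by (simp only: norm_minus_cancel norm_of_nat)
  thus False using assms by simp
qed

lemma has_field_derivative_zeta_reg:
  assumes "Im \<tau> > 0" "z \<in> off_rows \<tau>" "norm z < 1"
  shows "(zeta_reg k \<tau> has_field_derivative zeta_reg (Suc k) \<tau> z) (at z)"
  unfolding zeta_reg_def [abs_def]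
  using norm_less_1_imp_not_nonpos[of z] norm_less_1_imp_not_nonpos[of "-z"] assms
  by (intro derivative_intros has_field_derivative_pcot_reg has_field_derivative_cot_series) auto

lemma zeta_reg_expansion:
  assumes "Im \<tau> > 0"
  shows "zeta_reg k \<tau> has_fps_expansion Abs_fps (\<lambda>n. zeta_reg (k + n) \<tau> 0 / fact n)"
    and "cot_series 1 (Suc k) \<tau> has_fps_expansion Abs_fps (\<lambda>n. cot_series 1 (Suc (k + n)) \<tau> 0 / fact n)"
proof -
  obtain r where r: "r > 0" "r \<le> 1" "ball 0 r \<subseteq> off_rows \<tau>" "\<And>z. z \<in> ball 0 r \<Longrightarrow> z \<noteq> 0 \<Longrightarrow> z \<notin> lattice \<tau>"
    using punctured_ball_not_lattice[OF assms] by blast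
  show "zeta_reg k \<tau> has_fps_expansion Abs_fps (\<lambda>n. zeta_reg (k + n) \<tau> 0 / fact n)"
    by (rule has_fps_expansion_derivs[of "ball 0 r"])
       (use r in \<open>auto intro!: has_field_derivative_zeta_reg[OF assms]\<close>)
  show "cot_series 1 (Suc k) \<tau> has_fps_expansion Abs_fps (\<lambda>n. cot_series 1 (Suc (k + n)) \<tau> 0 / fact n)"
    by (rule has_fps_expansion_derivs[of "ball 0 r" "\<lambda>k. cot_series 1 (Suc k) \<tau>"])
       (use r in \<open>auto intro!: has_field_derivative_cot_series[OF _ assms]\<close>)
qed

text \<open>For even \<open>k \<ge> 4\<close> this is the Eisenstein series \<open>G\<^sub>k\<close>; for \<open>k = 2\<close> it is the value of the
  conditionally convergent series summed row by row.\<close>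

definition eis :: "nat \<Rightarrow> complex \<Rightarrow> complex" where
  "eis k \<tau> = - zeta_reg (k - 1) \<tau> 0 / fact (k - 1)"

lemma zeta_reg_even:
  assumes "even k" "Im \<tau> > 0"
  shows "zeta_reg k \<tau> 0 = 0"
proof -
  have "cot_term 0 k \<tau> 0 n = 0" for n
  proof -
    have "of_nat (Suc n) * \<tau> \<notin> \<int>"
      using zero_in_off_rows[OF assms(2)] by (auto simp: off_rows_def simp del: of_nat_Suc)
    from pcot_minus[OF this, of k] show ?thesis using assms(1) by (simp add: cot_term_def del: of_nat_Suc)
  qed
  hence "cot_series 0 k \<tau> 0 = 0" by (simp add: cot_series_def)
  thus ?thesis using assms pcot_reg_0 by (simp add: zeta_reg_def)
qed

lemma zeta_reg_nth:
  "zeta_reg 1 \<tau> 0 = - eis 2 \<tau>" "zeta_reg 3 \<tau> 0 = - 6 * eis 4 \<tau>"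
  "zeta_reg 5 \<tau> 0 = - 120 * eis 6 \<tau>" "zeta_reg 7 \<tau> 0 = - 5040 * eis 8 \<tau>"
  by (simp_all add: eis_def fact_numeral)

text \<open>\<open>- zeta_fun 1 \<tau> z - eis 2 \<tau>\<close> is the Weierstrass elliptic
  function, so \<open>V\<close> is its second derivative minus 6 times its square. This is constant,
  and its coefficient of z^4 gives the relation.\<close>

lemma eis_8:
  assumes \<tau>: "Im \<tau> > 0"
  shows "eis 8 \<tau> = 3 / 7 * eis 4 \<tau> ^ 2"
proof -
  define V where "V = (\<lambda>z. - zeta_fun 3 \<tau> z - 6 * (- zeta_fun 1 \<tau> z - eis 2 \<tau>) ^ 2)"
  define H where "H = (\<lambda>z. - (z ^ 2 * zeta_reg 3 \<tau> z) - 12 * (- zeta_reg 1 \<tau> z - eis 2 \<tau>)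
     - 6 * z ^ 2 * (- zeta_reg 1 \<tau> z - eis 2 \<tau>) ^ 2)"
  define Z where "Z = (\<lambda>k. Abs_fps (\<lambda>n. zeta_reg (k + n) \<tau> 0 / fact n))"
  \<comment> \<open>The expansion of the Weierstrass function without its pole 1 / z^2.\<close>
  define P where "P = - Z 1 - fps_const (eis 2 \<tau>)"
  define F where "F = - (fps_X ^ 2 * Z 3) - 12 * P - 6 * fps_X ^ 2 * P ^ 2"
  have P: "fps_nth P 0 = 0" "fps_nth P 1 = 0" "fps_nth P 2 = 3 * eis 4 \<tau>" "fps_nth P 3 = 0"
    "fps_nth P 4 = 5 * eis 6 \<tau>" "fps_nth P 6 = 7 * eis 8 \<tau>"
    using zeta_reg_even[of 2, OF _ \<tau>] zeta_reg_even[of 4, OF _ \<tau>]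
    by (simp_all add: P_def Z_def zeta_reg_nth zeta_reg_nth(1)[simplified] fact_numeral numeral_2_eq_2[symmetric])
  \<comment> \<open>The index is 6 rather than 4 because \<open>F\<close> expands z^2 V.\<close>
  have "fps_nth F 6 = 0"
  proof (rule elliptic_double_pole_coeffs[OF \<tau>, of V H])
    show "V holomorphic_on - lattice \<tau>"
      unfolding V_def
      by (intro holomorphic_intros;
          use has_field_derivative_zeta_fun[OF \<tau>] in \<open>auto simp: holomorphic_on_open[OF open_minus_lattice[OF \<tau>]]\<close>)
    show "V (z + 1) = V z" if "z \<notin> lattice \<tau>" for z
      using zeta_fun_plus_1[OF that] by (simp add: V_def)
    show "V (z + \<tau>) = V z" if "z \<notin> lattice \<tau>" for z
      using zeta_fun_plus_tau[OF \<tau>] by (simp add: V_def)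
    show "H has_fps_expansion F"
      unfolding H_def F_def P_def Z_def by (intro fps_expansion_intros zeta_reg_expansion \<tau>)
    show "fps_nth F 0 = 0" "fps_nth F 1 = 0"
      using P by (simp_all add: F_def fps_mult_nth numeral_fps_const power2_eq_square)
    show "eventually (\<lambda>z. z \<noteq> 0 \<longrightarrow> z\<^sup>2 * V z = H z) (nhds 0)"
    proof (intro always_eventually allI impI)
      fix z :: complex assume z: "z \<noteq> 0"
      have 1: "zeta_fun 1 \<tau> z = zeta_reg 1 \<tau> z - 1 / z ^ 2" "zeta_fun 3 \<tau> z = zeta_reg 3 \<tau> z - 6 / z ^ 4"
        using zeta_fun_eq_reg[OF z, of 1 \<tau>] zeta_fun_eq_reg[OF z, of 3 \<tau>]
        by (simp_all add: numeral_eq_Suc)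
      show "z\<^sup>2 * V z = H z"
        unfolding V_def H_def 1 using z by (simp add: field_simps power2_eq_square power4_eq_xxxx)
    qed
  qed simp
  moreover have "fps_nth F 6 = - (210 * - eis 8 \<tau>) - 12 * (7 * eis 8 \<tau>) - 6 * (3 * eis 4 \<tau>) ^ 2"
  proof -
    have "fps_nth (fps_X ^ 2 * Z 3) 6 = fps_nth (Z 3) 4" by (simp add: fps_X_power_mult_nth)
    moreover have "fps_nth (Z 3) 4 = 210 * - eis 8 \<tau>" by (simp add: Z_def zeta_reg_nth fact_numeral)
    moreover have "fps_nth (fps_X ^ 2 * P ^ 2) 6 = fps_nth (P ^ 2) 4" by (simp add: fps_X_power_mult_nth)
    moreover have "fps_nth (P ^ 2) 4 = (3 * eis 4 \<tau>) ^ 2"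
      using P by (simp add: power2_eq_square fps_mult_nth eval_nat_numeral)
    ultimately show ?thesis unfolding F_def
      by (simp add: numeral_fps_const mult.assoc P)
  qed
  ultimately show ?thesis by (simp add: power2_eq_square field_simps)
qed

text \<open>Z is the logarithmic derivative of a theta function, and V = 0 is the heat equation of
  that function rewritten for Z; \<open>cot_series 1 1 \<tau>\<close> is the \<tau>-derivative of Z.
  Under z -> z + \<tau> the first term of V loses c Z' and the second gains it, and at 0 the poles
  of order 3 cancel. The three equations are the coefficients of z, z^3 and z^5 in V.\<close>

lemma heat_equation_coeffs:
  assumes \<tau>: "Im \<tau> > 0"
  shows "2 * of_real pi * \<i> * (- cot_series 1 2 \<tau> 0) = 5 * eis 4 \<tau> - eis 2 \<tau> ^ 2"
    and "2 * of_real pi * \<i> * (- cot_series 1 4 \<tau> 0 / 6) = 14 * eis 6 \<tau> - 4 * eis 2 \<tau> * eis 4 \<tau>"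
    and "2 * of_real pi * \<i> * (- cot_series 1 6 \<tau> 0 / 120) =
           27 * eis 8 \<tau> - 3 * eis 4 \<tau> ^ 2 - 6 * eis 2 \<tau> * eis 6 \<tau>"
proof -
  define c where "c = 2 * of_real pi * \<i>"
  define V where "V = (\<lambda>z. c * cot_series 1 1 \<tau> z - zeta_fun 0 \<tau> z * zeta_fun 1 \<tau> z - 1 / 2 * zeta_fun 2 \<tau> z)"
  define H where "H = (\<lambda>z. c * (z ^ 2 * cot_series 1 1 \<tau> z) - (z * zeta_reg 1 \<tau> z - zeta_reg 0 \<tau> z)
     - z ^ 2 * (zeta_reg 0 \<tau> z * zeta_reg 1 \<tau> z) - 1 / 2 * (z ^ 2 * zeta_reg 2 \<tau> z))"
  define Z where "Z = (\<lambda>k. Abs_fps (\<lambda>n. zeta_reg (k + n) \<tau> 0 / fact n))"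
  define T where "T = Abs_fps (\<lambda>n. cot_series 1 (Suc (0 + n)) \<tau> 0 / fact n)"
  define F where "F = fps_const c * (fps_X ^ 2 * T) - (fps_X * Z 1 - Z 0) - fps_X ^ 2 * (Z 0 * Z 1)
     - fps_const (1 / 2) * (fps_X ^ 2 * Z 2)"
  have Z: "fps_nth (Z k) n = zeta_reg (k + n) \<tau> 0 / fact n" for k n by (simp add: Z_def)
  have ev: "zeta_reg 0 \<tau> 0 = 0" "zeta_reg 2 \<tau> 0 = 0" "zeta_reg 4 \<tau> 0 = 0" "zeta_reg 6 \<tau> 0 = 0"
    using zeta_reg_even[OF _ \<tau>] by simp_all
  have F: "fps_nth F n = 0" if "n \<ge> 3" for n
  proof (rule elliptic_double_pole_coeffs[OF \<tau>, of V H])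
    have "cot_series 1 1 \<tau> holomorphic_on - lattice \<tau>"
      using has_field_derivative_cot_series[of 1 1, OF _ \<tau> not_lattice_imp(2)]
      by (auto simp: holomorphic_on_open[OF open_minus_lattice[OF \<tau>]])
    thus "V holomorphic_on - lattice \<tau>"
      unfolding V_def
      by (intro holomorphic_intros;
          use has_field_derivative_zeta_fun[OF \<tau>] in \<open>auto simp: holomorphic_on_open[OF open_minus_lattice[OF \<tau>]]\<close>)
    show "V (z + 1) = V z" if "z \<notin> lattice \<tau>" for z
      using zeta_fun_plus_1[OF that] cot_series_plus_1[OF that] by (simp add: V_def)
    show "V (z + \<tau>) = V z" if "z \<notin> lattice \<tau>" for z
    proof -
      have sh: "zeta_fun 0 \<tau> (z + \<tau>) = zeta_fun 0 \<tau> z - c" "zeta_fun 1 \<tau> (z + \<tau>) = zeta_fun 1 \<tau> z"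
        "zeta_fun 2 \<tau> (z + \<tau>) = zeta_fun 2 \<tau> z"
        "cot_series 1 1 \<tau> (z + \<tau>) = cot_series 1 1 \<tau> z - zeta_fun 1 \<tau> z"
        using zeta_fun_plus_tau[OF \<tau>, of 0 z] zeta_fun_plus_tau[OF \<tau>, of 1 z] zeta_fun_plus_tau[OF \<tau>, of 2 z]
          weighted_cot_series_plus_tau[OF \<tau>, of 1 z] by (simp_all add: c_def)
      show ?thesis unfolding V_def sh by (simp add: algebra_simps)
    qed
    show "H has_fps_expansion F"
      unfolding H_def F_def Z_def T_def
      by (intro fps_expansion_intros zeta_reg_expansion \<tau> zeta_reg_expansion(2)[of \<tau> 0, unfolded One_nat_def[symmetric]])
    show "fps_nth F 0 = 0" "fps_nth F 1 = 0"
      using ev by (simp_all add: F_def fps_X_power_mult_nth Z)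
    show "eventually (\<lambda>z. z \<noteq> 0 \<longrightarrow> z\<^sup>2 * V z = H z) (nhds 0)"
    proof (intro always_eventually allI impI)
      fix z :: complex assume z: "z \<noteq> 0"
      have 1: "zeta_fun 0 \<tau> z = zeta_reg 0 \<tau> z + 1 / z"
        "zeta_fun 1 \<tau> z = zeta_reg 1 \<tau> z - 1 / z ^ 2" "zeta_fun 2 \<tau> z = zeta_reg 2 \<tau> z + 2 / z ^ 3"
        using zeta_fun_eq_reg[OF z, of 0 \<tau>] zeta_fun_eq_reg[OF z, of 1 \<tau>] zeta_fun_eq_reg[OF z, of 2 \<tau>]
        by (simp_all add: numeral_eq_Suc)
      show "z\<^sup>2 * V z = H z"
        unfolding V_def H_def 1 using z by (simp add: field_simps power2_eq_square power3_eq_cube)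
    qed
  qed (use that in simp)
  have T: "fps_nth T n = cot_series 1 (Suc n) \<tau> 0 / fact n" for n by (simp add: T_def)
  have "fps_nth F 3 = c * fps_nth T 1 - (fps_nth (Z 1) 2 - fps_nth (Z 0) 3) - fps_nth (Z 0 * Z 1) 1 - 1 / 2 * fps_nth (Z 2) 1"
    unfolding F_def by (simp add: fps_X_power_mult_nth mult.assoc)
  also have "fps_nth (Z 0 * Z 1) 1 = eis 2 \<tau> ^ 2"
    by (simp add: fps_mult_nth Z ev zeta_reg_nth[unfolded One_nat_def] power2_eq_square)
  finally show "2 * of_real pi * \<i> * (- cot_series 1 2 \<tau> 0) = 5 * eis 4 \<tau> - eis 2 \<tau> ^ 2"
    using F[of 3] by (simp add: T Z zeta_reg_nth c_def fact_numeral numeral_2_eq_2[symmetric]) (simp add: algebra_simps)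
  have "fps_nth F 5 = c * fps_nth T 3 - (fps_nth (Z 1) 4 - fps_nth (Z 0) 5) - fps_nth (Z 0 * Z 1) 3 - 1 / 2 * fps_nth (Z 2) 3"
    unfolding F_def by (simp add: fps_X_power_mult_nth mult.assoc)
  also have "fps_nth (Z 0 * Z 1) 3 = fps_nth (Z 0) 0 * fps_nth (Z 1) 3 + fps_nth (Z 0) 1 * fps_nth (Z 1) 2 +
      fps_nth (Z 0) 2 * fps_nth (Z 1) 1 + fps_nth (Z 0) 3 * fps_nth (Z 1) 0"
    by (simp add: fps_mult_nth eval_nat_numeral)
  also have "\<dots> = 4 * eis 2 \<tau> * eis 4 \<tau>"
    by (simp add: Z ev zeta_reg_nth zeta_reg_nth(1)[simplified] fact_numeral
        numeral_2_eq_2[symmetric] numeral_3_eq_3[symmetric])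
  finally show "2 * of_real pi * \<i> * (- cot_series 1 4 \<tau> 0 / 6) = 14 * eis 6 \<tau> - 4 * eis 2 \<tau> * eis 4 \<tau>"
    using F[of 5] by (simp add: T Z zeta_reg_nth c_def fact_numeral) (simp add: algebra_simps)
  have "fps_nth F 7 = c * fps_nth T 5 - (fps_nth (Z 1) 6 - fps_nth (Z 0) 7) - fps_nth (Z 0 * Z 1) 5 - 1 / 2 * fps_nth (Z 2) 5"
    unfolding F_def by (simp add: fps_X_power_mult_nth mult.assoc)
  also have "fps_nth (Z 0 * Z 1) 5 = fps_nth (Z 0) 0 * fps_nth (Z 1) 5 + fps_nth (Z 0) 1 * fps_nth (Z 1) 4 +
      fps_nth (Z 0) 2 * fps_nth (Z 1) 3 + fps_nth (Z 0) 3 * fps_nth (Z 1) 2 +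
      fps_nth (Z 0) 4 * fps_nth (Z 1) 1 + fps_nth (Z 0) 5 * fps_nth (Z 1) 0"
    by (simp add: fps_mult_nth eval_nat_numeral)
  also have "\<dots> = 6 * eis 2 \<tau> * eis 6 \<tau> + 3 * eis 4 \<tau> ^ 2"
    by (simp add: Z ev zeta_reg_nth zeta_reg_nth(1)[simplified] fact_numeral power2_eq_square
        numeral_2_eq_2[symmetric] numeral_3_eq_3[symmetric])
  finally show "2 * of_real pi * \<i> * (- cot_series 1 6 \<tau> 0 / 120) =
           27 * eis 8 \<tau> - 3 * eis 4 \<tau> ^ 2 - 6 * eis 2 \<tau> * eis 6 \<tau>"
    using F[of 7] by (simp add: T Z zeta_reg_nth c_def fact_numeral) (simp add: algebra_simps)
qed

lemma has_field_derivative_eis: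
  assumes "Im \<tau> > 0" "k > 0"
  shows "(eis k has_field_derivative - cot_series 1 k \<tau> 0 / fact (k - 1)) (at \<tau>)"
proof -
  have "((\<lambda>t. cot_series 0 (k - 1) t 0) has_field_derivative cot_series (Suc 0) (Suc (k - 1)) \<tau> 0) (at \<tau>)"
    by (rule has_field_derivative_cot_series_tau) (use assms in auto)
  from DERIV_add[OF DERIV_const this, of "pcot_reg (k - 1) 0"]
  have "((\<lambda>t. zeta_reg (k - 1) t 0) has_field_derivative cot_series 1 k \<tau> 0) (at \<tau>)"
    unfolding zeta_reg_def using assms by simp
  from DERIV_cdivide[OF DERIV_minus[OF this]] show ?thesis
    unfolding eis_def [abs_def] .
qed

text \<open>The series are normalised as lattice sums and not by constant term 1, hence the
  coefficients 5, 14 and 60/7. The last one is 27 * 3/7 - 3, after \<open>eis 8\<close> has been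
  expressed through \<open>eis 4\<close>.\<close>

theorem ramanujan_eis:
  assumes "Im \<tau> > 0"
  shows "(eis 2 has_field_derivative (5 * eis 4 \<tau> - eis 2 \<tau> ^ 2) / (2 * of_real pi * \<i>)) (at \<tau>)"
    and "(eis 4 has_field_derivative (14 * eis 6 \<tau> - 4 * eis 2 \<tau> * eis 4 \<tau>) / (2 * of_real pi * \<i>)) (at \<tau>)"
    and "(eis 6 has_field_derivative (60 / 7 * eis 4 \<tau> ^ 2 - 6 * eis 2 \<tau> * eis 6 \<tau>) / (2 * of_real pi * \<i>)) (at \<tau>)"
proof -
  have "- cot_series 1 2 \<tau> 0 = (5 * eis 4 \<tau> - eis 2 \<tau> ^ 2) / (2 * of_real pi * \<i>)"
    using heat_equation_coeffs(1)[OF assms] by (simp add: field_simps)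
  with has_field_derivative_eis[OF assms, of 2]
  show "(eis 2 has_field_derivative (5 * eis 4 \<tau> - eis 2 \<tau> ^ 2) / (2 * of_real pi * \<i>)) (at \<tau>)"
    by simp
  have "- cot_series 1 4 \<tau> 0 / 6 = (14 * eis 6 \<tau> - 4 * eis 2 \<tau> * eis 4 \<tau>) / (2 * of_real pi * \<i>)"
    using heat_equation_coeffs(2)[OF assms] by (simp add: field_simps)
  with has_field_derivative_eis[OF assms, of 4]
  show "(eis 4 has_field_derivative (14 * eis 6 \<tau> - 4 * eis 2 \<tau> * eis 4 \<tau>) / (2 * of_real pi * \<i>)) (at \<tau>)"
    by (simp add: fact_numeral)
  have "- cot_series 1 6 \<tau> 0 / 120 = (60 / 7 * eis 4 \<tau> ^ 2 - 6 * eis 2 \<tau> * eis 6 \<tau>) / (2 * of_real pi * \<i>)"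
    using heat_equation_coeffs(3)[OF assms] by (simp add: field_simps eis_8[OF assms])
  with has_field_derivative_eis[OF assms, of 6]
  show "(eis 6 has_field_derivative (60 / 7 * eis 4 \<tau> ^ 2 - 6 * eis 2 \<tau> * eis 6 \<tau>) / (2 * of_real pi * \<i>)) (at \<tau>)"
    by (simp add: fact_numeral)
qed

lemma has_sum_int_imp_sums:
  fixes f :: "int \<Rightarrow> 'a :: {real_normed_vector, banach}"
  assumes "(f has_sum S) UNIV" "f summable_on UNIV"
  shows "(\<lambda>n. f (int (Suc n)) + f (- int (Suc n))) sums (S - f 0)"
proof -
  define A where "A = range (\<lambda>n. int (Suc n))"
  define B where "B = range (\<lambda>n. - int (Suc n))"
  have "f summable_on A" "f summable_on B"
    using assms(2) summable_on_subset_banach by blast+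
  then obtain a b where a: "(f has_sum a) A" and b: "(f has_sum b) B"
    by (auto simp: summable_on_def)
  have "(f has_sum (f 0 + (a + b))) ({0} \<union> (A \<union> B))"
    using has_sum_finite[of "{0}" f]
    by (intro has_sum_Un_disjoint a b) (auto simp: A_def B_def simp del: of_nat_Suc)
  moreover have "{0} \<union> (A \<union> B) = UNIV"
  proof (intro equalityI subsetI UNIV_I)
    fix n :: int
    show "n \<in> {0} \<union> (A \<union> B)"
      by (cases n rule: int_cases3) (auto simp: A_def B_def image_iff gr0_conv_Suc simp del: of_nat_Suc)
  qed
  ultimately have S: "S = f 0 + (a + b)"
    using assms(1) has_sum_unique by metis
  have "((f \<circ> (\<lambda>n. int (Suc n))) has_sum a) UNIV" "((f \<circ> (\<lambda>n. - int (Suc n))) has_sum b) UNIV"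
    using a b unfolding A_def B_def by (subst (asm) has_sum_reindex; simp add: inj_on_def)+
  hence "(f \<circ> (\<lambda>n. int (Suc n))) sums a" "(f \<circ> (\<lambda>n. - int (Suc n))) sums b"
    by (auto dest: has_sum_imp_sums)
  from sums_add[OF this] show ?thesis by (simp add: S o_def del: of_nat_Suc)
qed

section \<open>Modularity and special values of Eisenstein series\<close>

text \<open>The weights make all lattice sums comparable with a product of two one-dimensional sums.\<close>

definition int_weight :: "int \<Rightarrow> real" where
  "int_weight m = 1 / (1 + of_int m ^ 2)"

lemma int_weight_pos: "int_weight m > 0"
  unfolding int_weight_def by (intro divide_pos_pos add_pos_nonneg) auto

lemma int_weight_summable: "int_weight summable_on UNIV"
proof -
  have "(\<lambda>m::int. 1 / (of_int m + \<i>) ^ Suc 1) summable_on UNIV"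
    using pcot_sums[of \<i> 1] Im_not_Ints[of \<i>] by (auto simp: summable_on_def)
  hence "(\<lambda>m::int. norm (1 / (of_int m + \<i>) ^ Suc 1)) summable_on UNIV"
    by (rule summable_on_iff_abs_summable_on_complex[THEN iffD1])
  moreover have "norm (1 / (of_int m + \<i>) ^ Suc 1) = int_weight m" for m :: int
  proof -
    have "norm (of_int m + \<i>) * norm (of_int m + \<i>) = 1 + of_int m ^ 2"
      using cmod_power2[of "of_int m + \<i>"] by (simp add: power2_eq_square)
    thus ?thesis by (simp add: norm_divide norm_mult int_weight_def)
  qed
  ultimately show ?thesis by simp
qed

text \<open>The sum is \<pi> coth \<pi> = 3.153... The terms with m = 1 and m = -1 and the term with
  m = 0 are counted exactly and contribute 2; the rest lies below a telescoping series with total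
  4/3.\<close>

lemma int_weight_infsum_le: "infsum int_weight UNIV \<le> 10 / 3"
proof -
  define S where "S = infsum int_weight UNIV"
  have "(\<lambda>n. int_weight (int (Suc n)) + int_weight (- int (Suc n))) sums (S - int_weight 0)"
    by (rule has_sum_int_imp_sums) (use int_weight_summable in \<open>auto simp: S_def\<close>)
  moreover have "int_weight (- m) = int_weight m" "int_weight 0 = 1" for m
    by (simp_all add: int_weight_def)
  ultimately have s: "(\<lambda>n. 2 * int_weight (int (Suc n))) sums (S - 1)"
    by (simp only: mult_2)
  have s': "(\<lambda>n. 2 * int_weight (int (Suc (Suc n)))) sums (S - 1 - 1)"
    using s by (subst sums_Suc_iff) (simp add: int_weight_def)
  \<comment> \<open>Its differences are 2 / ((n + 2)^2 - 1/4), just above the terms 2 / ((n + 2)^2 +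
    1).\<close>
  define u where "u = (\<lambda>n. 2 / (real n + 3 / 2))"
  have "u \<longlonglongrightarrow> 0" unfolding u_def by real_asymp
  hence t: "(\<lambda>n. u n - u (Suc n)) sums (u 0 - 0)"
    by (rule telescope_sums')
  have "S - 1 - 1 \<le> u 0 - 0"
  proof (rule sums_le[OF _ s' t])
    fix n
    have "u n - u (Suc n) = 2 / ((real n + 3 / 2) * (real n + 5 / 2))"
      by (simp add: u_def field_simps)
    also have "\<dots> \<ge> 2 * int_weight (int (Suc (Suc n)))"
    proof -
      have "2 / (1 + (real n + 2)\<^sup>2) \<le> 2 / ((real n + 3 / 2) * (real n + 5 / 2))"
      proof (rule divide_left_mono)
        show "(real n + 3 / 2) * (real n + 5 / 2) \<le> 1 + (real n + 2)\<^sup>2"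
          by (simp add: power2_eq_square algebra_simps)
        show "0 < (1 + (real n + 2)\<^sup>2) * ((real n + 3 / 2) * (real n + 5 / 2))"
          by (intro mult_pos_pos) (auto intro: add_pos_nonneg)
      qed simp
      thus ?thesis by (simp add: int_weight_def add_ac)
    qed
    finally show "2 * int_weight (int (Suc (Suc n))) \<le> u n - u (Suc n)" .
  qed
  thus ?thesis by (simp add: S_def u_def)
qed

lemma int_weight_prod_has_sum:
  "((\<lambda>(m, n). int_weight m * int_weight n) has_sum (infsum int_weight UNIV)\<^sup>2) (UNIV \<times> UNIV)"
proof -
  define S where "S = infsum int_weight UNIV"
  have S: "(int_weight has_sum S) UNIV" unfolding S_def using int_weight_summable by simp
  have f: "((\<lambda>n. case (m, n) of (m, n) \<Rightarrow> int_weight m * int_weight n) has_sum (int_weight m * S)) UNIV" for m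
    using has_sum_cmult_right[OF S, of "int_weight m"] by simp
  have g: "((\<lambda>m. int_weight m * S) has_sum (S * S)) UNIV"
    by (rule has_sum_cmult_left[OF S])
  have "(\<lambda>(m, n). int_weight m * int_weight n) summable_on (UNIV \<times> UNIV)"
    by (rule summable_on_SigmaI[OF f]) (use g int_weight_pos in \<open>auto simp: summable_on_def less_imp_le\<close>)
  from has_sum_SigmaI[OF f g this] show ?thesis by (simp add: S_def power2_eq_square)
qed

definition eis_term :: "nat \<Rightarrow> complex \<Rightarrow> int \<times> int \<Rightarrow> complex" where
  "eis_term k \<tau> = (\<lambda>(m, n). 1 / (of_int m + of_int n * \<tau>) ^ k)"

text \<open>For w = m + n \<tau>, the bounds |n| Im \<tau> \<le> |w| and m = w - n \<tau> give |m|,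
  |n| \<le> K |w| with \<open>K\<close> depending on \<tau> only. Hence (1 + m^2) (1 + n^2) \<le> 4
  (K |w|)^4, and K |w| \<ge> 1 allows every larger exponent.\<close>

lemma eis_term_summable:
  assumes \<tau>: "Im \<tau> > 0" and k: "k \<ge> 4"
  shows "(\<lambda>x. norm (eis_term k \<tau> x)) summable_on (UNIV - {(0, 0)})"
proof -
  define K where "K = 1 + (norm \<tau> + 1) / Im \<tau>"
  have K1: "K \<ge> 1" using \<tau> by (simp add: K_def)
  have bd: "norm (eis_term k \<tau> x) \<le> 4 * K ^ k * (case x of (m, n) \<Rightarrow> int_weight m * int_weight n)"
    if "x \<in> UNIV - {(0, 0)}" for x
  proof -
    obtain m n where x: "x = (m, n)" by (cases x)
    define w where "w = of_int m + of_int n * \<tau>"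
    define a b :: real where "a = of_int m" and "b = of_int n"
    have "\<bar>b\<bar> * Im \<tau> = \<bar>Im w\<bar>" using \<tau> by (simp add: w_def b_def abs_mult)
    hence n0: "\<bar>b\<bar> * Im \<tau> \<le> norm w" using abs_Im_le_cmod[of w] by simp
    hence n1: "\<bar>b\<bar> \<le> norm w / Im \<tau>" using \<tau> by (simp add: field_simps)
    have "norm w / Im \<tau> \<le> K * norm w"
    proof -
      have "1 / Im \<tau> \<le> K" using \<tau> by (simp add: K_def field_simps)
      from mult_right_mono[OF this, of "norm w"] show ?thesis by simp
    qed
    hence n: "\<bar>b\<bar> \<le> K * norm w" using n1 by linarith
    have "norm (of_int m :: complex) = norm (w - of_int n * \<tau>)" by (simp add: w_def)
    also have "\<dots> \<le> norm w + norm (of_int n * \<tau>)" by (rule norm_triangle_ineq4)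
    also have "norm (of_int n * \<tau>) = \<bar>b\<bar> * norm \<tau>" by (simp add: norm_mult b_def)
    also have "\<dots> \<le> norm w / Im \<tau> * norm \<tau>" using n1 by (intro mult_right_mono) auto
    finally have "\<bar>a\<bar> \<le> norm w + norm w / Im \<tau> * norm \<tau>" by (simp add: a_def)
    also have "\<dots> = norm w * (1 + norm \<tau> / Im \<tau>)" by (simp add: field_simps)
    also have "\<dots> \<le> norm w * K"
      using \<tau> by (intro mult_left_mono) (auto simp: K_def add_divide_distrib)
    finally have m: "\<bar>a\<bar> \<le> K * norm w" by (simp add: mult_ac)
    have "m \<noteq> 0 \<or> n \<noteq> 0" using that x by auto
    hence "\<bar>a\<bar> \<ge> 1 \<or> \<bar>b\<bar> \<ge> 1" unfolding a_def b_def by linarith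
    hence Kw: "K * norm w \<ge> 1" using m n by linarith
    hence Kw2: "(K * norm w) ^ 2 \<ge> 1" by simp
    have "a ^ 2 \<le> (K * norm w) ^ 2" "b ^ 2 \<le> (K * norm w) ^ 2"
      using power_mono[OF m, of 2] power_mono[OF n, of 2] by simp_all
    hence "(1 + a ^ 2) * (1 + b ^ 2) \<le> (2 * (K * norm w) ^ 2) * (2 * (K * norm w) ^ 2)"
      using Kw2 by (intro mult_mono) auto
    also have "\<dots> = 4 * (K * norm w) ^ 4" by (simp add: power4_eq_xxxx power2_eq_square)
    also have "\<dots> \<le> 4 * (K * norm w) ^ k"
      using power_increasing[OF k Kw] by simp
    also have "\<dots> = 4 * K ^ k * norm w ^ k" by (simp add: power_mult_distrib)
    finally have main: "(1 + a ^ 2) * (1 + b ^ 2) \<le> 4 * K ^ k * norm w ^ k" .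
    have "norm w > 0" using Kw by (cases "norm w = 0") auto
    moreover have "(1 + a ^ 2) * (1 + b ^ 2) > 0" by (intro mult_pos_pos add_pos_nonneg) auto
    ultimately have "1 / norm w ^ k \<le> 4 * K ^ k / ((1 + a ^ 2) * (1 + b ^ 2))"
      using main by (simp add: divide_simps mult_ac)
    thus ?thesis
      by (simp add: x eis_term_def norm_divide norm_power w_def int_weight_def a_def b_def)
  qed
  have "(\<lambda>(m, n). int_weight m * int_weight n) summable_on (UNIV \<times> UNIV)"
    using int_weight_prod_has_sum by (auto simp: summable_on_def)
  hence "(\<lambda>x. 4 * K ^ k * (case x of (m, n) \<Rightarrow> int_weight m * int_weight n)) summable_on (UNIV - {(0, 0)})"
    by (intro summable_on_cmult_right) (rule summable_on_subset_banach, auto)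
  thus ?thesis by (rule Infinite_Sum.abs_summable_on_comparison_test') (use bd in auto)
qed

lemma eisenstein_G_altdef: "eisenstein_G k \<tau> = infsum (eis_term k \<tau>) (UNIV - {(0, 0)})"
  by (simp add: eisenstein_G_def eis_term_def)

lemma eisenstein_G_has_sum:
  assumes "Im \<tau> > 0" "k \<ge> 4"
  shows "(eis_term k \<tau> has_sum eisenstein_G k \<tau>) (UNIV - {(0, 0)})"
  unfolding eisenstein_G_altdef
  by (rule has_sum_infsum, rule abs_summable_summable, rule eis_term_summable) fact+

text \<open>Absolute convergence permits summing over m first. Each row is then a value of a
  derivative of the cotangent, and rows n and -n combine to \<open>cot_term\<close>.\<close>

lemma eisenstein_G_eq_eis:
  assumes \<tau>: "Im \<tau> > 0" and k: "k \<ge> 4" "even k"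
  shows "eisenstein_G k \<tau> = eis k \<tau>"
proof -
  define j where "j = k - 1"
  have j: "Suc j = k" "odd j" "j > 0" using k by (auto simp: j_def)
  \<comment> \<open>Row 0 lacks its term m = 0; \<open>prod.swap\<close> makes the row index the
    outer one.\<close>
  define A where "A = (\<lambda>n::int. if n = 0 then - {0 :: int} else UNIV)"
  define g where "g = (\<lambda>n::int. - (if n = 0 then pcot_reg j 0 else pcot j (of_int n * \<tau>)) / fact j)"
  have "(eis_term k \<tau> has_sum eisenstein_G k \<tau>) (prod.swap ` Sigma UNIV A)"
  proof -
    have "prod.swap ` Sigma UNIV A = UNIV - {(0, 0)}"
      by (auto simp: A_def image_iff split: if_splits)
    thus ?thesis using eisenstein_G_has_sum[OF \<tau> k(1)] by simp
  qed
  hence 1: "((eis_term k \<tau> \<circ> prod.swap) has_sum eisenstein_G k \<tau>) (Sigma UNIV A)"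
    by (subst (asm) has_sum_reindex) auto
  have 2: "((\<lambda>m. (eis_term k \<tau> \<circ> prod.swap) (n, m)) has_sum g n) (A n)" for n
  proof (cases "n = 0")
    case True
    thus ?thesis using pcot_reg_0_sums[OF j(2)] by (simp add: eis_term_def g_def A_def j del: power_Suc)
  next
    case False
    hence "of_int n * \<tau> \<notin> \<int>" using \<tau> by (intro Im_not_Ints) auto
    from pcot_sums[OF this j(3)] show ?thesis
      using False j(2) by (simp add: eis_term_def g_def A_def j(1) del: power_Suc)
  qed
  have g: "(g has_sum eisenstein_G k \<tau>) UNIV"
    by (rule has_sum_SigmaD[OF 1 2])
  hence "(\<lambda>n. g (int (Suc n)) + g (- int (Suc n))) sums (eisenstein_G k \<tau> - g 0)"
    by (intro has_sum_int_imp_sums) (auto simp: summable_on_def)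
  moreover have "g (int (Suc n)) + g (- int (Suc n)) = - cot_term 0 j \<tau> 0 n / fact j" for n
    unfolding g_def cot_term_def by (simp add: field_simps del: of_nat_Suc)
  ultimately have "(\<lambda>n. - cot_term 0 j \<tau> 0 n / fact j) sums (eisenstein_G k \<tau> - g 0)" by simp
  moreover have "(\<lambda>n. - cot_term 0 j \<tau> 0 n / fact j) sums (- cot_series 0 j \<tau> 0 / fact j)"
    unfolding cot_series_def by (intro sums_divide sums_minus summable_sums summable_cot_term \<tau>) auto
  ultimately have "eisenstein_G k \<tau> - g 0 = - cot_series 0 j \<tau> 0 / fact j"
    by (rule sums_unique2)
  hence "eisenstein_G k \<tau> = g 0 + - cot_series 0 j \<tau> 0 / fact j" by (simp add: diff_eq_eq)
  thus ?thesis
    unfolding eis_def zeta_reg_def j_def[symmetric] by (simp add: g_def diff_divide_distrib)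
qed

lemma eisenstein_G_modular:
  fixes a b c d :: int
  assumes det: "a * d - b * c = 1" and nz: "of_int c * \<tau> + of_int d \<noteq> 0"
  shows "eisenstein_G k ((of_int a * \<tau> + of_int b) / (of_int c * \<tau> + of_int d)) =
    (of_int c * \<tau> + of_int d) ^ k * eisenstein_G k \<tau>"
proof -
  define u where "u = of_int c * \<tau> + of_int d"
  \<comment> \<open>Clearing the denominator of the transformed point turns (m, n) into
    \<open>h (m, n)\<close>; \<open>h'\<close> is the inverse because the determinant is 1.\<close>
  define h where "h = (\<lambda>(m, n). (m * d + n * b, m * c + n * a))"
  define h' where "h' = (\<lambda>(m, n). (m * a - n * b, - m * c + n * d))"
  have hh': "h (h' x) = x" and h'h: "h' (h x) = x" for x
  proof -
    obtain m n where x: "x = (m, n)" by (cases x)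
    have "m * (a * d - b * c) = m" "n * (a * d - b * c) = n" unfolding det by simp_all
    thus "h (h' x) = x" "h' (h x) = x" by (simp_all add: x h_def h'_def algebra_simps)
  qed
  have h0: "h x = (0, 0) \<longleftrightarrow> x = (0, 0)" for x
  proof
    assume "h x = (0, 0)"
    hence "h' (h x) = (0, 0)" by (simp add: h'_def)
    thus "x = (0, 0)" by (simp add: h'h)
  qed (simp add: h_def)
  have h'0: "h' x = (0, 0) \<longleftrightarrow> x = (0, 0)" for x
    using h0[of "h' x"] hh'[of x] by auto
  have "eis_term k ((of_int a * \<tau> + of_int b) / (of_int c * \<tau> + of_int d)) x = u ^ k * eis_term k \<tau> (h x)" for x
  proof -
    obtain m n where x: "x = (m, n)" by (cases x)
    have "of_int m + of_int n * ((of_int a * \<tau> + of_int b) / u) =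
        (of_int (m * d + n * b) + of_int (m * c + n * a) * \<tau>) / u"
      using nz unfolding u_def by (simp add: field_simps)
    thus ?thesis by (simp add: eis_term_def x h_def u_def power_divide)
  qed
  hence "eisenstein_G k ((of_int a * \<tau> + of_int b) / (of_int c * \<tau> + of_int d)) =
      infsum (\<lambda>x. u ^ k * eis_term k \<tau> (h x)) (UNIV - {(0, 0)})"
    unfolding eisenstein_G_altdef by (intro infsum_cong)
  also have "\<dots> = u ^ k * infsum (\<lambda>x. eis_term k \<tau> (h x)) (UNIV - {(0, 0)})"
    by (rule infsum_cmult_right')
  also have "infsum (\<lambda>x. eis_term k \<tau> (h x)) (UNIV - {(0, 0)}) = eisenstein_G k \<tau>"
    unfolding eisenstein_G_altdef
    by (rule infsum_reindex_bij_witness[of _ h' h]) (auto simp: hh' h'h h0 h'0)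
  finally show ?thesis by (simp add: u_def)
qed

lemma Im_moebius:
  fixes a b c d :: int
  assumes det: "a * d - b * c = 1"
  shows "Im ((of_int a * \<tau> + of_int b) / (of_int c * \<tau> + of_int d)) =
     Im \<tau> / (norm (of_int c * \<tau> + of_int d))\<^sup>2"
proof -
  define u where "u = of_int c * \<tau> + of_int d"
  have "Im ((of_int a * \<tau> + of_int b) / u) = Im ((of_int a * \<tau> + of_int b) * cnj u) / (norm u)\<^sup>2"
    by (simp add: complex_div_cnj[of _ u] Im_divide_of_real flip: of_real_power)
  also have "Im ((of_int a * \<tau> + of_int b) * cnj u) = of_int (a * d - b * c) * Im \<tau>"
    by (simp add: u_def algebra_simps)
  finally show ?thesis by (simp add: det u_def)
qed

lemma eis_modular:
  fixes a b c d :: int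
  assumes det: "a * d - b * c = 1" and \<tau>: "Im \<tau> > 0" and k: "k \<ge> 4" "even k"
  shows "eis k ((of_int a * \<tau> + of_int b) / (of_int c * \<tau> + of_int d)) =
    (of_int c * \<tau> + of_int d) ^ k * eis k \<tau>"
    and "of_int c * \<tau> + of_int d \<noteq> 0"
    and "Im ((of_int a * \<tau> + of_int b) / (of_int c * \<tau> + of_int d)) > 0"
proof -
  show nz: "of_int c * \<tau> + of_int d \<noteq> 0"
  proof
    assume *: "of_int c * \<tau> + of_int d = 0"
    hence "Im (of_int c * \<tau> + of_int d) = 0" by simp
    hence "c = 0" using \<tau> by simp
    with * have "d = 0" by simp
    with \<open>c = 0\<close> det show False by simp
  qed
  show Im: "Im ((of_int a * \<tau> + of_int b) / (of_int c * \<tau> + of_int d)) > 0"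
    unfolding Im_moebius[OF det] using nz \<tau> by simp
  show "eis k ((of_int a * \<tau> + of_int b) / (of_int c * \<tau> + of_int d)) =
    (of_int c * \<tau> + of_int d) ^ k * eis k \<tau>"
    using eisenstein_G_modular[OF det nz, of k] by (simp add: eisenstein_G_eq_eis Im \<tau> k)
qed

text \<open>High in the half-plane only row 0 survives, and its contribution 2 \<zeta>(4) is
  non-zero.\<close>

lemma eis_4_lower_bound:
  obtains Y \<delta> where "Y > 0" "\<delta> > 0" "\<And>\<tau>. Im \<tau> \<ge> Y \<Longrightarrow> norm (eis 4 \<tau>) \<ge> \<delta>"
proof -
  obtain C where C: "C \<ge> 0"
    "\<And>\<tau> z n \<delta>. real (Suc n) * Im \<tau> - \<bar>Im z\<bar> \<ge> \<delta> \<Longrightarrow> \<delta> \<ge> 2 \<Longrightarrow>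
       norm (cot_term 0 3 \<tau> z n) \<le> C * real (Suc n) ^ 0 * exp (-2 * pi * \<delta>)"
    using cot_term_bound[of 0 3] by auto
  have "Polygamma 3 (1 :: real) > 0"
    by (rule Polygamma_real_odd_pos) (auto elim!: nonpos_Ints_cases)
  hence "Polygamma 3 (1 :: complex) \<noteq> 0" using Polygamma_of_real[of 1 3, where 'a = complex] by simp
  hence p: "norm (pcot_reg 3 0) > 0" by (simp add: pcot_reg_def)
  define P where "P = norm (pcot_reg 3 0)"
  have ev: "eventually (\<lambda>y::real. 2 * C * exp (- 2 * pi * y) < P / 2) at_top"
  proof (rule order_tendstoD)
    have "((\<lambda>y. exp (- 2 * pi * y)) \<longlongrightarrow> 0) at_top" by real_asymp
    thus "((\<lambda>y. 2 * C * exp (- 2 * pi * y)) \<longlongrightarrow> 0) at_top" by (rule tendsto_mult_right_zero)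
  qed (use p in \<open>simp add: P_def\<close>)
  then obtain Y0 where Y0: "\<And>y. y \<ge> Y0 \<Longrightarrow> 2 * C * exp (- 2 * pi * y) < P / 2"
    by (auto simp: eventually_at_top_linorder)
  \<comment> \<open>This is half of the limit: \<open>eis 4\<close> divides by 3! = 6, and the other
    rows take away at most P / 2.\<close>
  have "norm (eis 4 \<tau>) \<ge> P / 12" if "Im \<tau> \<ge> max 2 Y0" for \<tau>
  proof -
    define x where "x = exp (- 2 * pi * Im \<tau>)"
    have Im: "Im \<tau> \<ge> 2" using that by simp
    have "x \<le> exp (-1)" unfolding x_def using Im pi_gt3 mult_mono[of 1 "2 * pi" 1 "Im \<tau>"] by simp
    also have "exp (-1::real) \<le> 1/2" using exp_ge_add_one_self[of 1] by (simp add: exp_minus field_simps)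
    finally have x: "0 \<le> x" "x \<le> 1 / 2" by (auto simp: x_def)
    have "norm (cot_term 0 3 \<tau> 0 n) \<le> C * x ^ Suc n" for n
    proof -
      have "1 * 2 \<le> real (Suc n) * Im \<tau>" using Im by (intro mult_mono) auto
      hence "norm (cot_term 0 3 \<tau> 0 n) \<le> C * exp (-2 * pi * (real (Suc n) * Im \<tau>))"
        using C(2)[where \<tau> = \<tau> and z = 0 and n = n and \<delta> = "real (Suc n) * Im \<tau>"] by simp
      also have "exp (-2 * pi * (real (Suc n) * Im \<tau>)) = x ^ Suc n"
        unfolding x_def exp_of_nat_mult[symmetric] by (simp add: mult_ac)
      finally show ?thesis .
    qed
    moreover have "(\<lambda>n. C * x ^ Suc n) sums (C * (x * (1 / (1 - x))))"
      using sums_mult[OF sums_mult[OF geometric_sums[of x]], of C x] x by simp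
    ultimately have "norm (cot_series 0 3 \<tau> 0) \<le> C * (x * (1 / (1 - x)))"
      unfolding cot_series_def by (metis norm_suminf_le sums_unique sums_summable)
    also have "\<dots> \<le> C * (x * 2)"
      using x C(1) by (intro mult_left_mono) (auto simp: field_simps)
    also have "\<dots> < P / 2" using Y0[of "Im \<tau>"] that by (simp add: x_def mult_ac)
    finally have "norm (cot_series 0 3 \<tau> 0) < P / 2" .
    hence "norm (pcot_reg 3 0 + cot_series 0 3 \<tau> 0) \<ge> P / 2"
      using norm_diff_ineq[of "pcot_reg 3 0" "cot_series 0 3 \<tau> 0"] by (simp add: P_def)
    thus ?thesis unfolding eis_def zeta_reg_def norm_divide norm_minus_cancel by (simp add: fact_numeral)
  qed
  thus thesis using p by (intro that[of "max 2 Y0" "P / 12"]) (auto simp: P_def)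
qed

text \<open>Outside \<open>F\<close> each term is at most 1 / q times a product of two weights. All
  these products sum to at most (10 / 3)^2 = 100 / 9, from which the one at the origin and those in
  \<open>F\<close> are removed.\<close>

lemma eisenstein_G_approx:
  assumes \<tau>: "Im \<tau> > 0" and k: "k \<ge> 4" and F: "finite F" "(0, 0) \<notin> F" and q: "q > 0"
    and bound: "\<And>m n. (m, n) \<noteq> (0, 0) \<Longrightarrow> (m, n) \<notin> F \<Longrightarrow>
       q * ((1 + of_int m ^ 2) * (1 + of_int n ^ 2)) \<le> norm (of_int m + of_int n * \<tau>) ^ k"
  shows "norm (eisenstein_G k \<tau> - (\<Sum>x\<in>F. eis_term k \<tau> x)) \<le>
     (100 / 9 - 1 - (\<Sum>(m, n)\<in>F. int_weight m * int_weight n)) / q"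
proof -
  define g where "g = (\<lambda>(m, n). int_weight m * int_weight n)"
  define X where "X = UNIV - {(0 :: int, 0 :: int)} - F"
  have 1: "(eis_term k \<tau> has_sum (eisenstein_G k \<tau> - (\<Sum>x\<in>F. eis_term k \<tau> x))) X"
    unfolding X_def using F by (intro has_sum_Diff eisenstein_G_has_sum[OF \<tau> k] has_sum_finite) auto
  have "(g has_sum ((infsum int_weight UNIV)\<^sup>2 - sum g (insert (0, 0) F))) (UNIV - insert (0, 0) F)"
    using F by (intro has_sum_Diff has_sum_finite) (use int_weight_prod_has_sum in \<open>auto simp: g_def\<close>)
  moreover have "UNIV - insert (0, 0) F = X" by (auto simp: X_def)
  moreover have "sum g (insert (0, 0) F) = 1 + sum g F"
    using F by (simp add: g_def int_weight_def)
  ultimately have "(g has_sum ((infsum int_weight UNIV)\<^sup>2 - (1 + sum g F))) X" by simp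
  from has_sum_cmult_left[OF this, of "1 / q"]
  have 2: "((\<lambda>x. g x / q) has_sum (((infsum int_weight UNIV)\<^sup>2 - (1 + sum g F)) / q)) X" by simp
  have "norm (eisenstein_G k \<tau> - (\<Sum>x\<in>F. eis_term k \<tau> x)) \<le> ((infsum int_weight UNIV)\<^sup>2 - (1 + sum g F)) / q"
  proof (rule norm_infsum_le[OF 1 2])
    fix x assume "x \<in> X"
    obtain m n where x: "x = (m, n)" by (cases x)
    have b: "q * ((1 + of_int m ^ 2) * (1 + of_int n ^ 2)) \<le> norm (of_int m + of_int n * \<tau>) ^ k"
      using \<open>x \<in> X\<close> by (intro bound) (auto simp: X_def x)
    have pos: "q * ((1 + of_int m ^ 2) * (1 + of_int n ^ 2)) > (0 :: real)"
      using q by (intro mult_pos_pos) (auto intro: add_pos_nonneg)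
    hence "1 / norm (of_int m + of_int n * \<tau>) ^ k \<le> 1 / (q * ((1 + of_int m ^ 2) * (1 + of_int n ^ 2)))"
      using b by (intro divide_left_mono) auto
    thus "norm (eis_term k \<tau> x) \<le> g x / q"
      by (simp add: x eis_term_def g_def int_weight_def norm_divide norm_power mult_ac)
  qed
  also have "\<dots> \<le> (100 / 9 - 1 - sum g F) / q"
  proof -
    have "infsum int_weight UNIV \<ge> 0" by (intro infsum_nonneg) (use int_weight_pos in \<open>auto intro: less_imp_le\<close>)
    hence "(infsum int_weight UNIV)\<^sup>2 \<le> (10 / 3)\<^sup>2"
      using int_weight_infsum_le by (intro power_mono) auto
    thus ?thesis using q by (intro divide_right_mono) (auto simp: power2_eq_square)
  qed
  finally show ?thesis by (simp add: g_def case_prod_unfold)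
qed

section \<open>Signs and values at the elliptic points\<close>

lemma small_int_cases:
  fixes m :: int
  assumes "m\<^sup>2 \<le> 8"
  shows "m \<in> {-2, -1, 0, 1, 2}"
proof -
  have "\<bar>m\<bar> < 3"
  proof (rule ccontr)
    assume "\<not> \<bar>m\<bar> < 3"
    hence "3\<^sup>2 \<le> \<bar>m\<bar>\<^sup>2" by (intro power_mono) auto
    thus False using assms by simp
  qed
  thus ?thesis by auto
qed

lemma eisenstein_G_4_i_approx: "norm (eisenstein_G 4 \<i> - 3) < 3"
proof -
  \<comment> \<open>The eight non-zero Gaussian integers of norm at most 2 contribute 3 and have
    total weight 3, so the error is at most (100/9 - 4) / (5/2) < 3. Equality for the factor 5/2
    occurs at (2, 1).\<close>
  define F :: "(int \<times> int) set" where "F = {(1, 0), (-1, 0), (0, 1), (0, -1), (1, 1), (1, -1), (-1, 1), (-1, -1 :: int)}"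
  have "norm (eisenstein_G 4 \<i> - (\<Sum>x\<in>F. eis_term 4 \<i> x)) \<le>
     (100 / 9 - 1 - (\<Sum>(m, n)\<in>F. int_weight m * int_weight n)) / (5 / 2)"
  proof (rule eisenstein_G_approx)
    fix m n :: int assume mn: "(m, n) \<noteq> (0, 0)" "(m, n) \<notin> F"
    have nrm: "norm (of_int m + of_int n * \<i>) ^ 4 = (of_int (m\<^sup>2 + n\<^sup>2))\<^sup>2"
      using cmod_power2[of "of_int m + of_int n * \<i>"] power_mult[of "norm (of_int m + of_int n * \<i>)" 2 2] by simp
    have "5 * ((1 + m\<^sup>2) * (1 + n\<^sup>2)) \<le> 2 * (m\<^sup>2 + n\<^sup>2)\<^sup>2"
    proof (cases "m\<^sup>2 + n\<^sup>2 \<le> 8")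
      case True
      have "m \<in> {-2, -1, 0, 1, 2}" "n \<in> {-2, -1, 0, 1, 2}"
        using True zero_le_power2[of m] zero_le_power2[of n] by (intro small_int_cases; linarith)+
      thus ?thesis using mn unfolding F_def by (elim insertE emptyE) auto
    next
      case False
      define s where "s = m\<^sup>2 + n\<^sup>2"
      have "0 \<le> (m\<^sup>2 - n\<^sup>2)\<^sup>2" by simp
      hence p: "4 * (m\<^sup>2 * n\<^sup>2) \<le> s\<^sup>2" by (simp add: s_def power2_eq_square algebra_simps)
      have s9: "s \<ge> 9" using False by (simp add: s_def)
      hence "9 * s \<le> s * s" by (intro mult_right_mono) auto
      moreover have "20 * (1 + s) + 5 * a \<le> 8 * a" if "9 * s \<le> a" for a
        unfolding distrib_left using that s9 by linarith
      ultimately have "20 * (1 + s) + 5 * s\<^sup>2 \<le> 8 * s\<^sup>2" by (simp only: power2_eq_square)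
      hence "20 * (1 + s) + 20 * (m\<^sup>2 * n\<^sup>2) \<le> 8 * s\<^sup>2" using p by linarith
      moreover have "(1 + m\<^sup>2) * (1 + n\<^sup>2) = 1 + s + m\<^sup>2 * n\<^sup>2" by (simp add: s_def algebra_simps)
      moreover have "5 * (1 + s + p) \<le> 2 * q" if "20 * (1 + s) + 20 * p \<le> 8 * q" for p q
        using that unfolding distrib_left by linarith
      ultimately show ?thesis unfolding s_def[symmetric] by simp
    qed
    hence "real_of_int (5 * ((1 + m\<^sup>2) * (1 + n\<^sup>2))) \<le> real_of_int (2 * (m\<^sup>2 + n\<^sup>2)\<^sup>2)"
      by (simp only: of_int_le_iff)
    thus "5 / 2 * ((1 + of_int m ^ 2) * (1 + of_int n ^ 2)) \<le> norm (of_int m + of_int n * \<i>) ^ 4"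
      unfolding nrm by simp
  qed (auto simp: F_def)
  also have "(\<Sum>(m, n)\<in>F. int_weight m * int_weight n) = 3"
    by (simp add: F_def int_weight_def)
  also have "(\<Sum>x\<in>F. eis_term 4 \<i> x) = 3"
  proof -
    have "(1 + \<i>) ^ 4 = -4" "(1 - \<i>) ^ 4 = -4" "(- 1 + \<i>) ^ 4 = -4" "(- 1 - \<i>) ^ 4 = -4" "(- \<i> - 1) ^ 4 = -4"
      by (simp_all add: power4_eq_xxxx algebra_simps)
    thus ?thesis by (simp add: F_def eis_term_def)
  qed
  finally show ?thesis by simp
qed

lemma rho_altdef: "rho = Complex (1 / 2) (sqrt 3 / 2)"
proof -
  have "rho = cis (pi / 3)" unfolding rho_def cis_conv_exp by (simp add: mult_ac)
  thus ?thesis by (simp add: complex_eq_iff cos_60 sin_60)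
qed

lemma Im_rho: "Im rho = sqrt 3 / 2" by (simp add: rho_altdef)

lemma rho_squared: "rho ^ 2 = rho - 1"
  by (simp add: rho_altdef complex_eq_iff power2_eq_square)

lemma rho_powers: "rho ^ 3 = -1" "rho ^ 4 = - rho" "rho ^ 6 = 1"
proof -
  have "rho ^ 3 = rho ^ 2 * rho" by (simp add: power3_eq_cube power2_eq_square)
  also have "\<dots> = rho * rho - rho" unfolding rho_squared by (simp add: algebra_simps)
  also have "\<dots> = -1" using rho_squared by (simp add: power2_eq_square)
  finally show 3: "rho ^ 3 = -1" .
  show "rho ^ 4 = - rho" "rho ^ 6 = 1"
    using power_add[of rho 3 1] power_add[of rho 3 3] unfolding 3 by simp_all
qed

lemma eisenstein_G_6_rho_approx: "norm (eisenstein_G 6 rho - 6) < 6"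
proof -
  \<comment> \<open>The six units of the Eisenstein integers, each with sixth power 1. Their total
    weight is 5/2, so the error is at most (100/9 - 7/2) / 2 < 6.\<close>
  define F :: "(int \<times> int) set" where "F = {(1, 0), (-1, 0), (0, 1), (0, -1), (1, -1), (-1, 1 :: int)}"
  have "norm (eisenstein_G 6 rho - (\<Sum>x\<in>F. eis_term 6 rho x)) \<le>
     (100 / 9 - 1 - (\<Sum>(m, n)\<in>F. int_weight m * int_weight n)) / 2"
  proof (rule eisenstein_G_approx)
    fix m n :: int assume mn: "(m, n) \<noteq> (0, 0)" "(m, n) \<notin> F"
    \<comment> \<open>The norm form of the Eisenstein integers.\<close>
    define N where "N = m\<^sup>2 + m * n + n\<^sup>2"
    have "norm (of_int m + of_int n * rho) ^ 2 = of_int N"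
      using cmod_power2[of "of_int m + of_int n * rho"]
      by (simp add: rho_altdef N_def power2_eq_square algebra_simps)
    hence nrm: "norm (of_int m + of_int n * rho) ^ 6 = (of_int N) ^ 3"
      using power_mult[of "norm (of_int m + of_int n * rho)" 2 3] by simp
    have N4: "4 * N = (2 * m + n)\<^sup>2 + 3 * n\<^sup>2" "4 * N = (2 * n + m)\<^sup>2 + 3 * m\<^sup>2" "2 * N = m\<^sup>2 + n\<^sup>2 + (m + n)\<^sup>2"
      by (simp_all add: N_def power2_eq_square algebra_simps)
    have "2 * ((1 + m\<^sup>2) * (1 + n\<^sup>2)) \<le> N ^ 3"
    proof (cases "N \<le> 3")
      case True
      have "m\<^sup>2 \<le> 8" "n\<^sup>2 \<le> 8"
        using True N4 zero_le_power2[of "2 * m + n"] zero_le_power2[of "2 * n + m"] by linarith+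
      from this[THEN small_int_cases] have "m \<in> {-2, -1, 0, 1, 2}" "n \<in> {-2, -1, 0, 1, 2}" .
      thus ?thesis using mn True unfolding F_def N_def by (elim insertE emptyE) auto
    next
      case False
      have s: "m\<^sup>2 + n\<^sup>2 \<le> 2 * N" using N4(3) zero_le_power2[of "m + n"] by linarith
      have "\<bar>m * n\<bar> \<le> N"
      proof -
        have "0 \<le> (m - n)\<^sup>2" "0 \<le> (m + n)\<^sup>2" by simp_all
        thus ?thesis using zero_le_power2[of m] zero_le_power2[of n]
          unfolding N_def by (simp add: power2_eq_square algebra_simps abs_le_iff)
      qed
      hence "\<bar>m * n\<bar>\<^sup>2 \<le> N\<^sup>2" by (intro power_mono) auto
      hence p: "m\<^sup>2 * n\<^sup>2 \<le> N\<^sup>2" by (simp add: power_mult_distrib)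
      have "2 * ((1 + m\<^sup>2) * (1 + n\<^sup>2)) = 2 * (1 + (m\<^sup>2 + n\<^sup>2) + m\<^sup>2 * n\<^sup>2)" by (simp add: algebra_simps)
      also have "\<dots> \<le> 2 * (1 + 2 * N + N\<^sup>2)"
        by (intro mult_left_mono add_mono order_refl s p) simp
      also have "\<dots> \<le> N ^ 3"
      proof -
        have "4 * N \<le> N\<^sup>2" using False by (simp add: power2_eq_square)
        moreover have "4 * N\<^sup>2 \<le> N ^ 3" using False by (simp add: power2_eq_square power3_eq_cube)
        moreover have "2 * (1 + 2 * N + a) \<le> b" if "4 * N \<le> a" "4 * a \<le> b" for a b
          unfolding distrib_left using that False by linarith
        ultimately show ?thesis by blast
      qed
      finally show ?thesis .
    qed
    hence "real_of_int (2 * ((1 + m\<^sup>2) * (1 + n\<^sup>2))) \<le> real_of_int (N ^ 3)"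
      by (simp only: of_int_le_iff)
    thus "2 * ((1 + of_int m ^ 2) * (1 + of_int n ^ 2)) \<le> norm (of_int m + of_int n * rho) ^ 6"
      unfolding nrm by simp
  qed (auto simp: F_def Im_rho)
  also have "(\<Sum>(m, n)\<in>F. int_weight m * int_weight n) = 5 / 2"
    by (simp add: F_def int_weight_def)
  also have "(\<Sum>x\<in>F. eis_term 6 rho x) = 6"
  proof -
    have "(1 - rho) ^ 6 = 1" "(- 1 + rho) ^ 6 = 1"
    proof -
      have "rho - 1 = rho ^ 2" "1 - rho = - (rho ^ 2)" using rho_squared by simp_all
      moreover have "(rho ^ 2) ^ 6 = 1" using rho_powers(3) by (metis power_mult mult.commute power_one)
      ultimately show "(1 - rho) ^ 6 = 1" "(- 1 + rho) ^ 6 = 1"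
        by (metis power_minus_even even_numeral) (metis \<open>(rho\<^sup>2) ^ 6 = 1\<close> \<open>rho - 1 = rho\<^sup>2\<close> uminus_add_conv_diff)
    qed
    thus ?thesis by (simp add: F_def eis_term_def rho_powers)
  qed
  finally show ?thesis by simp
qed

text \<open>Complex conjugation permutes the lattice, so the value is real; the sign comes from the
  estimate.\<close>

lemma eisenstein_G_4_i: "eisenstein_G 4 \<i> = of_real (Re (eisenstein_G 4 \<i>))" "Re (eisenstein_G 4 \<i>) > 0"
proof -
  have "cnj (eisenstein_G 4 \<i>) = infsum (\<lambda>x. cnj (eis_term 4 \<i> x)) (UNIV - {(0, 0)})"
    by (simp add: eisenstein_G_altdef infsum_cnj)
  also have "\<dots> = eisenstein_G 4 \<i>"
    unfolding eisenstein_G_altdef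
    by (rule infsum_reindex_bij_witness[of _ "\<lambda>(m, n). (m, -n)" "\<lambda>(m, n). (m, -n)"])
       (auto simp: eis_term_def)
  finally show "eisenstein_G 4 \<i> = of_real (Re (eisenstein_G 4 \<i>))"
    by (simp add: complex_eq_iff)
  show "Re (eisenstein_G 4 \<i>) > 0"
    using eisenstein_G_4_i_approx abs_Re_le_cmod[of "eisenstein_G 4 \<i> - 3"] by simp
qed

lemma cnj_rho: "cnj rho = 1 - rho"
  by (simp add: rho_altdef complex_eq_iff)

lemma eisenstein_G_6_rho: "eisenstein_G 6 rho = of_real (Re (eisenstein_G 6 rho))" "Re (eisenstein_G 6 rho) > 0"
proof -
  have "cnj (eisenstein_G 6 rho) = infsum (\<lambda>x. cnj (eis_term 6 rho x)) (UNIV - {(0, 0)})"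
    by (simp add: eisenstein_G_altdef infsum_cnj)
  also have "\<dots> = eisenstein_G 6 rho"
    unfolding eisenstein_G_altdef
    \<comment> \<open>Conjugation sends m + n \<rho> to (m + n) - n \<rho>.\<close>
    by (rule infsum_reindex_bij_witness[of _ "\<lambda>(m, n). (m + n, -n)" "\<lambda>(m, n). (m + n, -n)"])
       (auto simp: eis_term_def cnj_rho algebra_simps)
  finally show "eisenstein_G 6 rho = of_real (Re (eisenstein_G 6 rho))"
    by (simp add: complex_eq_iff)
  show "Re (eisenstein_G 6 rho) > 0"
    using eisenstein_G_6_rho_approx abs_Re_le_cmod[of "eisenstein_G 6 rho - 6"] by simp
qed

text \<open>At a fixed point the chain rule turns the modular relation into a linear equation
  between value and derivative. Together with Ramanujan's equations it yields \<open>eis 2\<close>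
  there. The condition u^k = 1 is the one under which \<open>eis k\<close> can be non-zero at the
  fixed point.\<close>

lemma eis_deriv_elliptic_point:
  fixes a b c d :: int
  assumes det: "a * d - b * c = 1" and \<tau>: "Im \<tau> > 0" and k: "k \<ge> 4" "even k"
    and fixed: "(of_int a * \<tau> + of_int b) / (of_int c * \<tau> + of_int d) = \<tau>"
    and u: "u = of_int c * \<tau> + of_int d" "u ^ k = 1"
    and D: "(eis k has_field_derivative D) (at \<tau>)"
  shows "D * (1 - u ^ 2) = of_nat k * of_int c * u * eis k \<tau>"
proof -
  have nz: "u \<noteq> 0" using eis_modular(2)[OF det \<tau> k] u by simp
  define \<gamma> where "\<gamma> = (\<lambda>t :: complex. (of_int a * t + of_int b) / (of_int c * t + of_int d))"
  have "(\<gamma> has_field_derivative (of_int a * u - (of_int a * \<tau> + of_int b) * of_int c) / (u * u)) (at \<tau>)"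
    unfolding \<gamma>_def u(1) by (rule derivative_eq_intros refl | use nz in \<open>simp add: u\<close>)+
  also have "of_int a * u - (of_int a * \<tau> + of_int b) * of_int c = of_int (a * d - b * c)"
    by (simp add: u algebra_simps)
  finally have g: "(\<gamma> has_field_derivative 1 / (u * u)) (at \<tau>)" by (simp add: det)
  have "\<gamma> \<tau> = \<tau>" using fixed by (simp add: \<gamma>_def)
  hence "((\<lambda>t. eis k (\<gamma> t)) has_field_derivative D * (1 / (u * u))) (at \<tau>)"
    using D g by (intro DERIV_chain2[of "eis k"]) auto
  note D1 = this
  have ev: "eventually (\<lambda>t. eis k (\<gamma> t) = (of_int c * t + of_int d) ^ k * eis k t) (nhds \<tau>)"
  proof -
    have "open {t. Im t > 0}" by (simp add: open_halfspace_Im_gt)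
    from eventually_nhds_in_open[OF this, of \<tau>] \<tau>
    have "eventually (\<lambda>t. Im t > 0) (nhds \<tau>)" by simp
    thus ?thesis by eventually_elim (unfold \<gamma>_def, rule eis_modular(1)[OF det _ k])
  qed
  have 1: "((\<lambda>t. (of_int c * t + of_int d) ^ k * eis k t) has_field_derivative D * (1 / (u * u))) (at \<tau>)"
    by (rule DERIV_cong_ev[OF refl ev refl, THEN iffD1, OF D1])
  have 2: "((\<lambda>t. (of_int c * t + of_int d) ^ k * eis k t) has_field_derivative
      (of_nat k * u ^ (k - 1) * of_int c * eis k \<tau> + u ^ k * D)) (at \<tau>)"
    using D by (auto intro!: derivative_eq_intros simp: u(1) mult_ac)
  have "D * (1 / (u * u)) = of_nat k * u ^ (k - 1) * of_int c * eis k \<tau> + u ^ k * D"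
    by (rule DERIV_unique[OF 1 2])
  moreover have "u ^ (k - 1) = 1 / u"
    using u(2) k nz power_Suc[of u "k - 1"] by (simp add: field_simps)
  ultimately have "D * (1 / (u * u)) = of_nat k * (1 / u) * of_int c * eis k \<tau> + D" using u(2) by simp
  thus ?thesis using nz by (simp add: field_simps power2_eq_square)
qed

text \<open>The map \<tau> -> -1 / \<tau> fixes i with automorphy factor i: since i^6 = -1,
  \<open>eis 6\<close> vanishes, and since i^4 = 1, the derivative of \<open>eis 4\<close>
  determines \<open>eis 2\<close>.\<close>

lemma eis_at_i:
  obtains r where "r > 0" "eis 4 \<i> = of_real r" "eis 6 \<i> = 0" "eis 2 \<i> = of_real (pi / Im \<i>)"
proof -
  define r where "r = Re (eisenstein_G 4 \<i>)"
  have r: "r > 0" "eis 4 \<i> = of_real r"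
    using eisenstein_G_4_i eisenstein_G_eq_eis[of \<i> 4] by (simp_all add: r_def)
  have e6: "eis 6 \<i> = 0"
  proof -
    have "\<i> ^ 6 = (\<i> ^ 2) ^ 3" by (simp flip: power_mult)
    hence "\<i> ^ 6 = -1" by simp
    thus ?thesis using eis_modular(1)[of 0 0 "-1" 1 \<i> 6] by simp
  qed
  define D where "D = (14 * eis 6 \<i> - 4 * eis 2 \<i> * eis 4 \<i>) / (2 * of_real pi * \<i>)"
  have "(eis 4 has_field_derivative D) (at \<i>)" unfolding D_def by (rule ramanujan_eis) simp
  hence "D * (1 - \<i> ^ 2) = of_nat 4 * of_int 1 * \<i> * eis 4 \<i>"
    by (intro eis_deriv_elliptic_point[of 0 0 "-1" 1]) auto
  hence "- 4 * eis 2 \<i> * eis 4 \<i> = - 4 * of_real pi * eis 4 \<i>"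
    by (simp add: D_def e6 field_simps)
  hence "eis 2 \<i> = of_real pi" using r by simp
  thus thesis using that r e6 by simp
qed

text \<open>The argument of j in the theorem at t = 0, where \<open>c_rho\<close> vanishes. It is
  equivalent to \<rho> under the modular group without being equal to it.\<close>

definition tau_rho :: complex where "tau_rho = (rho + 1) / 3"

lemma tau_rho_altdef: "tau_rho = Complex (1 / 2) (sqrt 3 / 6)"
  by (simp add: tau_rho_def rho_altdef complex_eq_iff)

text \<open>The matrix with rows (2, -1) and (3, -1) fixes \<open>tau_rho\<close> with automorphy
  factor \<rho>: \<rho>^4 \<noteq> 1 makes \<open>eis 4\<close> vanish, and \<rho>^6 = 1 lets the
  derivative of \<open>eis 6\<close> determine \<open>eis 2\<close>.\<close>

lemma eis_at_tau_rho:
  obtains r where "r > 0" "eis 6 tau_rho = - of_real r" "eis 4 tau_rho = 0"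
    "eis 2 tau_rho = of_real (pi / Im tau_rho)"
proof -
  \<comment> \<open>The value is transported from \<rho> by -1 / \<open>tau_rho\<close> = \<rho> -
    2; the sixth power of \<open>tau_rho\<close> is -1/27, which explains the factor and the
    sign.\<close>
  define r where "r = 27 * Re (eisenstein_G 6 rho)"
  have Im: "Im tau_rho > 0" by (simp add: tau_rho_altdef)
  have nz: "tau_rho \<noteq> 0" using Im by auto
  have r0: "r > 0" using eisenstein_G_6_rho by (simp add: r_def)
  have sq: "tau_rho ^ 2 = tau_rho - 1 / 3"
    using rho_squared by (simp add: tau_rho_def power2_eq_square field_simps)
  have p6: "tau_rho ^ 6 = -1 / 27"
  proof -
    have "tau_rho ^ 6 = (tau_rho ^ 2) ^ 3" by (simp flip: power_mult)
    also have "tau_rho ^ 2 = rho / 3" unfolding sq by (simp add: tau_rho_def field_simps)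
    finally show ?thesis by (simp add: power_divide rho_powers)
  qed
  have "tau_rho * (rho - 2) = (rho ^ 2 - rho - 2) / 3"
    by (simp add: tau_rho_def field_simps power2_eq_square)
  also have "\<dots> = -1" by (simp add: rho_squared)
  finally have inv: "- 1 / tau_rho = rho - 2"
    using nz by (simp add: field_simps)
  have "eis 6 (rho - 2) = eis 6 rho"
    using eis_modular(1)[of 1 1 "-2" 0 rho 6] by (simp add: Im_rho)
  moreover have "eis 6 (- 1 / tau_rho) = tau_rho ^ 6 * eis 6 tau_rho"
    using eis_modular(1)[of 0 0 "-1" 1 tau_rho 6] Im by simp
  ultimately have "eis 6 rho = - 1 / 27 * eis 6 tau_rho" unfolding inv p6 by simp
  hence "eis 6 tau_rho = - (27 * eis 6 rho)" by simp
  hence e6: "eis 6 tau_rho = - of_real r"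
    using eisenstein_G_6_rho(1) eisenstein_G_eq_eis[of rho 6] by (simp add: r_def Im_rho)
  have u: "3 * tau_rho - 1 = rho" by (simp add: tau_rho_def add_divide_distrib)
  have fixed: "(of_int 2 * tau_rho + of_int (-1)) / (of_int 3 * tau_rho + of_int (-1)) = tau_rho"
  proof -
    have "rho \<noteq> 0" using Im_rho by auto
    moreover have "3 * tau_rho ^ 2 = 3 * tau_rho - 1" using sq by simp
    hence "2 * tau_rho - 1 = tau_rho * (3 * tau_rho - 1)" by (simp add: algebra_simps power2_eq_square)
    ultimately show ?thesis by (simp add: u nonzero_divide_eq_eq)
  qed
  have e4: "eis 4 tau_rho = 0"
  proof -
    have "eis 4 tau_rho = rho ^ 4 * eis 4 tau_rho"
      using eis_modular(1)[of 2 "-1" "-1" 3 tau_rho 4] Im fixed u by simp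
    moreover have "rho ^ 4 \<noteq> 1" unfolding rho_powers by (simp add: rho_altdef complex_eq_iff)
    ultimately show ?thesis by simp
  qed
  define D where "D = (60 / 7 * eis 4 tau_rho ^ 2 - 6 * eis 2 tau_rho * eis 6 tau_rho) / (2 * of_real pi * \<i>)"
  have "(eis 6 has_field_derivative D) (at tau_rho)" unfolding D_def by (rule ramanujan_eis) fact
  hence "D * (1 - rho ^ 2) = of_nat 6 * of_int 3 * rho * eis 6 tau_rho"
    by (intro eis_deriv_elliptic_point[of 2 "-1" "-1" 3, OF _ Im _ _ fixed]) (use u rho_powers in auto)
  hence D1: "D * (1 - rho ^ 2) = 18 * rho * eis 6 tau_rho" by simp
  have D2: "D * (2 * of_real pi * \<i>) = - 6 * eis 2 tau_rho * eis 6 tau_rho"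
    by (simp add: D_def e4)
  have "(- 6 * eis 2 tau_rho * eis 6 tau_rho) * (1 - rho ^ 2) = 2 * of_real pi * \<i> * (18 * rho * eis 6 tau_rho)"
    unfolding D1[symmetric] D2[symmetric] by (simp only: mult_ac)
  hence "6 * (eis 6 tau_rho * (eis 2 tau_rho * (1 - rho ^ 2) + 6 * of_real pi * \<i> * rho)) = 0"
    by algebra
  hence "eis 6 tau_rho * (eis 2 tau_rho * (1 - rho ^ 2) + 6 * of_real pi * \<i> * rho) = 0"
    by simp
  hence "eis 2 tau_rho * (1 - rho ^ 2) = - (6 * of_real pi * \<i> * rho)"
    using r0 by (simp add: e6 add_eq_0_iff)
  moreover have "1 - rho ^ 2 = - \<i> * sqrt 3 * rho"
    unfolding rho_squared by (simp add: rho_altdef complex_eq_iff)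
  moreover have "rho \<noteq> 0" using Im_rho by auto
  ultimately have "eis 2 tau_rho * sqrt 3 = 6 * of_real pi" by simp
  hence "eis 2 tau_rho = of_real (6 * pi / sqrt 3)" by (simp add: field_simps)
  also have "6 * pi / sqrt 3 = pi / Im tau_rho" by (simp add: tau_rho_altdef)
  finally show thesis using that r0 e6 e4 by simp
qed

section \<open>The hypergeometric series\<close>

text \<open>Coefficients of the power series solutions of \<open>((1 + t\<^sup>3) y')' = - t y\<close> and of
  \<open>((1 - 4 t\<^sup>2) y')' = y\<close>.\<close>

fun hyp3 :: "complex \<Rightarrow> complex \<Rightarrow> nat \<Rightarrow> complex" where
  "hyp3 a b 0 = a"
| "hyp3 a b (Suc 0) = b"
| "hyp3 a b (Suc (Suc 0)) = 0"
| "hyp3 a b (Suc (Suc (Suc k))) = - (of_nat (k + 1) ^ 2 / (of_nat (k + 2) * of_nat (k + 3))) * hyp3 a b k"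

fun hyp2 :: "complex \<Rightarrow> complex \<Rightarrow> nat \<Rightarrow> complex" where
  "hyp2 a b 0 = a"
| "hyp2 a b (Suc 0) = b"
| "hyp2 a b (Suc (Suc k)) = of_nat (2 * k + 1) ^ 2 / (of_nat (k + 1) * of_nat (k + 2)) * hyp2 a b k"

lemma norm_hyp3_le:
  assumes "norm a \<le> M" "norm b \<le> M"
  shows "norm (hyp3 a b k) \<le> M"
  using assms
proof (induction a b k rule: hyp3.induct)
  case (4 a b k)
  have "norm (of_nat (k + 1) ^ 2 / (of_nat (k + 2) * of_nat (k + 3)) :: complex) =
      real (k + 1) ^ 2 / (real (k + 2) * real (k + 3))"
    by (simp only: norm_divide norm_mult norm_power norm_of_nat)
  also have "\<dots> \<le> 1" by (subst pos_divide_le_eq, intro mult_pos_pos) (simp_all add: power2_eq_square algebra_simps)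
  finally have "norm (of_nat (k + 1) ^ 2 / (of_nat (k + 2) * of_nat (k + 3)) :: complex) * norm (hyp3 a b k) \<le> 1 * M"
    using 4 by (intro mult_mono) auto
  thus ?case by (simp only: hyp3.simps norm_mult norm_minus_cancel mult_1)
qed (auto intro: order_trans[OF norm_ge_zero])

lemma norm_hyp2_le:
  assumes "norm a \<le> M" "norm b \<le> M"
  shows "norm (hyp2 a b k) \<le> M * 2 ^ k"
  using assms
proof (induction a b k rule: hyp2.induct)
  case (2 a b)
  moreover have "0 \<le> M" using 2 norm_ge_zero[of b] by linarith
  ultimately show ?case by simp
next
  case (3 a b k)
  have "norm (of_nat (2 * k + 1) ^ 2 / (of_nat (k + 1) * of_nat (k + 2)) :: complex) =
      real (2 * k + 1) ^ 2 / (real (k + 1) * real (k + 2))"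
    by (simp only: norm_divide norm_mult norm_power norm_of_nat)
  also have "\<dots> \<le> 4" by (subst pos_divide_le_eq, intro mult_pos_pos) (simp_all add: power2_eq_square algebra_simps)
  finally have "norm (of_nat (2 * k + 1) ^ 2 / (of_nat (k + 1) * of_nat (k + 2)) :: complex) * norm (hyp2 a b k) \<le>
      4 * (M * 2 ^ k)"
    using 3 by (intro mult_mono) auto
  thus ?case by (simp only: hyp2.simps norm_mult norm_minus_cancel) simp
qed auto

lemma fps_conv_radius_geI_bound:
  fixes F :: "complex fps"
  assumes "r > 0" "\<And>n. norm (fps_nth F n) \<le> M / r ^ n"
  shows "fps_conv_radius F \<ge> ereal r"
  unfolding fps_conv_radius_def
proof (rule conv_radius_geI_ex')
  fix s assume s: "0 < s" "ereal s < ereal r"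
  have "summable (\<lambda>n. M * (s / r) ^ n)"
    using s assms(1) by (intro summable_mult summable_geometric) auto
  moreover have "norm (fps_nth F n * of_real s ^ n) \<le> M * (s / r) ^ n" for n
    using mult_right_mono[OF assms(2)[of n], of "s ^ n"] s
    by (simp add: norm_mult norm_power power_divide)
  ultimately show "summable (\<lambda>n. fps_nth F n * of_real s ^ n)"
    by (rule summable_comparison_test'[where N = 0])
qed

lemma hyp3_radius: "fps_conv_radius (Abs_fps (hyp3 a b)) \<ge> ereal 1"
  by (rule fps_conv_radius_geI_bound[where M = "max (norm a) (norm b)"]) (auto intro!: norm_hyp3_le)

lemma hyp2_radius: "fps_conv_radius (Abs_fps (hyp2 a b)) \<ge> ereal (1 / 2)"
  by (rule fps_conv_radius_geI_bound[where M = "max (norm a) (norm b)"])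
     (auto intro!: norm_hyp2_le simp: power_divide)

lemma divide_mult_eq_imp:
  fixes x q d c :: complex
  assumes "x = q / d * c" "d \<noteq> 0"
  shows "d * x = q * c"
  using assms by simp

lemma fps_deriv_deriv_hyp3:
  "fps_deriv ((1 + fps_X ^ 3) * fps_deriv (Abs_fps (hyp3 a b))) = - fps_X * Abs_fps (hyp3 a b)"
proof (rule fps_ext)
  fix n
  define c where "c = hyp3 a b"
  have rec: "of_nat (k + 2) * of_nat (k + 3) * c (k + 3) = - (of_nat (k + 1) ^ 2 * c k)" for k
  proof -
    have "k + 3 = Suc (Suc (Suc k))" by simp
    hence "c (k + 3) = - (of_nat (k + 1) ^ 2 / (of_nat (k + 2) * of_nat (k + 3))) * c k"
      unfolding c_def by (simp only: hyp3.simps)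
    moreover have "(of_nat (k + 2) * of_nat (k + 3) :: complex) \<noteq> 0"
      by (simp only: mult_eq_0_iff of_nat_eq_0_iff) simp
    ultimately show ?thesis unfolding minus_divide_left mult_minus_left [symmetric] by (rule divide_mult_eq_imp)
  qed
  have "fps_nth (fps_deriv ((1 + fps_X ^ 3) * fps_deriv (Abs_fps c))) n = fps_nth (- fps_X * Abs_fps c) n"
  proof (cases n)
    case 0
    have "c 2 = 0" by (simp add: c_def numeral_2_eq_2)
    thus ?thesis using 0 by (simp add: distrib_right fps_X_power_mult_nth numeral_2_eq_2)
  next
    case (Suc k)
    have "fps_nth (fps_deriv ((1 + fps_X ^ 3) * fps_deriv (Abs_fps c))) n =
        of_nat (k + 2) * (of_nat (k + 3) * c (k + 3) + of_nat k * c k)"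
    proof -
      have "fps_nth ((1 + fps_X ^ 3) * fps_deriv (Abs_fps c)) (k + 2) =
          of_nat (k + 3) * c (k + 3) + of_nat k * c k"
      proof -
        have "fps_nth (fps_X ^ 3 * fps_deriv (Abs_fps c)) (k + 2) = of_nat k * c k"
          unfolding fps_X_power_mult_nth by (cases k) auto
        moreover have "fps_nth (fps_deriv (Abs_fps c)) (k + 2) = of_nat (k + 3) * c (k + 3)"
          by (simp add: eval_nat_numeral)
        ultimately show ?thesis by (simp only: distrib_right fps_add_nth mult_1)
      qed
      moreover have "n + 1 = k + 2" using Suc by simp
      ultimately show ?thesis by (simp only: fps_deriv_nth)
    qed
    also have "\<dots> = of_nat (k + 2) * of_nat (k + 3) * c (k + 3) + of_nat (k + 2) * of_nat k * c k"
      by (simp only: distrib_left mult.assoc)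
    \<comment> \<open>Here k (k + 2) - (k + 1)^2 = -1.\<close>
    also have "\<dots> = - c k" unfolding rec by (simp add: power2_eq_square algebra_simps)
    finally show ?thesis by (simp add: Suc)
  qed
  thus "fps_nth (fps_deriv ((1 + fps_X ^ 3) * fps_deriv (Abs_fps (hyp3 a b)))) n =
    fps_nth (- fps_X * Abs_fps (hyp3 a b)) n" by (simp only: c_def)
qed

lemma fps_deriv_deriv_hyp2:
  "fps_deriv ((1 - 4 * fps_X ^ 2) * fps_deriv (Abs_fps (hyp2 a b))) = Abs_fps (hyp2 a b)"
proof (rule fps_ext)
  fix n
  define c where "c = hyp2 a b"
  have rec: "of_nat (k + 1) * of_nat (k + 2) * c (k + 2) = of_nat (2 * k + 1) ^ 2 * c k" for k
  proof -
    have "k + 2 = Suc (Suc k)" by simp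
    hence "c (k + 2) = (of_nat (2 * k + 1) ^ 2 / (of_nat (k + 1) * of_nat (k + 2))) * c k"
      unfolding c_def by (simp only: hyp2.simps)
    moreover have "(of_nat (k + 1) * of_nat (k + 2) :: complex) \<noteq> 0"
      by (simp only: mult_eq_0_iff of_nat_eq_0_iff) simp
    ultimately show ?thesis by (rule divide_mult_eq_imp)
  qed
  have "fps_nth (fps_deriv ((1 - 4 * fps_X ^ 2) * fps_deriv (Abs_fps c))) n = c n"
  proof -
    have "fps_nth (fps_deriv ((1 - 4 * fps_X ^ 2) * fps_deriv (Abs_fps c))) n =
        of_nat (n + 1) * (of_nat (n + 2) * c (n + 2) - 4 * (of_nat n * c n))"
    proof -
      have "fps_nth (4 * (fps_X ^ 2 * fps_deriv (Abs_fps c))) (n + 1) = 4 * (of_nat n * c n)"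
        unfolding numeral_fps_const fps_mult_left_const_nth fps_X_power_mult_nth by (cases n) auto
      moreover have "fps_nth (fps_deriv (Abs_fps c)) (n + 1) = of_nat (n + 2) * c (n + 2)"
        by (simp add: eval_nat_numeral)
      ultimately show ?thesis
        by (simp only: fps_deriv_nth left_diff_distrib fps_sub_nth mult_1 mult.assoc)
    qed
    also have "\<dots> = of_nat (n + 1) * of_nat (n + 2) * c (n + 2) - of_nat (n + 1) * 4 * of_nat n * c n"
      by (simp only: right_diff_distrib mult.assoc)
    \<comment> \<open>Here (2 n + 1)^2 - 4 n (n + 1) = 1.\<close>
    also have "\<dots> = c n" unfolding rec by (simp add: power2_eq_square algebra_simps)
    finally show ?thesis .
  qed
  thus "fps_nth (fps_deriv ((1 - 4 * fps_X ^ 2) * fps_deriv (Abs_fps (hyp2 a b)))) n =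
    fps_nth (Abs_fps (hyp2 a b)) n" by (simp add: c_def)
qed

lemma hyp3_ode:
  fixes a b z :: complex
  assumes "norm z < 1"
  defines "F \<equiv> Abs_fps (hyp3 a b)"
  shows "(eval_fps F has_field_derivative eval_fps (fps_deriv F) z) (at z)"
    "((\<lambda>t. (1 + t ^ 3) * eval_fps (fps_deriv F) t) has_field_derivative - z * eval_fps F z) (at z)"
proof -
  have rF: "fps_conv_radius F \<ge> 1" using hyp3_radius[of a b] by (simp add: F_def one_ereal_def)
  have r1: "ereal (norm t) < fps_conv_radius F" if "norm t < 1" for t :: complex
    using that rF by (metis ereal_less(3) less_le_trans one_ereal_def less_ereal.simps(1))
  have r2: "ereal (norm t) < fps_conv_radius (fps_deriv F)" if "norm t < 1" for t :: complex
    using r1[OF that] fps_conv_radius_deriv[of F] by (rule less_le_trans)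
  show "(eval_fps F has_field_derivative eval_fps (fps_deriv F) z) (at z)"
    by (rule has_field_derivative_eval_fps) (rule r1, fact)
  define G where "G = (1 + fps_X ^ 3) * fps_deriv F"
  have X3: "fps_conv_radius (1 + fps_X ^ 3 :: complex fps) = \<infinity>"
  proof -
    show ?thesis using fps_conv_radius_add[of "1 :: complex fps" "fps_X ^ 3"] by simp
  qed
  have rG: "ereal (norm t) < fps_conv_radius G" if "norm t < 1" for t :: complex
    using r2[OF that] fps_conv_radius_mult[of "1 + fps_X ^ 3" "fps_deriv F"] unfolding G_def X3
    by (simp add: min_def split: if_splits)
  have evG: "eval_fps G t = (1 + t ^ 3) * eval_fps (fps_deriv F) t" if "norm t < 1" for t
    unfolding G_def using r2[OF that]
    by (subst eval_fps_mult) (auto simp: X3 eval_fps_add)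
  have "(eval_fps G has_field_derivative eval_fps (fps_deriv G) z) (at z)"
    by (rule has_field_derivative_eval_fps) (rule rG, fact)
  also have "fps_deriv G = - fps_X * F"
    unfolding G_def F_def by (rule fps_deriv_deriv_hyp3)
  also have "eval_fps (- fps_X * F) z = - z * eval_fps F z"
    using r1[OF assms(1)] by (subst eval_fps_mult) (auto simp: eval_fps_minus)
  finally have *: "(eval_fps G has_field_derivative - z * eval_fps F z) (at z)" .
  have ev: "eventually (\<lambda>t. eval_fps G t = (1 + t ^ 3) * eval_fps (fps_deriv F) t) (nhds z)"
    using eventually_nhds_in_open[of "ball 0 1" z] assms(1) by (auto elim!: eventually_mono simp: evG)
  show "((\<lambda>t. (1 + t ^ 3) * eval_fps (fps_deriv F) t) has_field_derivative - z * eval_fps F z) (at z)"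
    by (rule DERIV_cong_ev[OF refl ev refl, THEN iffD1, OF *])
qed

lemma hyp2_ode:
  fixes a b z :: complex
  assumes "norm z < 1 / 2"
  defines "F \<equiv> Abs_fps (hyp2 a b)"
  shows "(eval_fps F has_field_derivative eval_fps (fps_deriv F) z) (at z)"
    "((\<lambda>t. (1 - 4 * t ^ 2) * eval_fps (fps_deriv F) t) has_field_derivative 1 * eval_fps F z) (at z)"
proof -
  have rF: "fps_conv_radius F \<ge> ereal (1 / 2)" using hyp2_radius[of a b] by (simp add: F_def)
  have r1: "ereal (norm t) < fps_conv_radius F" if "norm t < 1 / 2" for t :: complex
    using that rF by (metis less_le_trans less_ereal.simps(1))
  have r2: "ereal (norm t) < fps_conv_radius (fps_deriv F)" if "norm t < 1 / 2" for t :: complex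
    using r1[OF that] fps_conv_radius_deriv[of F] by (rule less_le_trans)
  show "(eval_fps F has_field_derivative eval_fps (fps_deriv F) z) (at z)"
    by (rule has_field_derivative_eval_fps) (rule r1, fact)
  define G where "G = (1 - 4 * fps_X ^ 2) * fps_deriv F"
  have X4: "fps_conv_radius (4 * fps_X ^ 2 :: complex fps) = \<infinity>"
    using fps_conv_radius_mult[of "4 :: complex fps" "fps_X ^ 2"] by simp
  have X3: "fps_conv_radius (1 - 4 * fps_X ^ 2 :: complex fps) = \<infinity>"
  proof -
    show ?thesis using fps_conv_radius_diff[of "1 :: complex fps" "4 * fps_X ^ 2"] by (simp add: X4)
  qed
  have rG: "ereal (norm t) < fps_conv_radius G" if "norm t < 1 / 2" for t :: complex
    using r2[OF that] fps_conv_radius_mult[of "1 - 4 * fps_X ^ 2" "fps_deriv F"] unfolding G_def X3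
    by (simp add: min_def split: if_splits)
  have evG: "eval_fps G t = (1 - 4 * t ^ 2) * eval_fps (fps_deriv F) t" if "norm t < 1 / 2" for t
    unfolding G_def using r2[OF that]
    by (subst eval_fps_mult) (auto simp: X3 X4 eval_fps_diff eval_fps_mult)
  have "(eval_fps G has_field_derivative eval_fps (fps_deriv G) z) (at z)"
    by (rule has_field_derivative_eval_fps) (rule rG, fact)
  also have "fps_deriv G = F"
    unfolding G_def F_def by (rule fps_deriv_deriv_hyp2)
  finally have *: "(eval_fps G has_field_derivative 1 * eval_fps F z) (at z)" by simp
  have ev: "eventually (\<lambda>t. eval_fps G t = (1 - 4 * t ^ 2) * eval_fps (fps_deriv F) t) (nhds z)"
    using eventually_nhds_in_open[of "ball 0 (1 / 2)" z] assms(1) by (auto elim!: eventually_mono simp: evG)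
  show "((\<lambda>t. (1 - 4 * t ^ 2) * eval_fps (fps_deriv F) t) has_field_derivative 1 * eval_fps F z) (at z)"
    by (rule DERIV_cong_ev[OF refl ev refl, THEN iffD1, OF *])
qed

text \<open>Coefficients of \<open>g_rho\<close>, \<open>h_rho\<close> in powers of -t^3 and of
  \<open>g_i\<close>, \<open>h_i\<close> in powers of 4 t^2, up to a factor t for the two h. In
  these variables all coefficients are positive reals and the singular point is 1.\<close>

definition G3 :: "nat \<Rightarrow> real" where "G3 n = (\<Prod>m=1..n. 3 * real m - 2) ^ 3 / fact (3 * n)"
definition H3 :: "nat \<Rightarrow> real" where "H3 n = (\<Prod>m=1..n. 3 * real m - 1) ^ 3 / fact (3 * n + 1)"
definition G2 :: "nat \<Rightarrow> real" where "G2 n = (\<Prod>m=1..n. 4 * real m - 3) ^ 2 / (fact (2 * n) * 4 ^ n)"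
definition H2 :: "nat \<Rightarrow> real" where "H2 n = (\<Prod>m=1..n. 4 * real m - 1) ^ 2 / (fact (2 * n + 1) * 4 ^ n)"

lemma G3_Suc: "G3 (Suc n) = (3 * real n + 1) ^ 2 / ((3 * real n + 2) * (3 * real n + 3)) * G3 n"
proof -
  have f: "fact (3 * Suc n) = (3 * real n + 3) * (3 * real n + 2) * (3 * real n + 1) * fact (3 * n)"
    by (simp add: fact_reduce numeral_3_eq_3 algebra_simps)
  have p: "(\<Prod>m=1..Suc n. 3 * real m - 2) = (3 * real n + 1) * (\<Prod>m=1..n. 3 * real m - 2)"
    by (simp add: algebra_simps)
  have nz: "3 * real n + 1 \<noteq> 0" "3 * real n + 2 \<noteq> 0" "3 * real n + 3 \<noteq> 0" by (auto simp: add_eq_0_iff)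
  show ?thesis unfolding G3_def f p using nz
    by (simp add: power_mult_distrib divide_simps power2_eq_square power3_eq_cube del: fact_Suc)
qed

lemma H3_Suc: "H3 (Suc n) = (3 * real n + 2) ^ 2 / ((3 * real n + 3) * (3 * real n + 4)) * H3 n"
proof -
  have f: "fact (3 * Suc n + 1) = (3 * real n + 4) * (3 * real n + 3) * (3 * real n + 2) * fact (3 * n + 1)"
    by (simp add: fact_reduce numeral_3_eq_3 algebra_simps)
  have p: "(\<Prod>m=1..Suc n. 3 * real m - 1) = (3 * real n + 2) * (\<Prod>m=1..n. 3 * real m - 1)"
    by (simp add: algebra_simps)
  have nz: "3 * real n + 2 \<noteq> 0" "3 * real n + 3 \<noteq> 0" "3 * real n + 4 \<noteq> 0" by (auto simp: add_eq_0_iff)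
  show ?thesis unfolding H3_def f p using nz
    by (simp add: power_mult_distrib divide_simps power2_eq_square power3_eq_cube del: fact_Suc)
qed

lemma G2_Suc: "4 * G2 (Suc n) = (4 * real n + 1) ^ 2 / ((2 * real n + 1) * (2 * real n + 2)) * G2 n"
proof -
  have f: "fact (2 * Suc n) = (2 * real n + 2) * (2 * real n + 1) * fact (2 * n)"
    by (simp add: fact_reduce algebra_simps)
  have p: "(\<Prod>m=1..Suc n. 4 * real m - 3) = (4 * real n + 1) * (\<Prod>m=1..n. 4 * real m - 3)"
    by (simp add: algebra_simps)
  have nz: "2 * real n + 1 \<noteq> 0" "2 * real n + 2 \<noteq> 0" by (auto simp: add_eq_0_iff)
  show ?thesis unfolding G2_def f p using nz
    by (simp add: power_mult_distrib divide_simps power2_eq_square del: fact_Suc)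
qed

lemma H2_Suc: "4 * H2 (Suc n) = (4 * real n + 3) ^ 2 / ((2 * real n + 2) * (2 * real n + 3)) * H2 n"
proof -
  have f: "fact (2 * Suc n + 1) = (2 * real n + 3) * (2 * real n + 2) * fact (2 * n + 1)"
    by (simp add: fact_reduce algebra_simps)
  have p: "(\<Prod>m=1..Suc n. 4 * real m - 1) = (4 * real n + 3) * (\<Prod>m=1..n. 4 * real m - 1)"
    by (simp add: algebra_simps)
  have nz: "2 * real n + 2 \<noteq> 0" "2 * real n + 3 \<noteq> 0" by (auto simp: add_eq_0_iff)
  show ?thesis unfolding H2_def f p using nz
    by (simp add: power_mult_distrib divide_simps power2_eq_square del: fact_Suc)
qed

lemma hyp3_g: "hyp3 1 0 (3 * n) = (-1) ^ n * of_real (G3 n)" "hyp3 1 0 (3 * n + 1) = 0" "hyp3 1 0 (3 * n + 2) = 0"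
proof (induction n)
  case (Suc n)
  have e: "3 * Suc n = Suc (Suc (Suc (3 * n)))" "3 * Suc n + 1 = Suc (Suc (Suc (3 * n + 1)))"
    "3 * Suc n + 2 = Suc (Suc (Suc (3 * n + 2)))" by simp_all
  {
    case 1
    show ?case unfolding e(1) hyp3.simps(4) G3_Suc Suc by (simp add: add_ac mult_ac)
  next
    case 2
    show ?case unfolding e(2) hyp3.simps(4) Suc by simp
  next
    case 3
    show ?case unfolding e(3) hyp3.simps(4) Suc by simp
  }
qed (simp_all add: G3_def numeral_2_eq_2)

lemma hyp3_h: "hyp3 0 1 (3 * n) = 0" "hyp3 0 1 (3 * n + 1) = (-1) ^ n * of_real (H3 n)" "hyp3 0 1 (3 * n + 2) = 0"
proof (induction n)
  case (Suc n)
  have e: "3 * Suc n = Suc (Suc (Suc (3 * n)))" "3 * Suc n + 1 = Suc (Suc (Suc (3 * n + 1)))"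
    "3 * Suc n + 2 = Suc (Suc (Suc (3 * n + 2)))" by simp_all
  {
    case 1
    show ?case unfolding e(1) hyp3.simps(4) Suc by simp
  next
    case 2
    show ?case unfolding e(2) hyp3.simps(4) H3_Suc Suc by (simp add: add_ac mult_ac)
  next
    case 3
    show ?case unfolding e(3) hyp3.simps(4) Suc by simp
  }
qed (simp_all add: H3_def numeral_2_eq_2)

lemma hyp2_g: "hyp2 1 0 (2 * n) = of_real (4 ^ n * G2 n)" "hyp2 1 0 (2 * n + 1) = 0"
proof (induction n)
  case (Suc n)
  have e: "2 * Suc n = Suc (Suc (2 * n))" "2 * Suc n + 1 = Suc (Suc (2 * n + 1))" by simp_all
  {
    case 1
    have "4 ^ Suc n * G2 (Suc n) = 4 ^ n * (4 * G2 (Suc n))" by simp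
    thus ?case unfolding e(1) hyp2.simps(3) Suc unfolding G2_Suc by (simp add: add_ac mult_ac)
  next
    case 2
    show ?case unfolding e(2) hyp2.simps(3) Suc by simp
  }
qed (simp_all add: G2_def numeral_2_eq_2)

lemma hyp2_h: "hyp2 0 1 (2 * n) = 0" "hyp2 0 1 (2 * n + 1) = of_real (4 ^ n * H2 n)"
proof (induction n)
  case (Suc n)
  have e: "2 * Suc n = Suc (Suc (2 * n))" "2 * Suc n + 1 = Suc (Suc (2 * n + 1))" by simp_all
  {
    case 1
    show ?case unfolding e(1) hyp2.simps(3) Suc by simp
  next
    case 2
    have "4 ^ Suc n * H2 (Suc n) = 4 ^ n * (4 * H2 (Suc n))" by simp
    thus ?case unfolding e(2) hyp2.simps(3) Suc unfolding H2_Suc by (simp add: add_ac mult_ac)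
  }
qed (simp_all add: H2_def numeral_2_eq_2)

lemma eval_hyp3_fps:
  assumes t: "norm t < 1"
  shows "(\<lambda>n. (-1) ^ n * of_real (G3 n) * t ^ (3 * n)) sums eval_fps (Abs_fps (hyp3 1 0)) t"
    "(\<lambda>n. (-1) ^ n * of_real (H3 n) * t ^ (3 * n + 1)) sums eval_fps (Abs_fps (hyp3 0 1)) t"
proof -
  have r: "ereal (norm t) < fps_conv_radius (Abs_fps (hyp3 a b))" for a b
    using t hyp3_radius[of a b] by (metis less_le_trans less_ereal.simps(1))
  have s: "(\<lambda>n. hyp3 a b n * t ^ n) sums eval_fps (Abs_fps (hyp3 a b)) t" for a b
    using sums_eval_fps[OF r] by simp
  have mod3: "\<exists>m. n = 3 * m \<or> n = 3 * m + 1 \<or> n = 3 * m + 2" for n :: nat by presburger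
  have "(\<lambda>n. hyp3 1 0 (3 * n) * t ^ (3 * n)) sums eval_fps (Abs_fps (hyp3 1 0)) t"
  proof (subst sums_mono_reindex[of "\<lambda>n. 3 * n"])
    fix n :: nat assume "n \<notin> range ((*) 3)"
    with mod3[of n] show "hyp3 1 0 n * t ^ n = 0" using hyp3_g by auto
  qed (use s in \<open>auto simp: strict_mono_def\<close>)
  thus "(\<lambda>n. (-1) ^ n * of_real (G3 n) * t ^ (3 * n)) sums eval_fps (Abs_fps (hyp3 1 0)) t"
    by (simp only: hyp3_g)
  have "(\<lambda>n. hyp3 0 1 (3 * n + 1) * t ^ (3 * n + 1)) sums eval_fps (Abs_fps (hyp3 0 1)) t"
  proof (subst sums_mono_reindex[of "\<lambda>n. 3 * n + 1"])
    fix n :: nat assume "n \<notin> range (\<lambda>n. 3 * n + 1)"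
    with mod3[of n] show "hyp3 0 1 n * t ^ n = 0" using hyp3_h by auto
  qed (use s in \<open>auto simp: strict_mono_def\<close>)
  thus "(\<lambda>n. (-1) ^ n * of_real (H3 n) * t ^ (3 * n + 1)) sums eval_fps (Abs_fps (hyp3 0 1)) t"
    by (simp only: hyp3_h)
qed

lemma eval_hyp2_fps:
  assumes t: "norm t < 1 / 2"
  shows "(\<lambda>n. of_real (4 ^ n * G2 n) * t ^ (2 * n)) sums eval_fps (Abs_fps (hyp2 1 0)) t"
    "(\<lambda>n. of_real (4 ^ n * H2 n) * t ^ (2 * n + 1)) sums eval_fps (Abs_fps (hyp2 0 1)) t"
proof -
  have r: "ereal (norm t) < fps_conv_radius (Abs_fps (hyp2 a b))" for a b
    using t hyp2_radius[of a b] by (metis less_le_trans less_ereal.simps(1))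
  have s: "(\<lambda>n. hyp2 a b n * t ^ n) sums eval_fps (Abs_fps (hyp2 a b)) t" for a b
    using sums_eval_fps[OF r] by simp
  have mod2: "\<exists>m. n = 2 * m \<or> n = 2 * m + 1" for n :: nat by presburger
  have "(\<lambda>n. hyp2 1 0 (2 * n) * t ^ (2 * n)) sums eval_fps (Abs_fps (hyp2 1 0)) t"
  proof (subst sums_mono_reindex[of "\<lambda>n. 2 * n"])
    fix n :: nat assume "n \<notin> range ((*) 2)"
    with mod2[of n] show "hyp2 1 0 n * t ^ n = 0" using hyp2_g by auto
  qed (use s in \<open>auto simp: strict_mono_def\<close>)
  thus "(\<lambda>n. of_real (4 ^ n * G2 n) * t ^ (2 * n)) sums eval_fps (Abs_fps (hyp2 1 0)) t"
    by (simp only: hyp2_g)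
  have "(\<lambda>n. hyp2 0 1 (2 * n + 1) * t ^ (2 * n + 1)) sums eval_fps (Abs_fps (hyp2 0 1)) t"
  proof (subst sums_mono_reindex[of "\<lambda>n. 2 * n + 1"])
    fix n :: nat assume "n \<notin> range (\<lambda>n. 2 * n + 1)"
    with mod2[of n] show "hyp2 0 1 n * t ^ n = 0" using hyp2_h by auto
  qed (use s in \<open>auto simp: strict_mono_def\<close>)
  thus "(\<lambda>n. of_real (4 ^ n * H2 n) * t ^ (2 * n + 1)) sums eval_fps (Abs_fps (hyp2 0 1)) t"
    by (simp only: hyp2_h)
qed

lemma g_h_eq_eval_fps:
  shows "norm t < 1 \<Longrightarrow> g_rho t = eval_fps (Abs_fps (hyp3 1 0)) t"
    and "norm t < 1 \<Longrightarrow> h_rho t = eval_fps (Abs_fps (hyp3 0 1)) t"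
    and "norm t < 1 / 2 \<Longrightarrow> g_i t = eval_fps (Abs_fps (hyp2 1 0)) t"
    and "norm t < 1 / 2 \<Longrightarrow> h_i t = eval_fps (Abs_fps (hyp2 0 1)) t"
proof -
  assume t: "norm t < 1"
  show "g_rho t = eval_fps (Abs_fps (hyp3 1 0)) t"
    using eval_hyp3_fps(1)[OF t, THEN sums_unique] unfolding g_rho_def G3_def by simp
  show "h_rho t = eval_fps (Abs_fps (hyp3 0 1)) t"
    using eval_hyp3_fps(2)[OF t, THEN sums_unique] unfolding h_rho_def H3_def by simp
next
  assume t: "norm t < 1 / 2"
  show "g_i t = eval_fps (Abs_fps (hyp2 1 0)) t"
    using eval_hyp2_fps(1)[OF t, THEN sums_unique] unfolding g_i_def G2_def by simp
  show "h_i t = eval_fps (Abs_fps (hyp2 0 1)) t"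
    using eval_hyp2_fps(2)[OF t, THEN sums_unique] unfolding h_i_def H2_def by simp
qed

text \<open>An Abelian theorem: since the denominator diverges, every finite part of the series
  becomes negligible and only the limit of the coefficient quotients matters.\<close>

lemma power_series_ratio_at_1:
  fixes a b :: "nat \<Rightarrow> real"
  assumes b: "\<And>n. b n > 0" and sb: "\<And>x. 0 \<le> x \<Longrightarrow> x < 1 \<Longrightarrow> summable (\<lambda>n. b n * x ^ n)"
    and nsb: "\<not> summable b" and L: "(\<lambda>n. a n / b n) \<longlonglongrightarrow> L"
  shows "filterlim (\<lambda>x. \<Sum>n. b n * x ^ n) at_top (at_left 1)"
    and "((\<lambda>x. (\<Sum>n. a n * x ^ n) / (\<Sum>n. b n * x ^ n)) \<longlongrightarrow> L) (at_left 1)"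
proof -
  have ev01: "eventually (\<lambda>x::real. x \<in> {0<..<1}) (at_left 1)"
    by (rule eventually_at_left_real) simp
  show B: "filterlim (\<lambda>x. \<Sum>n. b n * x ^ n) at_top (at_left 1)"
    unfolding filterlim_at_top
  proof
    fix Z :: real
    obtain N where N: "(\<Sum>n<N. b n) > Z"
    proof (rule ccontr)
      assume "\<not> thesis"
      hence "(\<Sum>n<N. b n) \<le> Z" for N using that by (meson not_le)
      hence "summable b" using b by (intro summableI_nonneg_bounded[of b Z]) (auto intro: less_imp_le)
      thus False using nsb by simp
    qed
    have "((\<lambda>x. \<Sum>n<N. b n * x ^ n) \<longlongrightarrow> (\<Sum>n<N. b n * 1 ^ n)) (at_left 1)"
      by (intro tendsto_intros)
    hence "eventually (\<lambda>x. (\<Sum>n<N. b n * x ^ n) > Z) (at_left 1)"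
      using N by (intro order_tendstoD(1)) auto
    thus "eventually (\<lambda>x. Z \<le> (\<Sum>n. b n * x ^ n)) (at_left 1)"
      using ev01
    proof eventually_elim
      case (elim x)
      have "(\<Sum>n<N. b n * x ^ n) \<le> (\<Sum>n. b n * x ^ n)"
        by (rule sum_le_suminf) (use elim sb b in \<open>auto intro: less_imp_le\<close>)
      with elim show ?case by linarith
    qed
  qed
  \<comment> \<open>Subtracting L b_n leaves coefficients of order o(b_n). Beyond N they cost at
    most e/2 times the denominator; the first N cost a fixed \<open>K\<close>, which falls below e/2
    times the denominator as that grows.\<close>
  define d where "d = (\<lambda>n. a n - L * b n)"
  have "(\<lambda>n. a n / b n - L) \<longlonglongrightarrow> 0" using L by (simp add: LIM_zero)
  moreover have "a n / b n - L = d n / b n" for n using b[of n] by (simp add: d_def field_simps)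
  ultimately have d0: "(\<lambda>n. d n / b n) \<longlonglongrightarrow> 0" by simp
  show "((\<lambda>x. (\<Sum>n. a n * x ^ n) / (\<Sum>n. b n * x ^ n)) \<longlongrightarrow> L) (at_left 1)"
    unfolding tendsto_iff
  proof (intro allI impI)
    fix e :: real assume e: "e > 0"
    have "eventually (\<lambda>n. \<bar>d n / b n\<bar> < e / 2) sequentially"
      using order_tendstoD(2)[OF tendsto_rabs_zero[OF d0], of "e / 2"] e by simp
    then obtain N where N: "\<And>n. n \<ge> N \<Longrightarrow> \<bar>d n / b n\<bar> < e / 2"
      by (auto simp: eventually_sequentially)
    have dN: "\<bar>d n\<bar> \<le> e / 2 * b n" if "n \<ge> N" for n
      using N[OF that] b[of n] by (simp add: abs_divide field_simps less_imp_le)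
    define K where "K = (\<Sum>n<N. \<bar>d n\<bar>)"
    have "eventually (\<lambda>x. (\<Sum>n. b n * x ^ n) > max 1 (2 * K / e)) (at_left 1)"
      using B unfolding filterlim_at_top_dense by blast
    thus "eventually (\<lambda>x. dist ((\<Sum>n. a n * x ^ n) / (\<Sum>n. b n * x ^ n)) L < e) (at_left 1)"
      using ev01
    proof eventually_elim
      case (elim x)
      define S where "S = (\<Sum>n. b n * x ^ n)"
      have x: "0 \<le> x" "x < 1" "x \<le> 1" using elim by auto
      have S: "S > 1" "S > 2 * K / e" using elim by (auto simp: S_def)
      have sumb: "summable (\<lambda>n. b n * x ^ n)" using sb x by simp
      define u where "u = (\<lambda>n. (if n \<in> {..<N} then \<bar>d n\<bar> else 0) + e / 2 * (b n * x ^ n))"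
      have u: "u sums (K + e / 2 * S)"
        unfolding u_def K_def S_def by (intro sums_add sums_If_finite_set sums_mult summable_sums sumb) auto
      have du: "norm (d n * x ^ n) \<le> u n" for n
      proof (cases "n < N")
        case True
        have "\<bar>d n\<bar> * x ^ n \<le> \<bar>d n\<bar> * 1" using x by (intro mult_left_mono power_le_one) auto
        moreover have "e / 2 * (b n * x ^ n) \<ge> 0" using e b[of n] x by (intro mult_nonneg_nonneg) auto
        ultimately show ?thesis using True x by (simp add: u_def abs_mult)
      next
        case False
        have "\<bar>d n\<bar> * x ^ n \<le> (e / 2 * b n) * x ^ n" using dN[of n] False x by (intro mult_right_mono) auto
        thus ?thesis using False x by (simp add: u_def abs_mult mult_ac)
      qed
      have sumd: "summable (\<lambda>n. d n * x ^ n)"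
        by (rule summable_comparison_test'[where N = 0, OF sums_summable[OF u]]) (rule du)
      have "norm (\<Sum>n. d n * x ^ n) \<le> suminf u"
        by (rule norm_suminf_le[OF du]) (use u in \<open>auto intro: sums_summable\<close>)
      hence d_le: "\<bar>\<Sum>n. d n * x ^ n\<bar> \<le> K + e / 2 * S" using u by (simp add: sums_iff)
      have "(\<lambda>n. d n * x ^ n + L * (b n * x ^ n)) sums ((\<Sum>n. d n * x ^ n) + L * S)"
        unfolding S_def by (intro sums_add sums_mult summable_sums sumb sumd)
      moreover have "d n * x ^ n + L * (b n * x ^ n) = a n * x ^ n" for n
        by (simp add: d_def algebra_simps)
      ultimately have A: "(\<Sum>n. a n * x ^ n) = (\<Sum>n. d n * x ^ n) + L * S" by (simp add: sums_iff)
      have "(\<Sum>n. a n * x ^ n) / S - L = (\<Sum>n. d n * x ^ n) / S"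
        unfolding A using S by (simp add: field_simps)
      hence "\<bar>(\<Sum>n. a n * x ^ n) / S - L\<bar> = \<bar>\<Sum>n. d n * x ^ n\<bar> / S" using S by (simp add: abs_divide)
      also have "\<dots> \<le> (K + e / 2 * S) / S" using d_le S by (intro divide_right_mono) auto
      also have "\<dots> = K / S + e / 2" using S by (simp add: field_simps)
      also have "K / S < e / 2" using S e by (simp add: field_simps)
      finally show ?case by (simp add: dist_real_def S_def)
    qed
  qed
qed

text \<open>Since n b_n does not decrease, b_n is at least b_1 / n, and the harmonic series
  diverges.\<close>

lemma not_summable_of_mono:
  fixes b :: "nat \<Rightarrow> real"
  assumes "b 1 > 0" "\<And>n. n \<ge> 1 \<Longrightarrow> real n * b n \<le> real (Suc n) * b (Suc n)"
  shows "\<not> summable b"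
proof
  assume s: "summable b"
  have mono: "b 1 \<le> real n * b n" if "n \<ge> 1" for n
    using that by (induction n rule: dec_induct) (use assms(2) in \<open>auto intro: order_trans\<close>)
  have "b 1 \<le> real (n + 1) * b (n + 1)" for n by (rule mono) simp
  hence "norm (inverse (real (n + 1))) \<le> inverse (b 1) * b (n + 1)" for n
    using assms(1) by (simp add: field_simps)
  moreover have "summable (\<lambda>n. inverse (b 1) * b (n + 1))"
    using s by (intro summable_mult) (simp add: summable_Suc_iff)
  ultimately have "summable (\<lambda>n. inverse (real (n + 1)))"
    by (rule summable_comparison_test'[where N = 0, rotated])
  hence "summable (\<lambda>n. inverse (real n))" by (subst (asm) summable_iff_shift)
  thus False using not_summable_harmonic[where 'a = real] by (simp add: inverse_eq_divide)
qed

text \<open>A quotient of two instances of Euler's limit for the Gamma function, in which the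
  factorials cancel.\<close>

lemma pochhammer_ratio_limit:
  fixes z w :: real
  assumes "z > 0" "w > 0"
  shows "(\<lambda>n. exp ((w - z) * ln (real n)) * (pochhammer z n / pochhammer w n)) \<longlonglongrightarrow> Gamma w / Gamma z"
proof -
  have nz: "Gamma z \<noteq> 0" using Gamma_real_pos[OF assms(1)] by simp
  have "(\<lambda>n. Gamma_series' w n / Gamma_series' z n) \<longlonglongrightarrow> Gamma w / Gamma z"
    by (intro tendsto_divide Gamma_series'_LIMSEQ nz)
  moreover have "Gamma_series' w n / Gamma_series' z n =
     exp ((w - z) * ln (real n)) * (pochhammer z n / pochhammer w n)" for n
  proof -
    have "pochhammer z n \<noteq> 0" "pochhammer w n \<noteq> 0"
      using pochhammer_pos[OF assms(1), of n] pochhammer_pos[OF assms(2), of n] by simp_all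
    thus ?thesis by (simp add: Gamma_series'_def left_diff_distrib exp_diff divide_simps)
  qed
  ultimately show ?thesis by simp
qed

section \<open>Growth of the coefficients and limits at the singular points\<close>

lemma prod_eq_pochhammer:
  fixes c d :: real
  assumes "c \<noteq> 0"
  shows "(\<Prod>m=1..n. c * real m - d) = c ^ n * pochhammer (1 - d / c) n"
  by (induction n) (use assms in \<open>auto simp: pochhammer_Suc field_simps\<close>)

lemma G3_pos: "G3 n > 0"
proof -
  have "(\<Prod>m=1..n. 3 * real m - 2) > 0" by (intro prod_pos) auto
  thus ?thesis by (simp add: G3_def)
qed

lemma G2_pos: "G2 n > 0"
proof -
  have "(\<Prod>m=1..n. 4 * real m - 3) > 0" by (intro prod_pos) auto
  thus ?thesis by (simp add: G2_def)
qed

text \<open>The quotient is R^3 / (3 n + 1) with R growing like q n^(1/3), so it tends to q^3 / 3.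
  This power of a Gamma quotient is the origin of \<open>Omega_rho\<close>.\<close>

lemma H3_G3_limit: "(\<lambda>n. H3 n / G3 n) \<longlonglongrightarrow> 2 * pi * Omega_rho\<^sup>2"
proof -
  define R where "R = (\<lambda>n. pochhammer (2 / 3) n / pochhammer (1 / 3 :: real) n)"
  define q where "q = Gamma (1 / 3) / Gamma (2 / 3 :: real)"
  have qpos: "q > 0" unfolding q_def by (intro divide_pos_pos Gamma_real_pos) auto
  have "(\<lambda>n. exp ((1 / 3 - 2 / 3) * ln (real n)) * R n) \<longlonglongrightarrow> q"
    unfolding R_def q_def by (rule pochhammer_ratio_limit) auto
  hence 1: "(\<lambda>n. (exp ((1 / 3 - 2 / 3) * ln (real n)) * R n) ^ 3 * (real n / (3 * real n + 1))) \<longlonglongrightarrow> q ^ 3 * (1 / 3)"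
  proof (intro tendsto_mult tendsto_power)
    show "(\<lambda>n. real n / (3 * real n + 1)) \<longlonglongrightarrow> 1 / 3" by real_asymp
  qed
  have "eventually (\<lambda>n. (exp ((1 / 3 - 2 / 3) * ln (real n)) * R n) ^ 3 * (real n / (3 * real n + 1)) = H3 n / G3 n) sequentially"
    using eventually_gt_at_top[of 0]
  proof eventually_elim
    case (elim n)
    have "exp ((1 / 3 - 2 / 3) * ln (real n)) ^ 3 = exp (- ln (real n))"
      by (simp flip: exp_of_nat_mult)
    also have "\<dots> = 1 / real n" using elim by (simp add: exp_minus inverse_eq_divide)
    finally have "(exp ((1 / 3 - 2 / 3) * ln (real n)) * R n) ^ 3 * (real n / (3 * real n + 1)) = R n ^ 3 / (3 * real n + 1)"
      using elim by (simp add: power_mult_distrib)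
    also have "R n ^ 3 / (3 * real n + 1) = H3 n / G3 n"
    proof -
      have "pochhammer (1 / 3 :: real) n > 0" by (rule pochhammer_pos) simp
      moreover have "fact (3 * n + 1) = (3 * real n + 1) * fact (3 * n)" by simp
      moreover have "(\<Prod>m=1..n. 3 * real m - 2) = 3 ^ n * pochhammer (1 / 3) n"
        "(\<Prod>m=1..n. 3 * real m - 1) = 3 ^ n * pochhammer (2 / 3) n"
        using prod_eq_pochhammer[of 3 2 n] prod_eq_pochhammer[of 3 1 n] by simp_all
      ultimately show ?thesis unfolding H3_def G3_def
        by (simp add: R_def power_divide power_mult_distrib del: fact_Suc)
    qed
    finally show ?case .
  qed
  with 1 have "(\<lambda>n. H3 n / G3 n) \<longlonglongrightarrow> q ^ 3 * (1 / 3)" by (rule Lim_transform_eventually)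
  moreover have "2 * pi * Omega_rho\<^sup>2 = q ^ 3 * (1 / 3)"
  proof -
    have "(q powr (3 / 2)) ^ 2 = q powr 3" by (simp add: power2_eq_square flip: powr_add)
    also have "\<dots> = q ^ 3" using qpos by simp
    finally show ?thesis unfolding Omega_rho_def q_def[symmetric] by (simp add: power_mult_distrib power_divide)
  qed
  ultimately show ?thesis by (simp only:)
qed

text \<open>The quotient is R^2 / (2 n + 1) with R growing like q n^(1/2). The extra factor 2 is
  compensated later by the factor t = 1/2 of \<open>h_i\<close> at the singular point.\<close>

lemma H2_G2_limit: "(\<lambda>n. H2 n / G2 n) \<longlonglongrightarrow> 2 * (2 * pi * Omega_i\<^sup>2)"
proof -
  define R where "R = (\<lambda>n. pochhammer (3 / 4) n / pochhammer (1 / 4 :: real) n)"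
  define q where "q = Gamma (1 / 4) / Gamma (3 / 4 :: real)"
  have "(\<lambda>n. exp ((1 / 4 - 3 / 4) * ln (real n)) * R n) \<longlonglongrightarrow> q"
    unfolding R_def q_def by (rule pochhammer_ratio_limit) auto
  hence 1: "(\<lambda>n. (exp ((1 / 4 - 3 / 4) * ln (real n)) * R n) ^ 2 * (real n / (2 * real n + 1))) \<longlonglongrightarrow> q ^ 2 * (1 / 2)"
  proof (intro tendsto_mult tendsto_power)
    show "(\<lambda>n. real n / (2 * real n + 1)) \<longlonglongrightarrow> 1 / 2" by real_asymp
  qed
  have "eventually (\<lambda>n. (exp ((1 / 4 - 3 / 4) * ln (real n)) * R n) ^ 2 * (real n / (2 * real n + 1)) = H2 n / G2 n) sequentially"
    using eventually_gt_at_top[of 0]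
  proof eventually_elim
    case (elim n)
    have "exp ((1 / 4 - 3 / 4) * ln (real n)) ^ 2 = exp (- ln (real n))"
      by (simp flip: exp_of_nat_mult)
    also have "\<dots> = 1 / real n" using elim by (simp add: exp_minus inverse_eq_divide)
    finally have "(exp ((1 / 4 - 3 / 4) * ln (real n)) * R n) ^ 2 * (real n / (2 * real n + 1)) = R n ^ 2 / (2 * real n + 1)"
      using elim by (simp add: power_mult_distrib)
    also have "R n ^ 2 / (2 * real n + 1) = H2 n / G2 n"
    proof -
      have "pochhammer (1 / 4 :: real) n > 0" by (rule pochhammer_pos) simp
      moreover have "fact (2 * n + 1) = (2 * real n + 1) * fact (2 * n)" by simp
      moreover have "(\<Prod>m=1..n. 4 * real m - 3) = 4 ^ n * pochhammer (1 / 4) n"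
        "(\<Prod>m=1..n. 4 * real m - 1) = 4 ^ n * pochhammer (3 / 4) n"
        using prod_eq_pochhammer[of 4 3 n] prod_eq_pochhammer[of 4 1 n] by simp_all
      ultimately show ?thesis unfolding H2_def G2_def
        by (simp add: R_def power_divide power_mult_distrib del: fact_Suc)
    qed
    finally show ?case .
  qed
  with 1 have "(\<lambda>n. H2 n / G2 n) \<longlonglongrightarrow> q ^ 2 * (1 / 2)" by (rule Lim_transform_eventually)
  moreover have "2 * (2 * pi * Omega_i\<^sup>2) = q ^ 2 * (1 / 2)"
    unfolding Omega_i_def q_def[symmetric] by (simp add: power_mult_distrib power_divide)
  ultimately show ?thesis by (simp only:)
qed

lemma G3_not_summable: "\<not> summable G3"
proof (rule not_summable_of_mono)
  fix n :: nat assume "n \<ge> 1"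
  have "real n * ((3 * real n + 2) * (3 * real n + 3)) \<le> real (Suc n) * (3 * real n + 1) ^ 2"
    by (simp add: power2_eq_square algebra_simps)
  hence "real n \<le> real (Suc n) * (3 * real n + 1) ^ 2 / ((3 * real n + 2) * (3 * real n + 3))"
    by (subst pos_le_divide_eq) (auto intro!: mult_pos_pos add_nonneg_pos)
  from mult_right_mono[OF this less_imp_le[OF G3_pos[of n]]]
  show "real n * G3 n \<le> real (Suc n) * G3 (Suc n)" by (simp add: G3_Suc mult_ac)
qed (rule G3_pos)

lemma G2_not_summable: "\<not> summable G2"
proof (rule not_summable_of_mono)
  fix n :: nat assume "n \<ge> 1"
  have "real n * (4 * ((2 * real n + 1) * (2 * real n + 2))) \<le> real (Suc n) * (4 * real n + 1) ^ 2"
    by (simp add: power2_eq_square algebra_simps)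
  hence "real n \<le> real (Suc n) * (4 * real n + 1) ^ 2 / (4 * ((2 * real n + 1) * (2 * real n + 2)))"
    by (subst pos_le_divide_eq) (auto intro!: mult_pos_pos add_nonneg_pos)
  from mult_right_mono[OF this less_imp_le[OF G2_pos[of n]]]
  have "real n * G2 n \<le> real (Suc n) * ((4 * real n + 1) ^ 2 / ((2 * real n + 1) * (2 * real n + 2)) * G2 n) / 4"
    by (simp add: mult_ac)
  thus "real n * G2 n \<le> real (Suc n) * G2 (Suc n)" unfolding G2_Suc[symmetric] by simp
qed (rule G2_pos)

text \<open>On this ray -t^3 = r^3 is non-negative, so the alternating signs disappear; the ray
  leads to the singular point t = -1.\<close>

lemma g_h_rho_on_negative_axis:
  assumes "0 \<le> r" "r < 1"
  shows "g_rho (of_real (- r)) = of_real (\<Sum>n. G3 n * (r ^ 3) ^ n)" "summable (\<lambda>n. G3 n * (r ^ 3) ^ n)"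
    "h_rho (of_real (- r)) = - of_real (r * (\<Sum>n. H3 n * (r ^ 3) ^ n))"
proof -
  have r: "norm (of_real (- r) :: complex) < 1" using assms by simp
  have e: "(-1) ^ n * of_real x * (of_real (- r)) ^ (3 * n) = (of_real (x * (r ^ 3) ^ n) :: complex)" for x n
  proof -
    have "(of_real (- r) :: complex) ^ (3 * n) = (-1) ^ (3 * n) * of_real r ^ (3 * n)"
      by (simp add: power_minus[of "of_real r"])
    also have "(-1 :: complex) ^ (3 * n) = (-1) ^ n" by (simp add: power_mult)
    finally show ?thesis by (simp add: power_mult flip: power_mult_distrib)
  qed
  have s1: "(\<lambda>n. of_real (G3 n * (r ^ 3) ^ n) :: complex) sums g_rho (of_real (- r))"
    using eval_hyp3_fps(1)[OF r] g_h_eq_eval_fps(1)[OF r] unfolding e by simp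
  hence "summable (\<lambda>n. of_real (G3 n * (r ^ 3) ^ n) :: complex)" by (rule sums_summable)
  thus sm: "summable (\<lambda>n. G3 n * (r ^ 3) ^ n)" by (simp only: summable_of_real_iff)
  show "g_rho (of_real (- r)) = of_real (\<Sum>n. G3 n * (r ^ 3) ^ n)"
    using s1 sums_of_real[OF summable_sums[OF sm], where 'a = complex] sums_unique2 by blast
  have "(\<lambda>n. of_real (- r) * ((-1) ^ n * of_real (H3 n) * (of_real (- r)) ^ (3 * n)) :: complex) sums h_rho (of_real (- r))"
    using eval_hyp3_fps(2)[OF r] g_h_eq_eval_fps(2)[OF r] by (simp add: mult_ac)
  hence s2: "(\<lambda>n. of_real (- r * (H3 n * (r ^ 3) ^ n)) :: complex) sums h_rho (of_real (- r))"
    unfolding e by simp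
  show "h_rho (of_real (- r)) = - of_real (r * (\<Sum>n. H3 n * (r ^ 3) ^ n))"
  \<comment> \<open>Summability of the \<open>H3\<close> series is read off from a series with the
    factor r, which therefore has to be non-zero.\<close>
  proof (cases "r = 0")
    case True
    thus ?thesis using s2 sums_unique2[OF s2, of 0] by simp
  next
    case False
    have "summable (\<lambda>n. of_real (- r * (H3 n * (r ^ 3) ^ n)) :: complex)" using s2 by (rule sums_summable)
    hence "summable (\<lambda>n. - r * (H3 n * (r ^ 3) ^ n))" by (simp only: summable_of_real_iff)
    hence sm: "summable (\<lambda>n. H3 n * (r ^ 3) ^ n)" using False by (subst (asm) summable_cmult_iff) simp
    have "(\<lambda>n. of_real (- r * (H3 n * (r ^ 3) ^ n)) :: complex) sums of_real (- r * (\<Sum>n. H3 n * (r ^ 3) ^ n))"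
      by (intro sums_of_real sums_mult summable_sums sm)
    from sums_unique2[OF s2 this] show ?thesis by simp
  qed
qed

lemma g_h_i_on_positive_axis:
  assumes "0 \<le> r" "r < 1 / 2"
  shows "g_i (of_real r) = of_real (\<Sum>n. G2 n * (4 * r ^ 2) ^ n)" "summable (\<lambda>n. G2 n * (4 * r ^ 2) ^ n)"
    "h_i (of_real r) = of_real (r * (\<Sum>n. H2 n * (4 * r ^ 2) ^ n))"
proof -
  have r: "norm (of_real r :: complex) < 1 / 2" using assms by simp
  have e: "of_real (4 ^ n * x) * (of_real r) ^ (2 * n) = (of_real (x * (4 * r ^ 2) ^ n) :: complex)" for x n
    by (simp add: power_mult power_mult_distrib)
  have s1: "(\<lambda>n. of_real (G2 n * (4 * r ^ 2) ^ n) :: complex) sums g_i (of_real r)"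
    using eval_hyp2_fps(1)[OF r] g_h_eq_eval_fps(3)[OF r] unfolding e by simp
  hence "summable (\<lambda>n. of_real (G2 n * (4 * r ^ 2) ^ n) :: complex)" by (rule sums_summable)
  thus sm: "summable (\<lambda>n. G2 n * (4 * r ^ 2) ^ n)" by (simp only: summable_of_real_iff)
  show "g_i (of_real r) = of_real (\<Sum>n. G2 n * (4 * r ^ 2) ^ n)"
    using s1 sums_of_real[OF summable_sums[OF sm], where 'a = complex] sums_unique2 by blast
  have "(\<lambda>n. of_real r * (of_real (4 ^ n * H2 n) * (of_real r) ^ (2 * n)) :: complex) sums h_i (of_real r)"
    using eval_hyp2_fps(2)[OF r] g_h_eq_eval_fps(4)[OF r] by (simp add: mult_ac)
  hence s2: "(\<lambda>n. of_real (r * (H2 n * (4 * r ^ 2) ^ n)) :: complex) sums h_i (of_real r)"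
    unfolding e by simp
  show "h_i (of_real r) = of_real (r * (\<Sum>n. H2 n * (4 * r ^ 2) ^ n))"
  proof (cases "r = 0")
    case True
    thus ?thesis using s2 sums_unique2[OF s2, of 0] by simp
  next
    case False
    have "summable (\<lambda>n. of_real (r * (H2 n * (4 * r ^ 2) ^ n)) :: complex)" using s2 by (rule sums_summable)
    hence "summable (\<lambda>n. r * (H2 n * (4 * r ^ 2) ^ n))" by (simp only: summable_of_real_iff)
    hence sm: "summable (\<lambda>n. H2 n * (4 * r ^ 2) ^ n)" using False by (subst (asm) summable_cmult_iff) simp
    have "(\<lambda>n. of_real (r * (H2 n * (4 * r ^ 2) ^ n)) :: complex) sums of_real (r * (\<Sum>n. H2 n * (4 * r ^ 2) ^ n))"
      by (intro sums_of_real sums_mult summable_sums sm)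
    from sums_unique2[OF s2 this] show ?thesis by simp
  qed
qed

lemma rho_limits:
  shows "filterlim (\<lambda>r::real. norm (g_rho (of_real (- r)))) at_top (at_left 1)"
    and "((\<lambda>r::real. c_rho (of_real (- r))) \<longlongrightarrow> of_real (- (2 * pi * Omega_rho\<^sup>2))) (at_left 1)"
proof -
  have sb: "summable (\<lambda>n. G3 n * x ^ n)" if "0 \<le> x" "x < 1" for x
  proof -
    have "root 3 x < 1" using that by (subst real_root_lt_1_iff) auto
    thus ?thesis using g_h_rho_on_negative_axis(2)[of "root 3 x"] that by simp
  qed
  note lim = power_series_ratio_at_1[of G3, OF G3_pos sb G3_not_summable H3_G3_limit]
  have sub: "filterlim (\<lambda>r::real. r ^ 3) (at_left 1) (at_left 1)"
    by real_asymp
  have ev: "eventually (\<lambda>r::real. r \<in> {0<..<1}) (at_left 1)"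
    by (rule eventually_at_left_real) simp
  have 1: "filterlim (\<lambda>r::real. \<Sum>n. G3 n * (r ^ 3) ^ n) at_top (at_left 1)"
    by (rule filterlim_compose[OF lim(1) sub])
  show "filterlim (\<lambda>r::real. norm (g_rho (of_real (- r)))) at_top (at_left 1)"
  proof (rule filterlim_at_top_mono[OF 1])
    show "eventually (\<lambda>r. (\<Sum>n. G3 n * (r ^ 3) ^ n) \<le> norm (g_rho (of_real (- r)))) (at_left 1)"
      using ev by eventually_elim (use g_h_rho_on_negative_axis(1) in auto)
  qed
  have "((\<lambda>r. (\<Sum>n. H3 n * (r ^ 3) ^ n) / (\<Sum>n. G3 n * (r ^ 3) ^ n)) \<longlongrightarrow> 2 * pi * Omega_rho\<^sup>2) (at_left 1)"
    by (rule filterlim_compose[OF lim(2) sub])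
  hence lim': "((\<lambda>r. of_real (- (r * ((\<Sum>n. H3 n * (r ^ 3) ^ n) / (\<Sum>n. G3 n * (r ^ 3) ^ n)))) :: complex) \<longlongrightarrow>
      of_real (- (1 * (2 * pi * Omega_rho\<^sup>2)))) (at_left 1)"
    by (intro tendsto_of_real tendsto_minus tendsto_mult tendsto_ident_at)
  have eq: "eventually (\<lambda>r. of_real (- (r * ((\<Sum>n. H3 n * (r ^ 3) ^ n) / (\<Sum>n. G3 n * (r ^ 3) ^ n)))) =
      c_rho (of_real (- r))) (at_left 1)"
    using ev by eventually_elim (use g_h_rho_on_negative_axis in \<open>auto simp: c_rho_def\<close>)
  show "((\<lambda>r::real. c_rho (of_real (- r))) \<longlongrightarrow> of_real (- (2 * pi * Omega_rho\<^sup>2))) (at_left 1)"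
    using Lim_transform_eventually[OF lim' eq] by (simp only: mult_1)
qed

lemma i_limits:
  shows "filterlim (\<lambda>r::real. norm (g_i (of_real r))) at_top (at_left (1 / 2))"
    and "((\<lambda>r::real. c_i (of_real r)) \<longlongrightarrow> of_real (2 * pi * Omega_i\<^sup>2)) (at_left (1 / 2))"
proof -
  have sb: "summable (\<lambda>n. G2 n * x ^ n)" if "0 \<le> x" "x < 1" for x
  proof -
    have "sqrt x / 2 < 1 / 2" using that by simp
    thus ?thesis using g_h_i_on_positive_axis(2)[of "sqrt x / 2"] that by (simp add: power_divide)
  qed
  note lim = power_series_ratio_at_1[of G2, OF G2_pos sb G2_not_summable H2_G2_limit]
  have ev: "eventually (\<lambda>r::real. r \<in> {0<..<1 / 2}) (at_left (1 / 2))"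
    by (rule eventually_at_left_real) simp
  have sub: "filterlim (\<lambda>r::real. 4 * r ^ 2) (at_left 1) (at_left (1 / 2))"
    unfolding filterlim_at
  proof
    have "((\<lambda>r::real. 4 * r ^ 2) \<longlongrightarrow> 4 * (1 / 2) ^ 2) (at_left (1 / 2))"
      by (intro tendsto_intros)
    thus "((\<lambda>r::real. 4 * r ^ 2) \<longlongrightarrow> 1) (at_left (1 / 2))" by (simp add: power2_eq_square)
    show "eventually (\<lambda>r::real. 4 * r ^ 2 \<in> {..<1} \<and> 4 * r ^ 2 \<noteq> 1) (at_left (1 / 2))"
      using ev
    proof eventually_elim
      case (elim r)
      hence "r ^ 2 < (1 / 2) ^ 2" by (intro power_strict_mono) auto
      thus ?case by (simp add: power2_eq_square)
    qed
  qed
  have 1: "filterlim (\<lambda>r::real. \<Sum>n. G2 n * (4 * r ^ 2) ^ n) at_top (at_left (1 / 2))"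
    by (rule filterlim_compose[OF lim(1) sub])
  show "filterlim (\<lambda>r::real. norm (g_i (of_real r))) at_top (at_left (1 / 2))"
  proof (rule filterlim_at_top_mono[OF 1])
    show "eventually (\<lambda>r. (\<Sum>n. G2 n * (4 * r ^ 2) ^ n) \<le> norm (g_i (of_real r))) (at_left (1 / 2))"
      using ev by eventually_elim (use g_h_i_on_positive_axis(1) in auto)
  qed
  have "((\<lambda>r. (\<Sum>n. H2 n * (4 * r ^ 2) ^ n) / (\<Sum>n. G2 n * (4 * r ^ 2) ^ n)) \<longlongrightarrow> 2 * (2 * pi * Omega_i\<^sup>2)) (at_left (1 / 2))"
    by (rule filterlim_compose[OF lim(2) sub])
  hence lim': "((\<lambda>r. of_real (r * ((\<Sum>n. H2 n * (4 * r ^ 2) ^ n) / (\<Sum>n. G2 n * (4 * r ^ 2) ^ n))) :: complex) \<longlongrightarrow>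
      of_real (1 / 2 * (2 * (2 * pi * Omega_i\<^sup>2)))) (at_left (1 / 2))"
    by (intro tendsto_of_real tendsto_mult tendsto_ident_at)
  have eq: "eventually (\<lambda>r. of_real (r * ((\<Sum>n. H2 n * (4 * r ^ 2) ^ n) / (\<Sum>n. G2 n * (4 * r ^ 2) ^ n))) =
      c_i (of_real r)) (at_left (1 / 2))"
    using ev by eventually_elim (use g_h_i_on_positive_axis in \<open>auto simp: c_i_def\<close>)
  show "((\<lambda>r::real. c_i (of_real r)) \<longlongrightarrow> of_real (2 * pi * Omega_i\<^sup>2)) (at_left (1 / 2))"
    using Lim_transform_eventually[OF lim' eq] by (simp add: mult.assoc)
qed

section \<open>Uniqueness for linear systems with holomorphic coefficients\<close>

lemma higher_deriv_mult_eq_0: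
  assumes "open A" "z \<in> A" "m holomorphic_on A" "v holomorphic_on A"
    and "\<And>k. k \<le> n \<Longrightarrow> (deriv ^^ k) v z = 0"
  shows "(deriv ^^ n) (\<lambda>w. m w * v w) z = 0"
  using higher_deriv_mult[OF assms(3,4,1,2), of n] assms(5) by simp

text \<open>By Leibniz's rule each higher derivative at \<open>a\<close> is a combination of lower
  ones, so all Taylor coefficients at \<open>a\<close> vanish, and the identity theorem spreads this
  over \<open>A\<close>.\<close>

lemma linear_system_zero:
  fixes v1 v2 v3 :: "complex \<Rightarrow> complex"
  assumes A: "open A" "connected A" "a \<in> A"
    and hol: "m11 holomorphic_on A" "m12 holomorphic_on A" "m13 holomorphic_on A"
      "m21 holomorphic_on A" "m22 holomorphic_on A" "m23 holomorphic_on A"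
      "m31 holomorphic_on A" "m32 holomorphic_on A" "m33 holomorphic_on A"
    and d1: "\<And>z. z \<in> A \<Longrightarrow> (v1 has_field_derivative (m11 z * v1 z + m12 z * v2 z + m13 z * v3 z)) (at z)"
    and d2: "\<And>z. z \<in> A \<Longrightarrow> (v2 has_field_derivative (m21 z * v1 z + m22 z * v2 z + m23 z * v3 z)) (at z)"
    and d3: "\<And>z. z \<in> A \<Longrightarrow> (v3 has_field_derivative (m31 z * v1 z + m32 z * v2 z + m33 z * v3 z)) (at z)"
    and init: "v1 a = 0" "v2 a = 0" "v3 a = 0"
    and z: "z \<in> A"
  shows "v1 z = 0" "v2 z = 0" "v3 z = 0"
proof -
  have hv: "v1 holomorphic_on A" "v2 holomorphic_on A" "v3 holomorphic_on A"
    using d1 d2 d3 by (auto simp: holomorphic_on_open[OF A(1)])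
  have step: "(deriv ^^ Suc n) v a = 0"
    if d: "\<And>z. z \<in> A \<Longrightarrow> (v has_field_derivative (p1 z * v1 z + p2 z * v2 z + p3 z * v3 z)) (at z)"
      and hp: "p1 holomorphic_on A" "p2 holomorphic_on A" "p3 holomorphic_on A"
      and IH: "\<And>k. k \<le> n \<Longrightarrow> (deriv ^^ k) v1 a = 0" "\<And>k. k \<le> n \<Longrightarrow> (deriv ^^ k) v2 a = 0"
        "\<And>k. k \<le> n \<Longrightarrow> (deriv ^^ k) v3 a = 0"
    for v p1 p2 p3 n
  proof -
    have hv': "v holomorphic_on A" using d by (auto simp: holomorphic_on_open[OF A(1)])
    have "(deriv ^^ Suc n) v a = (deriv ^^ n) (deriv v) a"
      by (simp add: funpow_Suc_right del: funpow.simps)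
    also have "\<dots> = (deriv ^^ n) (\<lambda>z. p1 z * v1 z + p2 z * v2 z + p3 z * v3 z) a"
      by (rule higher_deriv_transform_within_open[where S = A])
         (use A hv hv' hp DERIV_imp_deriv[OF d] in \<open>auto intro!: holomorphic_intros holomorphic_deriv\<close>)
    also have "\<dots> = (deriv ^^ n) (\<lambda>z. p1 z * v1 z + p2 z * v2 z) a + (deriv ^^ n) (\<lambda>z. p3 z * v3 z) a"
      by (rule higher_deriv_add[where S = A]) (use A hv hp in \<open>auto intro!: holomorphic_intros\<close>)
    also have "(deriv ^^ n) (\<lambda>z. p1 z * v1 z + p2 z * v2 z) a =
        (deriv ^^ n) (\<lambda>z. p1 z * v1 z) a + (deriv ^^ n) (\<lambda>z. p2 z * v2 z) a"
      by (rule higher_deriv_add[where S = A]) (use A hv hp in \<open>auto intro!: holomorphic_intros\<close>)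
    finally show ?thesis
      using higher_deriv_mult_eq_0[OF A(1,3)] hp hv IH by simp
  qed
  have all: "(\<forall>k\<le>n. (deriv ^^ k) v1 a = 0 \<and> (deriv ^^ k) v2 a = 0 \<and> (deriv ^^ k) v3 a = 0)" for n
  proof (induction n)
    case (Suc n)
    hence IH: "\<And>k. k \<le> n \<Longrightarrow> (deriv ^^ k) v1 a = 0" "\<And>k. k \<le> n \<Longrightarrow> (deriv ^^ k) v2 a = 0"
        "\<And>k. k \<le> n \<Longrightarrow> (deriv ^^ k) v3 a = 0" by blast+
    have "(deriv ^^ Suc n) v1 a = 0" "(deriv ^^ Suc n) v2 a = 0" "(deriv ^^ Suc n) v3 a = 0"
      by (rule step[OF d1 hol(1-3) IH] step[OF d2 hol(4-6) IH] step[OF d3 hol(7-9) IH]; assumption)+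
    with IH show ?case by (metis le_Suc_eq)
  qed (use init in simp)
  show "v1 z = 0" "v2 z = 0" "v3 z = 0"
    using holomorphic_fun_eq_0_on_connected[OF hv(1) A(1,2) _ A(3) z]
      holomorphic_fun_eq_0_on_connected[OF hv(2) A(1,2) _ A(3) z]
      holomorphic_fun_eq_0_on_connected[OF hv(3) A(1,2) _ A(3) z] all by blast+
qed

section \<open>Pulling Eisenstein series back along the Schwarz map\<close>

text \<open>Cayley transform of the half-plane onto the unit disc with \<tau> at the centre. Real
  points go to the unit circle; its point 1, which they miss, stands for the cusp at
  infinity.\<close>

definition disc_map :: "complex \<Rightarrow> complex \<Rightarrow> complex" where
  "disc_map \<tau> x = (x - \<tau>) / (x - cnj \<tau>)"

definition disc_map_inv :: "complex \<Rightarrow> complex \<Rightarrow> complex" where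
  "disc_map_inv \<tau> w = (\<tau> - cnj \<tau> * w) / (1 - w)"

lemma disc_map_inv_disc_map:
  assumes "Im \<tau> > 0" "Im x \<ge> 0"
  shows "disc_map_inv \<tau> (disc_map \<tau> x) = x" "disc_map \<tau> x \<noteq> 1"
proof -
  have nz: "x - cnj \<tau> \<noteq> 0" using assms by (auto simp: complex_eq_iff)
  have nz2: "\<tau> - cnj \<tau> \<noteq> 0" using assms by (auto simp: complex_eq_iff)
  have "1 - disc_map \<tau> x = (\<tau> - cnj \<tau>) / (x - cnj \<tau>)"
    using nz by (simp add: disc_map_def field_simps)
  moreover have "\<tau> - cnj \<tau> * disc_map \<tau> x = (\<tau> - cnj \<tau>) * x / (x - cnj \<tau>)"
    using nz by (simp add: disc_map_def field_simps)
  ultimately show "disc_map_inv \<tau> (disc_map \<tau> x) = x" "disc_map \<tau> x \<noteq> 1"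
    using nz nz2 by (auto simp: disc_map_inv_def)
qed

lemma norm_disc_map_less_1:
  assumes "Im \<tau> > 0" "Im x > 0"
  shows "norm (disc_map \<tau> x) < 1"
proof -
  have nz: "x - cnj \<tau> \<noteq> 0" using assms by (auto simp: complex_eq_iff)
  have "norm (x - \<tau>) ^ 2 < norm (x - cnj \<tau>) ^ 2"
    unfolding cmod_power2 using assms by (simp add: power2_eq_square algebra_simps)
  hence "norm (x - \<tau>) < norm (x - cnj \<tau>)" by (rule power_less_imp_less_base) simp
  thus ?thesis using nz by (simp add: disc_map_def norm_divide)
qed

lemma continuous_disc_map:
  assumes "Im \<tau> > 0" "Im x \<ge> 0"
  shows "isCont (disc_map \<tau>) x"
proof -
  have nz: "x - cnj \<tau> \<noteq> 0" using assms by (auto simp: complex_eq_iff)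
  thus ?thesis unfolding disc_map_def by (intro continuous_intros) auto
qed

text \<open>A boundary point other than 1 is the image of a real number, which rationals
  approximate; the point 1 is approached by large integers.\<close>

lemma cusps_dense:
  assumes \<tau>: "Im \<tau> > 0" and w: "norm w = 1" and e: "e > 0"
  obtains p q :: int where "q > 0" "coprime p q" "norm (disc_map \<tau> (of_int p / of_int q) - w) < e"
proof (cases "w = 1")
  case False
  have w0: "w \<noteq> 0" using w by auto
  have cw: "cnj w = 1 / w"
    using w w0 complex_norm_square[of w] by (simp add: field_simps)
  define C where "C = disc_map_inv \<tau> w"
  have nz: "1 - w \<noteq> 0" using False by simp
  have "cnj C = (cnj \<tau> - \<tau> * (1 / w)) / (1 - 1 / w)"
    by (simp add: C_def disc_map_inv_def cw)
  also have "\<dots> = C" using w0 nz by (simp add: C_def disc_map_inv_def divide_simps) (simp add: algebra_simps)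
  finally have "Im C = 0" by (simp add: complex_eq_iff)
  hence C: "C = of_real (Re C)" by (simp add: complex_eq_iff)
  have nz2: "\<tau> - cnj \<tau> \<noteq> 0" using \<tau> by (auto simp: complex_eq_iff)
  have "C - \<tau> = w * (\<tau> - cnj \<tau>) / (1 - w)" "C - cnj \<tau> = (\<tau> - cnj \<tau>) / (1 - w)"
    using nz by (simp_all add: C_def disc_map_inv_def field_simps)
  hence dw: "disc_map \<tau> C = w" using nz nz2 by (simp add: disc_map_def)
  have "isCont (\<lambda>x. disc_map \<tau> (of_real x)) (Re C)"
    by (rule isCont_o2[where g = "disc_map \<tau>"]) (use continuous_disc_map[OF \<tau>] in \<open>auto intro: continuous_intros\<close>)
  then obtain d where d: "d > 0" "\<And>x. \<bar>x - Re C\<bar> < d \<Longrightarrow> norm (disc_map \<tau> (of_real x) - w) < e"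
    using e unfolding continuous_at_eps_delta dist_norm C[symmetric] dw by (metis real_norm_def)
  obtain x where x: "x \<in> \<rat>" "Re C < x" "x < Re C + d"
    using Rats_dense_in_real[of "Re C" "Re C + d"] d(1) by auto
  from x(1) obtain p q where pq: "x = of_int p / of_int q" "q > 0" "coprime p q"
    by (cases rule: Rats_cases') auto
  have "norm (disc_map \<tau> (of_real x) - w) < e" using x by (intro d(2)) auto
  thus thesis using pq that[of q p] by simp
next
  case True
  define K where "K = norm (cnj \<tau> - \<tau>)"
  define n where "n = nat \<lceil>norm \<tau> + K / e + 1\<rceil>"
  have n: "real n > norm \<tau> + K / e" unfolding n_def by linarith
  have "norm (of_nat n - cnj \<tau>) \<ge> real n - norm \<tau>"
    using norm_triangle_ineq2[of "of_nat n" "cnj \<tau>"] by simp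
  hence big: "norm (of_nat n - cnj \<tau>) > K / e" using n by linarith
  have "K / e \<ge> 0" using e by (simp add: K_def)
  hence pos: "norm (of_nat n - cnj \<tau>) > 0" using big by linarith
  hence "disc_map \<tau> (of_nat n) - 1 = (cnj \<tau> - \<tau>) / (of_nat n - cnj \<tau>)"
    by (simp add: disc_map_def field_simps)
  hence "norm (disc_map \<tau> (of_nat n) - 1) = K / norm (of_nat n - cnj \<tau>)"
    by (simp add: norm_divide K_def)
  also have "\<dots> < e" using big pos e by (simp add: field_simps)
  finally show thesis using that[of 1 "int n"] True by simp
qed

text \<open>A modular matrix with lower row (q, -p) sends p / q to infinity. At height y above p / q
  its automorphy factor is i q y and the image has height 1 / (q^2 y), so
  \<open>eis_4_lower_bound\<close> applies once y is small.\<close>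

lemma eis_4_cusp_unbounded:
  fixes p q :: int
  assumes "q > 0" "coprime p q"
  obtains \<delta> Y where "\<delta> > 0" "Y > 0"
    "\<And>y. 0 < y \<Longrightarrow> y < Y \<Longrightarrow> norm (eis 4 (of_int p / of_int q + \<i> * of_real y)) \<ge> \<delta> / y ^ 4"
proof -
  obtain Y0 \<delta>0 where Y0: "Y0 > 0" "\<delta>0 > 0" "\<And>\<tau>. Im \<tau> \<ge> Y0 \<Longrightarrow> norm (eis 4 \<tau>) \<ge> \<delta>0"
    using eis_4_lower_bound by metis
  obtain u v where "u * p + v * q = gcd p q" using bezout_int by blast
  hence uv: "u * p + v * q = 1" using assms(2) by simp
  define a b c d where "a = - u" and "b = - v" and "c = q" and "d = - p"
  have det: "a * d - b * c = 1" using uv by (simp add: a_def b_def c_def d_def)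
  have "norm (eis 4 (of_int p / of_int q + \<i> * of_real y)) \<ge> (\<delta>0 / of_int q ^ 4) / y ^ 4"
    if y: "0 < y" "y < 1 / (of_int q ^ 2 * Y0)" for y :: real
  proof -
    define \<tau> where "\<tau> = of_int p / of_int q + \<i> * of_real y"
    have Im: "Im \<tau> = y" by (simp add: \<tau>_def)
    have cd: "of_int c * \<tau> + of_int d = \<i> * of_real (of_int q * y)"
      using assms(1) by (simp add: \<tau>_def c_def d_def algebra_simps)
    define \<gamma> where "\<gamma> = (of_int a * \<tau> + of_int b) / (of_int c * \<tau> + of_int d)"
    have "norm (of_int c * \<tau> + of_int d) = of_int q * y"
      unfolding cd using y assms(1) by (simp add: norm_mult abs_mult)
    hence "Im \<gamma> = y / (of_int q * y) ^ 2"
      unfolding \<gamma>_def Im_moebius[OF det] Im by simp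
    also have "\<dots> = 1 / (of_int q ^ 2 * y)" using y assms(1) by (simp add: power2_eq_square)
    also have "\<dots> \<ge> Y0" using y Y0(1) assms(1) by (simp add: field_simps)
    finally have "norm (eis 4 \<gamma>) \<ge> \<delta>0" by (rule Y0(3))
    also have "eis 4 \<gamma> = (of_int c * \<tau> + of_int d) ^ 4 * eis 4 \<tau>"
      unfolding \<gamma>_def by (rule eis_modular(1)[OF det]) (use Im y in auto)
    also have "norm \<dots> = (of_int q * y) ^ 4 * norm (eis 4 \<tau>)"
      unfolding cd using y assms(1) by (simp add: norm_mult norm_power abs_mult power_mult_distrib)
    finally show ?thesis using y assms(1) by (simp add: \<tau>_def field_simps power_mult_distrib)
  qed
  moreover have "\<delta>0 / of_int q ^ 4 > 0" "1 / (of_int q ^ 2 * Y0) > 0" using Y0 assms(1) by simp_all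
  ultimately show thesis using that by blast
qed

text \<open>\<open>i\<close>, \<open>m\<close> and \<open>d\<close> stand for the inverses of
  \<open>F\<close>, \<open>l\<close> and \<open>D\<close>. Products equal to 1 are first collected
  and erased, then \<open>l * m\<close> and \<open>D * d\<close> are inserted where the other side
  needs them, so that the outer steps are polynomial identities.\<close>

lemma schwarz_identity_1:
  fixes l D F F' E e2 e4 e6 m d i :: complex
  assumes F: "F * i = 1" "l * m = 1" "D * d = 1"
  shows "((5 * e4 - e2\<^sup>2) * l * d * i ^ 2 * F ^ 2 - e2 * (2 * (F' * F))) * (i ^ 2 * i ^ 2) +
      (E * F * (l * F) - D * F' * (l * F')) * (m * i * (m * i)) =
      l * d * (5 * (e4 * i ^ 4) - (e2 * i ^ 2 + D * F' * (m * i))\<^sup>2) + E * m"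
proof -
  have "((5 * e4 - e2\<^sup>2) * l * d * i ^ 2 * F ^ 2 - e2 * (2 * (F' * F))) * (i ^ 2 * i ^ 2) +
      (E * F * (l * F) - D * F' * (l * F')) * (m * i * (m * i)) =
     (5 * e4 - e2\<^sup>2) * l * d * i ^ 4 * (F * i) ^ 2 - 2 * e2 * F' * i ^ 3 * (F * i) + E * (F * i) ^ 2 * (l * m) * m
      - D * F' ^ 2 * m * i ^ 2 * (l * m)" by algebra
  also have "\<dots> = (5 * e4 - e2\<^sup>2) * l * d * i ^ 4 - 2 * e2 * F' * i ^ 3 * (l * m) * (D * d) + E * m
      - D * F' ^ 2 * m * i ^ 2 * (l * m) * (D * d)" unfolding F by simp
  also have "\<dots> = l * d * (5 * (e4 * i ^ 4) - (e2 * i ^ 2 + D * F' * (m * i))\<^sup>2) + E * m"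
    by algebra
  finally show ?thesis .
qed

lemma schwarz_identity_2:
  fixes l D F F' E e2 e4 e6 m d i :: complex
  assumes F: "F * i = 1" "l * m = 1" "D * d = 1"
  shows "((14 * e6 - 4 * e2 * e4) * l * d * i ^ 2 * F ^ 4 - e4 * (4 * (F' * F ^ 3))) * (i ^ 4 * i ^ 4) =
      l * d * (14 * (e6 * i ^ 6) - 4 * (e2 * i ^ 2 + D * F' * (m * i)) * (e4 * i ^ 4))"
proof -
  have "((14 * e6 - 4 * e2 * e4) * l * d * i ^ 2 * F ^ 4 - e4 * (4 * (F' * F ^ 3))) * (i ^ 4 * i ^ 4) =
     (14 * e6 - 4 * e2 * e4) * l * d * i ^ 6 * (F * i) ^ 4 - 4 * e4 * F' * i ^ 5 * (F * i) ^ 3" by algebra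
  also have "\<dots> = (14 * e6 - 4 * e2 * e4) * l * d * i ^ 6 - 4 * e4 * F' * i ^ 5 * (l * m) * (D * d)" unfolding F by simp
  also have "\<dots> = l * d * (14 * (e6 * i ^ 6) - 4 * (e2 * i ^ 2 + D * F' * (m * i)) * (e4 * i ^ 4))"
    by algebra
  finally show ?thesis .
qed

lemma schwarz_identity_3:
  fixes l D F F' E e2 e4 e6 m d i :: complex
  assumes F: "F * i = 1" "l * m = 1" "D * d = 1"
  shows "((60 / 7 * e4\<^sup>2 - 6 * e2 * e6) * l * d * i ^ 2 * F ^ 6 - e6 * (6 * (F' * F ^ 5))) * (i ^ 6 * i ^ 6) =
      l * d * (60 / 7 * (e4 * i ^ 4)\<^sup>2 - 6 * (e2 * i ^ 2 + D * F' * (m * i)) * (e6 * i ^ 6))"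
proof -
  \<comment> \<open>The fraction 60/7 is abstracted to x, so that only integer coefficients
    remain.\<close>
  have "((x * e4\<^sup>2 - 6 * e2 * e6) * l * d * i ^ 2 * F ^ 6 - e6 * (6 * (F' * F ^ 5))) * (i ^ 6 * i ^ 6) =
     (x * e4\<^sup>2 - 6 * e2 * e6) * l * d * i ^ 8 * (F * i) ^ 6 - 6 * e6 * F' * i ^ 7 * (F * i) ^ 5" for x by algebra
  moreover have "(x * e4\<^sup>2 - 6 * e2 * e6) * l * d * i ^ 8 * (F * i) ^ 6 - 6 * e6 * F' * i ^ 7 * (F * i) ^ 5 = (x * e4\<^sup>2 - 6 * e2 * e6) * l * d * i ^ 8 - 6 * e6 * F' * i ^ 7 * (l * m) * (D * d)" for x unfolding F by simp
  moreover have "(x * e4\<^sup>2 - 6 * e2 * e6) * l * d * i ^ 8 - 6 * e6 * F' * i ^ 7 * (l * m) * (D * d) = l * d * (x * (e4 * i ^ 4)\<^sup>2 - 6 * (e2 * i ^ 2 + D * F' * (m * i)) * (e6 * i ^ 6))" for x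
    by algebra
  ultimately show ?thesis by (simp only:)
qed

text \<open>The quadratic system becomes linear for the difference of two solutions, with
  coefficients built from both; this brings it into the form of
  \<open>linear_system_zero\<close>.\<close>

lemma schwarz_difference:
  fixes x s e Q S p P y q :: complex
  shows "x * (5 * q - s\<^sup>2) + e - (x * (5 * Q - S\<^sup>2) + e) =
   - (x * (s + S)) * (s - S) + x * 5 * (q - Q) + 0 * (p - P)"
    and "x * (14 * p - 4 * s * q) - x * (14 * P - 4 * S * Q) = - (x * (4 * Q)) * (s - S) + - (x * (4 * s)) * (q - Q) + x * 14 * (p - P)"
    and "x * (y * q\<^sup>2 - 6 * s * p) - x * (y * Q\<^sup>2 - 6 * S * P) = - (x * (6 * P)) * (s - S) + x * (y * (q + Q)) * (q - Q) + - (x * (6 * s)) * (p - P)"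
  by algebra+

text \<open>The left-hand sides are what the quotient and chain rules return for the pulled-back
  functions, with c = 2 \<pi> i and c l / (D F^2) as derivative of \<tau>; the right-hand sides show
  that these functions form a closed system.\<close>

lemma schwarz_algebra:
  fixes c l D F F' E e2 e4 e6 :: complex
  assumes "c \<noteq> 0" "l \<noteq> 0" "D \<noteq> 0" "F \<noteq> 0"
  shows "((5 * e4 - e2\<^sup>2) / c * (c * l / (D * F\<^sup>2)) * F ^ 2 - e2 * (2 * (F' * F))) / (F ^ 2 * F ^ 2) +
      (E * F * (l * F) - D * F' * (l * F')) / (l * F * (l * F)) =
      l / D * (5 * (e4 / F ^ 4) - (e2 / F ^ 2 + D * F' / (l * F))\<^sup>2) + E / l"
    and "((14 * e6 - 4 * e2 * e4) / c * (c * l / (D * F\<^sup>2)) * F ^ 4 - e4 * (4 * (F' * F ^ 3))) / (F ^ 4 * F ^ 4) =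
      l / D * (14 * (e6 / F ^ 6) - 4 * (e2 / F ^ 2 + D * F' / (l * F)) * (e4 / F ^ 4))"
    and "((60 / 7 * e4\<^sup>2 - 6 * e2 * e6) / c * (c * l / (D * F\<^sup>2)) * F ^ 6 - e6 * (6 * (F' * F ^ 5))) / (F ^ 6 * F ^ 6) =
      l / D * (60 / 7 * (e4 / F ^ 4)\<^sup>2 - 6 * (e2 / F ^ 2 + D * F' / (l * F)) * (e6 / F ^ 6))"
proof -
  define i where "i = 1 / F"
  define m where "m = 1 / l"
  define d where "d = 1 / D"
  have rel: "F * i = 1" "l * m = 1" "D * d = 1" using assms by (simp_all add: i_def m_def d_def)
  have 1: "(5 * e4 - e2\<^sup>2) / c * (c * l / (D * F\<^sup>2)) = (5 * e4 - e2\<^sup>2) * l * d * i ^ 2"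
    "(14 * e6 - 4 * e2 * e4) / c * (c * l / (D * F\<^sup>2)) = (14 * e6 - 4 * e2 * e4) * l * d * i ^ 2"
    "(60 / 7 * e4\<^sup>2 - 6 * e2 * e6) / c * (c * l / (D * F\<^sup>2)) = (60 / 7 * e4\<^sup>2 - 6 * e2 * e6) * l * d * i ^ 2"
    using assms by (simp_all add: i_def d_def power_divide)
  have 2: "x / F ^ k = x * i ^ k" "x / D = x * d" "x / l = x * m" for x k
    by (simp_all add: i_def m_def d_def power_divide)
  have 3: "x / (F ^ k * F ^ k) = x * (i ^ k * i ^ k)" for x k
    by (simp add: i_def power_divide)
  have 4: "x / (l * F) = x * (m * i)" "x / (l * F * (l * F)) = x * (m * i * (m * i))" for x
    by (simp_all add: i_def m_def)
  show "((5 * e4 - e2\<^sup>2) / c * (c * l / (D * F\<^sup>2)) * F ^ 2 - e2 * (2 * (F' * F))) / (F ^ 2 * F ^ 2) +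
      (E * F * (l * F) - D * F' * (l * F')) / (l * F * (l * F)) =
      l / D * (5 * (e4 / F ^ 4) - (e2 / F ^ 2 + D * F' / (l * F))\<^sup>2) + E / l"
    unfolding 1 2 3 4 by (rule schwarz_identity_1[OF rel])
  show "((14 * e6 - 4 * e2 * e4) / c * (c * l / (D * F\<^sup>2)) * F ^ 4 - e4 * (4 * (F' * F ^ 3))) / (F ^ 4 * F ^ 4) =
      l / D * (14 * (e6 / F ^ 6) - 4 * (e2 / F ^ 2 + D * F' / (l * F)) * (e4 / F ^ 4))"
    unfolding 1 2 3 4 by (rule schwarz_identity_2[OF rel])
  show "((60 / 7 * e4\<^sup>2 - 6 * e2 * e6) / c * (c * l / (D * F\<^sup>2)) * F ^ 6 - e6 * (6 * (F' * F ^ 5))) / (F ^ 6 * F ^ 6) =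
      l / D * (60 / 7 * (e4 / F ^ 4)\<^sup>2 - 6 * (e2 / F ^ 2 + D * F' / (l * F)) * (e6 / F ^ 6))"
    unfolding 1 2 3 4 by (rule schwarz_identity_3[OF rel])
qed

text \<open>In the applications \<open>s\<close>, \<open>Q\<close> and \<open>P\<close> are explicit polynomials; \<open>\<kappa>\<close> is determined by \<open>init'\<close> and only
  later identified through \<open>limit_on_circle\<close>.\<close>

locale schwarz_family =
  fixes R \<kappa> :: real and \<tau>\<^sub>0 l :: complex and g h g' h' D E s Q P :: "complex \<Rightarrow> complex"
  assumes R: "R > 0" and \<tau>0: "Im \<tau>\<^sub>0 > 0" and \<kappa>: "\<kappa> > 0"
    and l: "l = of_real (\<kappa> * Im \<tau>\<^sub>0 / pi)"
    and dg: "\<And>z. z \<in> ball 0 R \<Longrightarrow> (g has_field_derivative g' z) (at z)"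
    and dh: "\<And>z. z \<in> ball 0 R \<Longrightarrow> (h has_field_derivative h' z) (at z)"
    and ode_g: "\<And>z. z \<in> ball 0 R \<Longrightarrow> ((\<lambda>t. D t * g' t) has_field_derivative E z * g z) (at z)"
    and ode_h: "\<And>z. z \<in> ball 0 R \<Longrightarrow> ((\<lambda>t. D t * h' t) has_field_derivative E z * h z) (at z)"
    and D_hol: "D holomorphic_on ball 0 R"
    and D_nz: "\<And>z. z \<in> ball 0 R \<Longrightarrow> D z \<noteq> 0"
    and init: "g 0 = 1" "h 0 = 0" "g' 0 = 0" "h' 0 = 1" "D 0 = 1"
    and ds: "\<And>z. z \<in> ball 0 R \<Longrightarrow> (s has_field_derivative (l / D z * (5 * Q z - (s z)\<^sup>2) + E z / l)) (at z)"
    and dQ: "\<And>z. z \<in> ball 0 R \<Longrightarrow> (Q has_field_derivative (l / D z * (14 * P z - 4 * s z * Q z))) (at z)"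
    and dP: "\<And>z. z \<in> ball 0 R \<Longrightarrow> (P has_field_derivative (l / D z * (60 / 7 * (Q z)\<^sup>2 - 6 * s z * P z))) (at z)"
    and init': "s 0 = 0" "Q 0 = eis 4 \<tau>\<^sub>0" "P 0 = eis 6 \<tau>\<^sub>0" "eis 2 \<tau>\<^sub>0 = of_real (pi / Im \<tau>\<^sub>0)"
begin

definition "F z = g z - of_real \<kappa> * h z"
definition "F' z = g' z - of_real \<kappa> * h' z"
definition "W z = of_real \<kappa> * h z / g z"
definition "tau z = disc_map_inv \<tau>\<^sub>0 (W z)"
definition "Dom = {z \<in> ball 0 R. norm (of_real \<kappa> * h z) < norm (g z)}"

lemma l_nz: "l \<noteq> 0"
  using \<kappa> \<tau>0 by (simp add: l)

lemma cont_gh: "continuous_on (ball 0 R) g" "continuous_on (ball 0 R) h"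
  by (rule DERIV_continuous_on, rule has_field_derivative_at_within, rule dg dh, assumption)+

text \<open>Abel's identity. Besides the derivative of \<open>W\<close> it shows that
  \<open>g\<close> and \<open>h\<close> have no common zero.\<close>

lemma wronskian:
  assumes "z \<in> ball 0 R"
  shows "D z * (g z * h' z - g' z * h z) = 1"
proof -
  define w where "w = (\<lambda>z. g z * (D z * h' z) - (D z * g' z) * h z)"
  have "(w has_field_derivative 0) (at z within ball 0 R)" if z: "z \<in> ball 0 R" for z
  proof -
    have "(w has_field_derivative (g' z * (D z * h' z) + E z * h z * g z) -
        (E z * g z * h z + h' z * (D z * g' z))) (at z)"
      unfolding w_def
      by (rule DERIV_diff[OF DERIV_mult[OF dg[OF z] ode_h[OF z]] DERIV_mult[OF ode_g[OF z] dh[OF z]]])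
    thus ?thesis by (simp add: algebra_simps has_field_derivative_at_within)
  qed
  then obtain c where c: "\<And>z. z \<in> ball 0 R \<Longrightarrow> w z = c"
    using has_field_derivative_zero_constant[of "ball 0 R" w] by auto
  have "w z = w 0" using c[of z] c[of 0] assms R by simp
  thus ?thesis by (simp add: w_def init algebra_simps)
qed

lemma open_Dom: "open Dom"
proof -
  have "continuous_on (ball 0 R) (\<lambda>z. norm (g z) - norm (of_real \<kappa> * h z))"
    by (intro continuous_intros cont_gh)
  hence "open ((\<lambda>z. norm (g z) - norm (of_real \<kappa> * h z)) -` {0<..} \<inter> ball 0 R)"
    by (subst (asm) continuous_on_open_vimage) auto
  moreover have "(\<lambda>z. norm (g z) - norm (of_real \<kappa> * h z)) -` {0<..} \<inter> ball 0 R = Dom"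
    by (auto simp: Dom_def)
  ultimately show ?thesis by simp
qed

lemma Dom_D:
  assumes "z \<in> Dom"
  shows "z \<in> ball 0 R" "g z \<noteq> 0" "F z \<noteq> 0" "norm (W z) < 1" "W z \<noteq> 1" "F z = g z * (1 - W z)"
proof -
  show 1: "z \<in> ball 0 R" using assms by (simp add: Dom_def)
  have lt: "norm (of_real \<kappa> * h z) < norm (g z)" using assms by (simp add: Dom_def)
  show g: "g z \<noteq> 0" using lt by auto
  show W: "norm (W z) < 1" using lt g by (simp add: W_def norm_divide norm_mult)
  show W1: "W z \<noteq> 1" using W by auto
  show F: "F z = g z * (1 - W z)" using g by (simp add: F_def W_def field_simps)
  show "F z \<noteq> 0" using F g W1 by simp
qed

lemma zero_in_Dom: "0 \<in> Dom"
  using R by (simp add: Dom_def init)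

lemma Im_disc_map_inv_pos:
  assumes "norm w < 1"
  shows "Im (disc_map_inv \<tau>\<^sub>0 w) > 0"
proof -
  have nz: "1 - w \<noteq> 0" using assms by auto
  have "disc_map_inv \<tau>\<^sub>0 w = (\<tau>\<^sub>0 - cnj \<tau>\<^sub>0 * w) * cnj (1 - w) / of_real ((norm (1 - w))\<^sup>2)"
    unfolding disc_map_inv_def by (subst complex_div_cnj) simp
  hence "Im (disc_map_inv \<tau>\<^sub>0 w) = Im ((\<tau>\<^sub>0 - cnj \<tau>\<^sub>0 * w) * cnj (1 - w)) / (norm (1 - w))\<^sup>2"
    by (simp only: Im_divide_of_real)
  also have "Im ((\<tau>\<^sub>0 - cnj \<tau>\<^sub>0 * w) * cnj (1 - w)) = Im \<tau>\<^sub>0 * (1 - (norm w)\<^sup>2)"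
    unfolding cmod_power2 by (simp add: algebra_simps power2_eq_square)
  finally have "Im (disc_map_inv \<tau>\<^sub>0 w) = Im \<tau>\<^sub>0 * (1 - (norm w)\<^sup>2) / (norm (1 - w))\<^sup>2" .
  moreover have "(norm w)\<^sup>2 < 1" using assms by (simp add: power_less_one_iff)
  ultimately show ?thesis using \<tau>0 nz by simp
qed

lemma Im_tau_pos: "z \<in> Dom \<Longrightarrow> Im (tau z) > 0"
  unfolding tau_def by (intro Im_disc_map_inv_pos Dom_D)

lemma has_field_derivative_W:
  assumes "z \<in> ball 0 R" "g z \<noteq> 0"
  shows "(W has_field_derivative of_real \<kappa> / (D z * (g z)\<^sup>2)) (at z)"
proof -
  have "(W has_field_derivative (of_real \<kappa> * h' z * g z - of_real \<kappa> * h z * g' z) / (g z * g z)) (at z)"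
    unfolding W_def by (intro DERIV_divide DERIV_cmult dg dh assms)
  also have "of_real \<kappa> * h' z * g z - of_real \<kappa> * h z * g' z = of_real \<kappa> * (g z * h' z - g' z * h z)"
    by (simp add: algebra_simps)
  also have "g z * h' z - g' z * h z = 1 / D z"
    using wronskian[OF assms(1)] D_nz[OF assms(1)] by (simp add: field_simps)
  finally show ?thesis by (simp add: power2_eq_square)
qed

lemma has_field_derivative_tau:
  assumes z: "z \<in> Dom"
  shows "(tau has_field_derivative 2 * of_real pi * \<i> * l / (D z * (F z)\<^sup>2)) (at z)"
proof -
  note D = Dom_D[OF z]
  have nz: "1 - W z \<noteq> 0" using D by simp
  have "(disc_map_inv \<tau>\<^sub>0 has_field_derivative
      ((0 - cnj \<tau>\<^sub>0 * 1) * (1 - W z) - (\<tau>\<^sub>0 - cnj \<tau>\<^sub>0 * W z) * (0 - 1)) / ((1 - W z) * (1 - W z))) (at (W z))"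
    unfolding disc_map_inv_def by (intro DERIV_divide DERIV_diff DERIV_cmult DERIV_ident DERIV_const nz)
  hence "(tau has_field_derivative ((0 - cnj \<tau>\<^sub>0 * 1) * (1 - W z) - (\<tau>\<^sub>0 - cnj \<tau>\<^sub>0 * W z) * (0 - 1)) / ((1 - W z) * (1 - W z))
      * (of_real \<kappa> / (D z * (g z)\<^sup>2))) (at z)"
    unfolding tau_def by (rule DERIV_chain2) (intro has_field_derivative_W D)
  also have "((0 - cnj \<tau>\<^sub>0 * 1) * (1 - W z) - (\<tau>\<^sub>0 - cnj \<tau>\<^sub>0 * W z) * (0 - 1)) = \<tau>\<^sub>0 - cnj \<tau>\<^sub>0"
    by (simp add: algebra_simps)
  also have "\<tau>\<^sub>0 - cnj \<tau>\<^sub>0 = 2 * \<i> * of_real (Im \<tau>\<^sub>0)" by (simp add: complex_eq_iff)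
  \<comment> \<open>\<open>l\<close> contains the factor 1 / \<pi> so that 2 \<pi> i appears here
    and cancels against the one in Ramanujan's equations.\<close>
  also have "2 * \<i> * of_real (Im \<tau>\<^sub>0) / ((1 - W z) * (1 - W z)) * (of_real \<kappa> / (D z * (g z)\<^sup>2)) =
      2 * of_real pi * \<i> * l / (D z * (F z)\<^sup>2)"
    unfolding D(6) l by (simp add: power2_eq_square mult_ac)
  finally show ?thesis .
qed

lemma has_field_derivative_F:
  assumes z: "z \<in> ball 0 R"
  shows "(F has_field_derivative F' z) (at z)"
    and "((\<lambda>z. D z * F' z) has_field_derivative E z * F z) (at z)"
proof -
  show "(F has_field_derivative F' z) (at z)"
    unfolding F_def F'_def by (intro DERIV_diff DERIV_cmult dg dh z)
  have "((\<lambda>z. D z * g' z - of_real \<kappa> * (D z * h' z)) has_field_derivative E z * g z - of_real \<kappa> * (E z * h z)) (at z)"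
    by (intro DERIV_diff DERIV_cmult ode_g ode_h z)
  thus "((\<lambda>z. D z * F' z) has_field_derivative E z * F z) (at z)"
    unfolding F_def F'_def by (simp add: algebra_simps)
qed

text \<open>The second summand absorbs the F' / F left by differentiating the powers of F in
  \<open>Qf\<close> and \<open>Pf\<close>; its own derivative is governed by the linear equation for
  F, so F disappears from the system.\<close>

definition "Sf z = eis 2 (tau z) / F z ^ 2 + D z * F' z / (l * F z)"
definition "Qf z = eis 4 (tau z) / F z ^ 4"
definition "Pf z = eis 6 (tau z) / F z ^ 6"

lemma ode_modular:
  assumes z: "z \<in> Dom"
  shows "(Sf has_field_derivative (l / D z * (5 * Qf z - (Sf z)\<^sup>2) + E z / l)) (at z)"
    and "(Qf has_field_derivative (l / D z * (14 * Pf z - 4 * Sf z * Qf z))) (at z)"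
    and "(Pf has_field_derivative (l / D z * (60 / 7 * (Qf z)\<^sup>2 - 6 * Sf z * Pf z))) (at z)"
proof -
  note D = Dom_D[OF z]
  note dF = has_field_derivative_F[OF D(1)]
  define c where "c = 2 * of_real pi * \<i>"
  have c: "c \<noteq> 0" by (simp add: c_def)
  note dt = has_field_derivative_tau[OF z, folded c_def]
  note ram = ramanujan_eis[OF Im_tau_pos[OF z], folded c_def]
  have pw: "((\<lambda>z. F z ^ n) has_field_derivative of_nat n * (F' z * F z ^ (n - Suc 0))) (at z)" for n
    by (rule DERIV_power[OF dF(1)])
  have p2: "((\<lambda>z. F z ^ 2) has_field_derivative 2 * (F' z * F z)) (at z)" using pw[of 2] by simp
  have p4: "((\<lambda>z. F z ^ 4) has_field_derivative 4 * (F' z * F z ^ 3)) (at z)" using pw[of 4] by simp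
  have p6: "((\<lambda>z. F z ^ 6) has_field_derivative 6 * (F' z * F z ^ 5)) (at z)" using pw[of 6] by simp
  note alg = schwarz_algebra[OF c l_nz D_nz[OF D(1)] D(3)]
  have nz: "F z ^ n \<noteq> 0" "l * F z \<noteq> 0" for n using D(3) l_nz by auto
  show "(Sf has_field_derivative (l / D z * (5 * Qf z - (Sf z)\<^sup>2) + E z / l)) (at z)"
    unfolding Sf_def Qf_def alg(1)[symmetric]
    by (intro DERIV_add DERIV_divide DERIV_chain2[OF ram(1) dt] p2 dF DERIV_cmult nz)
  show "(Qf has_field_derivative (l / D z * (14 * Pf z - 4 * Sf z * Qf z))) (at z)"
    unfolding Sf_def Qf_def Pf_def alg(2)[symmetric]
    by (intro DERIV_divide DERIV_chain2[OF ram(2) dt] p4 nz)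
  show "(Pf has_field_derivative (l / D z * (60 / 7 * (Qf z)\<^sup>2 - 6 * Sf z * Pf z))) (at z)"
    unfolding Sf_def Qf_def Pf_def alg(3)[symmetric]
    by (intro DERIV_divide DERIV_chain2[OF ram(3) dt] p6 nz)
qed

text \<open>\<open>Dom\<close> is not known to be connected at this stage, and the initial values at
  0 control only its component.\<close>

definition "Comp = connected_component_set Dom 0"

lemma Comp: "open Comp" "connected Comp" "0 \<in> Comp" "Comp \<subseteq> Dom"
  unfolding Comp_def using open_connected_component[OF open_Dom] zero_in_Dom
  by (auto simp: connected_component_subset)

lemma modular_identities_Comp:
  assumes z: "z \<in> Comp"
  shows "Qf z = Q z" "Pf z = P z"
proof -
  have sub: "Comp \<subseteq> ball 0 R" using Comp(4) by (auto simp: Dom_def)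
  have hol: "Sf holomorphic_on Comp" "Qf holomorphic_on Comp" "Pf holomorphic_on Comp"
    unfolding holomorphic_on_open[OF Comp(1)] using ode_modular Comp(4) by blast+
  have hol': "s holomorphic_on Comp" "Q holomorphic_on Comp" "P holomorphic_on Comp"
    unfolding holomorphic_on_open[OF Comp(1)] using ds dQ dP sub by blast+
  have lD: "(\<lambda>z. l / D z) holomorphic_on Comp"
    using D_nz sub by (intro holomorphic_intros holomorphic_on_subset[OF D_hol]) auto
  have 0: "Sf 0 = 0" "Qf 0 = eis 4 \<tau>\<^sub>0" "Pf 0 = eis 6 \<tau>\<^sub>0"
  proof -
    have t0: "tau 0 = \<tau>\<^sub>0" by (simp add: tau_def W_def init disc_map_inv_def)
    have F0: "F 0 = 1" "F' 0 = - of_real \<kappa>" by (simp_all add: F_def F'_def init)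
    show "Qf 0 = eis 4 \<tau>\<^sub>0" "Pf 0 = eis 6 \<tau>\<^sub>0" by (simp_all add: Qf_def Pf_def t0 F0)
    \<comment> \<open>This cancellation is what forces the choice of \<open>l\<close> in terms of
      \<kappa>.\<close>
    have "Sf 0 = of_real (pi / Im \<tau>\<^sub>0) - of_real \<kappa> / l" by (simp add: Sf_def t0 F0 init init')
    also have "\<dots> = 0" unfolding l using \<kappa> \<tau>0 by simp
    finally show "Sf 0 = 0" .
  qed
  have d: "((\<lambda>z. Sf z - s z) has_field_derivative - (l / D z * (Sf z + s z)) * (Sf z - s z) + l / D z * 5 * (Qf z - Q z) +
            0 * (Pf z - P z)) (at z)" (is ?d1)
    "((\<lambda>z. Qf z - Q z) has_field_derivative - (l / D z * (4 * Q z)) * (Sf z - s z) +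
            - (l / D z * (4 * Sf z)) * (Qf z - Q z) + l / D z * 14 * (Pf z - P z)) (at z)" (is ?d2)
    "((\<lambda>z. Pf z - P z) has_field_derivative - (l / D z * (6 * P z)) * (Sf z - s z) +
            l / D z * (60 / 7 * (Qf z + Q z)) * (Qf z - Q z) + - (l / D z * (6 * Sf z)) * (Pf z - P z)) (at z)" (is ?d3)
    if z: "z \<in> Comp" for z
  proof -
    have zD: "z \<in> Dom" and zR: "z \<in> ball 0 R" using z Comp(4) sub by blast+
    note o = ode_modular[OF zD] ds[OF zR] dQ[OF zR] dP[OF zR]
    show ?d1 by (rule DERIV_cong[OF DERIV_diff[OF o(1) o(4)]]) (rule schwarz_difference)
    show ?d2 by (rule DERIV_cong[OF DERIV_diff[OF o(2) o(5)]]) (rule schwarz_difference)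
    show ?d3 by (rule DERIV_cong[OF DERIV_diff[OF o(3) o(6)]]) (rule schwarz_difference)
  qed
  have m: "(\<lambda>z. - (l / D z * (Sf z + s z))) holomorphic_on Comp" "(\<lambda>z. l / D z * 5) holomorphic_on Comp"
    "(\<lambda>z. 0 :: complex) holomorphic_on Comp"
    "(\<lambda>z. - (l / D z * (4 * Q z))) holomorphic_on Comp" "(\<lambda>z. - (l / D z * (4 * Sf z))) holomorphic_on Comp"
    "(\<lambda>z. l / D z * 14) holomorphic_on Comp"
    "(\<lambda>z. - (l / D z * (6 * P z))) holomorphic_on Comp" "(\<lambda>z. l / D z * (60 / 7 * (Qf z + Q z))) holomorphic_on Comp"
    "(\<lambda>z. - (l / D z * (6 * Sf z))) holomorphic_on Comp"
    by (intro holomorphic_intros hol hol' lD)+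
  have i: "Sf 0 - s 0 = 0" "Qf 0 - Q 0 = 0" "Pf 0 - P 0 = 0" using 0 init' by simp_all
  have "Qf z - Q z = 0" by (rule linear_system_zero(2)[OF Comp(1-3) m d i z])
  moreover have "Pf z - P z = 0" by (rule linear_system_zero(3)[OF Comp(1-3) m d i z])
  ultimately show "Qf z = Q z" "Pf z = P z" by simp_all
qed

lemma eis_4_Comp: "z \<in> Comp \<Longrightarrow> eis 4 (tau z) = Q z * F z ^ 4"
  using modular_identities_Comp(1)[of z] Dom_D(3)[of z] Comp(4) by (auto simp: Qf_def field_simps)

lemma eis_6_Comp: "z \<in> Comp \<Longrightarrow> eis 6 (tau z) = P z * F z ^ 6"
  using modular_identities_Comp(2)[of z] Dom_D(3)[of z] Comp(4) by (auto simp: Pf_def field_simps)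

text \<open>As \<open>Comp\<close> is open and the ball connected, it suffices that
  \<open>Comp\<close> is relatively closed. A missing limit point lies outside \<open>Dom\<close>
  but is a limit of points with |W| < 1, which pins down |W| = 1 there.\<close>

lemma Comp_eq_ball: "Comp = ball 0 R"
proof -
  have sub: "Comp \<subseteq> ball 0 R" using Comp(4) by (auto simp: Dom_def)
  have closed: "t \<in> Comp" if t: "t \<in> ball 0 R" "t \<in> closure Comp" for t
  proof (rule ccontr)
    assume tC: "t \<notin> Comp"
    have tDom: "t \<notin> Dom"
    proof
      assume "t \<in> Dom"
      then obtain e where e: "e > 0" "ball t e \<subseteq> Dom" using open_Dom open_contains_ball by blast
      then obtain u where u: "u \<in> Comp" "u \<in> ball t e"
        using t(2) unfolding closure_approachable by (auto simp: dist_commute)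
      have "connected (Comp \<union> ball t e)"
        using u Comp(2) by (intro connected_Un) auto
      hence "Comp \<union> ball t e \<subseteq> Comp"
        unfolding Comp_def using Comp(3,4) e(2) connected_component_maximal[of 0 "Comp \<union> ball t e" Dom]
        by (auto simp: Comp_def)
      moreover have "t \<in> ball t e" using e by simp
      ultimately show False using tC by blast
    qed
    obtain u where u: "\<And>n. u n \<in> Comp" "u \<longlonglongrightarrow> t"
      using t(2) closure_sequential by blast
    have cg: "isCont g t" "isCont h t" using dg dh t(1) by (auto intro: DERIV_isCont)
    have "norm (of_real \<kappa> * h t) \<le> norm (g t)"
    proof (rule tendsto_le[of sequentially])
      show "(\<lambda>n. norm (g (u n))) \<longlonglongrightarrow> norm (g t)"
        by (intro tendsto_norm isCont_tendsto_compose[OF cg(1) u(2)])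
      show "(\<lambda>n. norm (of_real \<kappa> * h (u n))) \<longlonglongrightarrow> norm (of_real \<kappa> * h t)"
        by (intro tendsto_norm tendsto_mult tendsto_const isCont_tendsto_compose[OF cg(2) u(2)])
      show "eventually (\<lambda>n. norm (of_real \<kappa> * h (u n)) \<le> norm (g (u n))) sequentially"
        using u(1) Comp(4) by (intro always_eventually) (auto simp: Dom_def intro: less_imp_le)
    qed simp
    moreover have "norm (of_real \<kappa> * h t) \<ge> norm (g t)" using tDom t(1) by (auto simp: Dom_def)
    ultimately have eq: "norm (of_real \<kappa> * h t) = norm (g t)" by simp
    \<comment> \<open>Otherwise g and h would both vanish at t, against the Wronskian.\<close>
    have gt: "g t \<noteq> 0"
    proof
      assume g0: "g t = 0"
      hence "h t = 0" using eq \<kappa> by simp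
      thus False using wronskian[OF t(1)] g0 by simp
    qed
    have Wt: "norm (W t) = 1" using eq gt by (simp add: W_def norm_divide norm_mult)
    define X where "X = {z \<in> ball 0 R. g z \<noteq> 0}"
    have "open X"
    proof -
      have "open (g -` (- {0}) \<inter> ball 0 R)"
        using cont_gh(1) by (subst (asm) continuous_on_open_vimage) auto
      moreover have "g -` (- {0}) \<inter> ball 0 R = X" by (auto simp: X_def)
      ultimately show ?thesis by simp
    qed
    have WX: "W holomorphic_on X"
      unfolding holomorphic_on_open[OF \<open>open X\<close>] using has_field_derivative_W by (auto simp: X_def)
    have tX: "t \<in> X" using t gt by (simp add: X_def)
    \<comment> \<open>With a non-zero derivative, W is a local coordinate at t, and \<open>V\<close>
      below is its inverse.\<close>
    have "deriv W t \<noteq> 0"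
      using DERIV_imp_deriv[OF has_field_derivative_W[OF t(1) gt]] \<kappa> gt D_nz[OF t(1)] by simp
    then obtain r where r: "r > 0" "ball t r \<subseteq> X" "open (W ` ball t r)" "inj_on W (ball t r)"
      by (rule has_complex_derivative_locally_invertible[OF WX tX \<open>open X\<close>])
    have holW: "W holomorphic_on ball t r" using WX r(2) by (rule holomorphic_on_subset)
    obtain V where V: "V holomorphic_on (W ` ball t r)" "\<And>z. z \<in> ball t r \<Longrightarrow> V (W z) = z"
      using holomorphic_has_inverse[OF holW open_ball r(4)] by metis
    have "W t \<in> W ` ball t r" using r(1) by simp
    then obtain e where e: "e > 0" "ball (W t) e \<subseteq> W ` ball t r"
      using r(3) open_contains_ball by blast
    \<comment> \<open>An intersection of two discs is convex, so its preimage under W near t is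
      connected. It meets \<open>Comp\<close> in a member of the sequence \<open>u\<close> and hence
      lies inside \<open>Comp\<close>.\<close>
    define B where "B = ball (W t) e \<inter> ball 0 1"
    have VB: "W (V w) = w" "V w \<in> ball t r" if w: "w \<in> ball (W t) e" for w
    proof -
      obtain z where "z \<in> ball t r" "w = W z" using w e(2) by blast
      thus "W (V w) = w" "V w \<in> ball t r" using V(2)[of z] by simp_all
    qed
    have contV: "continuous_on (ball (W t) e) V"
      using V(1) e(2) holomorphic_on_imp_continuous_on continuous_on_subset by blast
    have "V ` B \<subseteq> Comp"
    proof -
      have "connected (V ` B)"
        unfolding B_def by (intro connected_continuous_image continuous_on_subset[OF contV] convex_connected convex_Int) auto
      moreover have "V ` B \<subseteq> Dom"
      proof safe
        fix w assume w: "w \<in> B"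
        hence "V w \<in> X" using VB r(2) by (auto simp: B_def)
        moreover have "norm (W (V w)) < 1" using w VB(1)[of w] by (simp add: B_def)
        ultimately show "V w \<in> Dom" by (auto simp: X_def Dom_def W_def norm_divide norm_mult field_simps)
      qed
      moreover obtain n where n: "u n \<in> V ` B"
      proof -
        have "isCont W t" by (rule DERIV_isCont[OF has_field_derivative_W[OF t(1) gt]])
        hence "(\<lambda>n. W (u n)) \<longlonglongrightarrow> W t" using u(2) by (rule isCont_tendsto_compose)
        hence "eventually (\<lambda>n. W (u n) \<in> ball (W t) e) sequentially"
          by (rule topological_tendstoD) (use e in auto)
        moreover have "eventually (\<lambda>n. u n \<in> ball t r) sequentially"
          using u(2) by (rule topological_tendstoD) (use r in auto)
        ultimately have "eventually (\<lambda>n. W (u n) \<in> ball (W t) e \<and> u n \<in> ball t r) sequentially"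
          by (rule eventually_conj)
        from eventually_happens'[OF sequentially_bot this]
        obtain n where n: "W (u n) \<in> ball (W t) e" "u n \<in> ball t r" by (elim exE conjE)
        have "norm (W (u n)) < 1" using u(1) Comp(4) Dom_D(4) by blast
        hence "W (u n) \<in> B" using n by (simp add: B_def)
        moreover have "u n = V (W (u n))" using V(2)[OF n(2)] by simp
        ultimately show thesis using that by blast
      qed
      ultimately have "connected (Comp \<union> V ` B)" "Comp \<union> V ` B \<subseteq> Dom"
        using u(1)[of n] Comp(2,4) by (auto intro!: connected_Un)
      hence "Comp \<union> V ` B \<subseteq> Comp"
        using Comp(3) connected_component_maximal[of 0 "Comp \<union> V ` B" Dom] by (auto simp: Comp_def)
      thus ?thesis by blast
    qed
    obtain p q :: int where pq: "q > 0" "coprime p q" "norm (disc_map \<tau>\<^sub>0 (of_int p / of_int q) - W t) < e"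
      by (rule cusps_dense[OF \<tau>0 Wt e(1)])
    define x where "x = (of_int p / of_int q :: complex)"
    have Imx: "Im x = 0" by (simp add: x_def)
    \<comment> \<open>The vertical path down to the cusp, in the disc coordinate. Its end point at y
      = 0 lies on the unit circle but still inside the domain of \<open>V\<close>.\<close>
    define w where "w = (\<lambda>y. disc_map \<tau>\<^sub>0 (x + \<i> * of_real y))"
    have w0: "w 0 \<in> ball (W t) e" using pq(3) by (simp add: w_def x_def dist_norm norm_minus_commute)
    have lim_w: "(w \<longlongrightarrow> w 0) (at_right 0)"
      unfolding w_def
      by (rule isCont_tendsto_compose[OF continuous_disc_map[OF \<tau>0]]) (auto intro!: tendsto_eq_intros simp: Imx)
    have "isCont V (w 0)" using contV w0 by (simp add: continuous_on_eq_continuous_at)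
    hence lim_V: "((\<lambda>y. V (w y)) \<longlongrightarrow> V (w 0)) (at_right 0)" using lim_w by (rule isCont_tendsto_compose)
    define v where "v = V (w 0)"
    have vR: "v \<in> ball 0 R" using VB(2)[OF w0] r(2) by (auto simp: v_def X_def)
    \<comment> \<open>The product Q F^4 is continuous up to the end point of the path, where \<tau>
      has no meaning any more. Multiplied by y^4 it therefore tends to 0, whereas the estimate at
      the cusp keeps it above a positive constant.\<close>
    have lim1: "((\<lambda>y. Q (V (w y)) * F (V (w y)) ^ 4) \<longlongrightarrow> Q v * F v ^ 4) (at_right 0)"
      by (intro tendsto_mult tendsto_power isCont_tendsto_compose[OF _ lim_V[folded v_def]]
            DERIV_isCont[OF dQ[OF vR]] DERIV_isCont[OF has_field_derivative_F(1)[OF vR]])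
    have "((\<lambda>y. norm (Q (V (w y)) * F (V (w y)) ^ 4) * y ^ 4) \<longlongrightarrow> norm (Q v * F v ^ 4) * 0 ^ 4) (at_right 0)"
      by (rule tendsto_mult[OF tendsto_norm[OF lim1] tendsto_power[OF tendsto_ident_at]])
    hence lim0: "((\<lambda>y. norm (Q (V (w y)) * F (V (w y)) ^ 4) * y ^ 4) \<longlongrightarrow> 0) (at_right 0)" by simp
    obtain \<delta> Y where \<delta>: "\<delta> > 0" "Y > 0"
      "\<And>y. 0 < y \<Longrightarrow> y < Y \<Longrightarrow> norm (eis 4 (of_int p / of_int q + \<i> * of_real y)) \<ge> \<delta> / y ^ 4"
      by (rule eis_4_cusp_unbounded[OF pq(1,2)]) (rule that; blast)
    note \<delta> = \<delta>[folded x_def]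
    have "eventually (\<lambda>y. norm (Q (V (w y)) * F (V (w y)) ^ 4) * y ^ 4 < \<delta>) (at_right 0)"
      using lim0 \<delta>(1) by (rule order_tendstoD(2))
    moreover have "eventually (\<lambda>y. w y \<in> ball (W t) e) (at_right 0)"
      using lim_w by (rule topological_tendstoD) (use w0 in auto)
    moreover have "eventually (\<lambda>y::real. y \<in> {0<..<Y}) (at_right 0)"
      by (rule eventually_at_right_real) (use \<delta> in auto)
    ultimately have "eventually (\<lambda>y::real. False) (at_right 0)"
    proof eventually_elim
      case (elim y)
      have y: "y > 0" "y < Y" using elim by auto
      have Imy: "Im (x + \<i> * of_real y) > 0" using y by (simp add: Imx)
      have "w y \<in> B" using elim norm_disc_map_less_1[OF \<tau>0 Imy] by (simp add: B_def w_def)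
      hence VC: "V (w y) \<in> Comp" using \<open>V ` B \<subseteq> Comp\<close> by blast
      have "tau (V (w y)) = x + \<i> * of_real y"
        unfolding tau_def using VB(1)[of "w y"] elim disc_map_inv_disc_map(1)[OF \<tau>0, of "x + \<i> * of_real y"] y
        by (simp add: w_def Imx)
      hence "norm (Q (V (w y)) * F (V (w y)) ^ 4) \<ge> \<delta> / y ^ 4"
        using eis_4_Comp[OF VC] \<delta>(3)[OF y] by simp
      hence "norm (Q (V (w y)) * F (V (w y)) ^ 4) * y ^ 4 \<ge> \<delta>" using y by (simp add: field_simps)
      thus False using elim by simp
    qed
    thus False by simp
  qed
  show ?thesis
  proof (rule ccontr)
    assume "Comp \<noteq> ball 0 R"
    have "closedin (top_of_set (ball 0 R)) Comp"
      unfolding closedin_closed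
    proof (intro exI conjI)
      show "closed (closure Comp)" by simp
      show "Comp = ball 0 R \<inter> closure Comp" using sub closed closure_subset[of Comp] by blast
    qed
    moreover have "openin (top_of_set (ball 0 R)) Comp"
      using sub Comp(1) by (intro open_openin_trans) auto
    ultimately have "Comp = {} \<or> Comp = ball 0 R"
      using connected_ball[of 0 R] unfolding connected_clopen by blast
    thus False using \<open>Comp \<noteq> ball 0 R\<close> Comp(3) by auto
  qed
qed

theorem schwarz_main:
  assumes z: "z \<in> ball 0 R"
  shows "z \<in> Dom" "eis 4 (tau z) = Q z * F z ^ 4" "eis 6 (tau z) = P z * F z ^ 6"
proof -
  have z: "z \<in> Comp" using assms by (simp only: Comp_eq_ball)
  show "z \<in> Dom" using z Comp(4) by blast
  show "eis 4 (tau z) = Q z * F z ^ 4" "eis 6 (tau z) = P z * F z ^ 6"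
    by (rule eis_4_Comp[OF z], rule eis_6_Comp[OF z])
qed

text \<open>If the limit of W lay inside the disc, \<tau> would converge in the half-plane and
  E4(\<tau>) with it, whereas Q g^4 (1 - W)^4 diverges. This is what makes the unknown \<kappa>
  computable.\<close>

lemma limit_on_circle:
  fixes t :: "'b \<Rightarrow> complex"
  assumes nb: "\<F> \<noteq> bot" and tR: "eventually (\<lambda>x. t x \<in> ball 0 R) \<F>"
    and gt: "filterlim (\<lambda>x. norm (g (t x))) at_top \<F>"
    and ct: "((\<lambda>x. h (t x) / g (t x)) \<longlongrightarrow> c) \<F>"
    and Qt: "((\<lambda>x. Q (t x)) \<longlongrightarrow> Q0) \<F>" "Q0 \<noteq> 0"
  shows "norm (of_real \<kappa> * c) = 1"
proof -
  have Wc: "((\<lambda>x. W (t x)) \<longlongrightarrow> of_real \<kappa> * c) \<F>"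
  proof -
    have "W (t x) = of_real \<kappa> * (h (t x) / g (t x))" for x by (simp add: W_def)
    thus ?thesis using tendsto_mult[OF tendsto_const ct, of "of_real \<kappa>"] by (simp only:)
  qed
  have le: "norm (of_real \<kappa> * c) \<le> 1"
    by (rule tendsto_upperbound[OF tendsto_norm[OF Wc] _ nb])
       (rule eventually_mono[OF tR], rule less_imp_le, rule Dom_D(4), rule schwarz_main(1))
  show ?thesis
  proof (rule ccontr)
    assume "norm (of_real \<kappa> * c) \<noteq> 1"
    hence lt: "norm (of_real \<kappa> * c) < 1" using le by simp
    define w where "w = of_real \<kappa> * c"
    have w1: "1 - w \<noteq> 0" using lt by (auto simp: w_def)
    have Im: "Im (disc_map_inv \<tau>\<^sub>0 w) > 0" using lt by (intro Im_disc_map_inv_pos) (simp add: w_def)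
    have "isCont (disc_map_inv \<tau>\<^sub>0) w"
      unfolding disc_map_inv_def by (intro continuous_intros) (use w1 in auto)
    hence "((\<lambda>x. tau (t x)) \<longlongrightarrow> disc_map_inv \<tau>\<^sub>0 w) \<F>"
      unfolding tau_def by (rule isCont_tendsto_compose) (use Wc in \<open>simp add: w_def\<close>)
    hence lim1: "((\<lambda>x. norm (eis 4 (tau (t x)))) \<longlongrightarrow> norm (eis 4 (disc_map_inv \<tau>\<^sub>0 w))) \<F>"
      by (intro tendsto_norm isCont_tendsto_compose[OF DERIV_isCont[OF ramanujan_eis(2)[OF Im]]])
    have "((\<lambda>x. norm (Q (t x)) * norm (1 - W (t x)) ^ 4) \<longlongrightarrow> norm Q0 * norm (1 - w) ^ 4) \<F>"
      using Wc unfolding w_def by (intro tendsto_intros Qt)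
    moreover have "filterlim (\<lambda>x. norm (g (t x)) ^ 4) at_top \<F>"
      by (rule filterlim_pow_at_top[OF _ gt]) simp
    ultimately have "filterlim (\<lambda>x. (norm (Q (t x)) * norm (1 - W (t x)) ^ 4) * norm (g (t x)) ^ 4) at_top \<F>"
      by (intro filterlim_tendsto_pos_mult_at_top) (use w1 Qt(2) in auto)
    moreover have "eventually (\<lambda>x. (norm (Q (t x)) * norm (1 - W (t x)) ^ 4) * norm (g (t x)) ^ 4 = norm (eis 4 (tau (t x)))) \<F>"
      using tR
    proof eventually_elim
      case (elim x)
      show ?case using schwarz_main(2)[OF elim] Dom_D(6)[OF schwarz_main(1)[OF elim]]
        by (simp add: norm_mult norm_power power_mult_distrib mult_ac)
    qed
    ultimately have "filterlim (\<lambda>x. norm (eis 4 (tau (t x)))) at_top \<F>"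
      by (rule filterlim_cong[OF refl refl, THEN iffD1, rotated])
    hence "filterlim (\<lambda>x. norm (eis 4 (tau (t x)))) at_infinity \<F>"
      by (rule filterlim_at_top_imp_at_infinity)
    thus False using not_tendsto_and_filterlim_at_infinity[OF nb lim1] by blast
  qed
qed

end

section \<open>The two families\<close>

text \<open>216000 = 60^3 and 529200 = 27 * 140^2; numerator and denominator both carry F^12, which
  cancels.\<close>

lemma klein_j_eq:
  assumes "Im \<tau> > 0" "F \<noteq> 0" "eis 4 \<tau> = Q * F ^ 4" "eis 6 \<tau> = P * F ^ 6"
  shows "klein_j \<tau> = 1728 * (216000 * Q ^ 3) / (216000 * Q ^ 3 - 529200 * P ^ 2)"
proof -
  have g2: "invariant_g2 \<tau> ^ 3 = 216000 * Q ^ 3 * F ^ 12"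
    using assms by (simp add: invariant_g2_def eisenstein_G_eq_eis power_mult_distrib flip: power_mult)
  have g3: "27 * invariant_g3 \<tau> ^ 2 = 529200 * P ^ 2 * F ^ 12"
    using assms by (simp add: invariant_g3_def eisenstein_G_eq_eis power_mult_distrib flip: power_mult)
  have "klein_j \<tau> = (1728 * (216000 * Q ^ 3)) * F ^ 12 / ((216000 * Q ^ 3 - 529200 * P ^ 2) * F ^ 12)"
    unfolding klein_j_def g3 g2 by (simp add: left_diff_distrib mult.assoc)
  thus ?thesis using assms(2) by simp
qed

lemma s_inv_eq: "s_inv \<tau> \<Omega> w = disc_map_inv \<tau> (w / of_real (2 * pi * \<Omega>\<^sup>2))"
  by (simp add: s_inv_def disc_map_inv_def Let_def)

text \<open>The map x -> (x + 1) / 3 is real affine and sends \<open>rho\<close> to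
  \<open>tau_rho\<close>, so it respects the disc coordinates centred at these points.\<close>

lemma disc_map_inv_affine:
  assumes "W \<noteq> 1"
  shows "(disc_map_inv rho W + 1) / 3 = disc_map_inv tau_rho W"
  using assms by (simp add: disc_map_inv_def tau_rho_def field_simps)

lemma one_plus_cube_nz: "norm (t :: complex) < 1 \<Longrightarrow> 1 + t ^ 3 \<noteq> 0"
proof
  assume t: "norm t < 1" and "1 + t ^ 3 = 0"
  hence "t ^ 3 = -1" by (simp add: eq_neg_iff_add_eq_0 add.commute)
  hence "norm t ^ 3 = 1" by (metis norm_minus_cancel norm_one norm_power)
  moreover have "norm t ^ 3 < 1" using t by (simp add: power_less_one_iff)
  ultimately show False by simp
qed

lemma one_minus_square_nz: "norm (t :: complex) < 1 / 2 \<Longrightarrow> 1 - 4 * t ^ 2 \<noteq> 0"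
proof
  assume t: "norm t < 1 / 2" and "1 - 4 * t ^ 2 = 0"
  hence "t ^ 2 = 1 / 4" by (simp add: field_simps)
  hence "norm t ^ 2 = 1 / 4" by (metis norm_power norm_divide norm_one norm_numeral)
  moreover have "norm t ^ 2 < (1 / 2) ^ 2" using t by (intro power_strict_mono) auto
  ultimately show False by (simp add: power2_eq_square)
qed

lemma hyp_fun_derivs:
  shows "norm z < 1 \<Longrightarrow> (g_rho has_field_derivative eval_fps (fps_deriv (Abs_fps (hyp3 1 0))) z) (at z)"
    and "norm z < 1 \<Longrightarrow> (h_rho has_field_derivative eval_fps (fps_deriv (Abs_fps (hyp3 0 1))) z) (at z)"
    and "norm z < 1 / 2 \<Longrightarrow> (g_i has_field_derivative eval_fps (fps_deriv (Abs_fps (hyp2 1 0))) z) (at z)"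
    and "norm z < 1 / 2 \<Longrightarrow> (h_i has_field_derivative eval_fps (fps_deriv (Abs_fps (hyp2 0 1))) z) (at z)"
proof -
  assume z: "norm z < 1"
  show "(g_rho has_field_derivative eval_fps (fps_deriv (Abs_fps (hyp3 1 0))) z) (at z)"
    by (rule has_field_derivative_transform_within_open[OF hyp3_ode(1)[OF z, of 1 0], of "ball 0 1"])
       (use z g_h_eq_eval_fps in auto)
  show "(h_rho has_field_derivative eval_fps (fps_deriv (Abs_fps (hyp3 0 1))) z) (at z)"
    by (rule has_field_derivative_transform_within_open[OF hyp3_ode(1)[OF z, of 0 1], of "ball 0 1"])
       (use z g_h_eq_eval_fps in auto)
next
  assume z: "norm z < 1 / 2"
  show "(g_i has_field_derivative eval_fps (fps_deriv (Abs_fps (hyp2 1 0))) z) (at z)"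
    by (rule has_field_derivative_transform_within_open[OF hyp2_ode(1)[OF z, of 1 0], of "ball 0 (1 / 2)"])
       (use z g_h_eq_eval_fps in auto)
  show "(h_i has_field_derivative eval_fps (fps_deriv (Abs_fps (hyp2 0 1))) z) (at z)"
    by (rule has_field_derivative_transform_within_open[OF hyp2_ode(1)[OF z, of 0 1], of "ball 0 (1 / 2)"])
       (use z g_h_eq_eval_fps in auto)
qed

lemma rho_part:
  assumes t: "norm t < 1"
  shows "g_rho t \<noteq> 0"
    and "Im ((s_inv rho Omega_rho (c_rho t) + 1) / 3) > 0"
    and "klein_j ((s_inv rho Omega_rho (c_rho t) + 1) / 3) = 27 * t ^ 3 * ((8 - t ^ 3) / (1 + t ^ 3)) ^ 3"
proof -
  obtain r where r: "r > 0" "eis 6 tau_rho = - of_real r" "eis 4 tau_rho = 0"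
    "eis 2 tau_rho = of_real (pi / Im tau_rho)"
    by (rule eis_at_tau_rho)
  have Im: "Im tau_rho > 0" by (simp add: tau_rho_altdef)
  \<comment> \<open>Chosen to solve \<open>P 0 = eis 6 tau_rho\<close>, that is 140 r l^3 =
    1.\<close>
  define \<kappa> where "\<kappa> = pi / Im tau_rho * root 3 (1 / (140 * r))"
  have \<kappa>: "\<kappa> > 0" using r Im by (simp add: \<kappa>_def)
  define l :: complex where "l = of_real (\<kappa> * Im tau_rho / pi)"
  have l: "l = of_real (root 3 (1 / (140 * r)))" using Im by (simp add: l_def \<kappa>_def)
  have l3: "l ^ 3 = of_real (1 / (140 * r))"
    unfolding l of_real_power[symmetric] using r by (simp add: odd_real_root_pow)
  have l0: "l \<noteq> 0" using l3 r by auto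
  define m where "m = 1 / l"
  have lm: "l * m = 1" using l0 by (simp add: m_def)
  \<comment> \<open>Up to constants and powers of \<open>m\<close>, \<open>Q\<close> and
    \<open>P\<close> are Aronhold's invariants S and T of x^3 + y^3 + w^3 + 3 z x y w;
    \<open>s\<close> then follows from the equation for \<open>Q\<close>. Symmetry under
    multiplication of z by cube roots of unity restricts the exponents in \<open>s\<close>,
    \<open>Q\<close> and \<open>P\<close> to 2, 1 and 0 modulo 3.\<close>
  define s where "s = (\<lambda>z. - (3 / 4) * m * z ^ 2)"
  define Q where "Q = (\<lambda>z. - (1 / 10) * m ^ 2 * (z - z ^ 4 / 8))"
  define P where "P = (\<lambda>z. - (1 / 140) * m ^ 3 * (1 - 5 / 2 * z ^ 3 - z ^ 6 / 8))"
  interpret schwarz_family 1 \<kappa> tau_rho l g_rho h_rho "eval_fps (fps_deriv (Abs_fps (hyp3 1 0)))"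
    "eval_fps (fps_deriv (Abs_fps (hyp3 0 1)))" "\<lambda>z. 1 + z ^ 3" "\<lambda>z. - z" s Q P
  proof
    fix z :: complex assume "z \<in> ball 0 1"
    hence z: "norm z < 1" by simp
    have D: "1 + z ^ 3 \<noteq> 0" using z by (rule one_plus_cube_nz)
    show "(g_rho has_field_derivative eval_fps (fps_deriv (Abs_fps (hyp3 1 0))) z) (at z)"
      "(h_rho has_field_derivative eval_fps (fps_deriv (Abs_fps (hyp3 0 1))) z) (at z)"
      using hyp_fun_derivs z by blast+
    show "((\<lambda>t. (1 + t ^ 3) * eval_fps (fps_deriv (Abs_fps (hyp3 1 0))) t) has_field_derivative - z * g_rho z) (at z)"
      "((\<lambda>t. (1 + t ^ 3) * eval_fps (fps_deriv (Abs_fps (hyp3 0 1))) t) has_field_derivative - z * h_rho z) (at z)"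
      using hyp3_ode(2)[OF z] g_h_eq_eval_fps(1,2)[OF z] by simp_all
    show "1 + z ^ 3 \<noteq> 0" by (rule D)
    define d where "d = 1 / (1 + z ^ 3)"
    have d: "(1 + z ^ 3) * d = 1" using D by (simp add: d_def)
    have ld: "l / (1 + z ^ 3) = l * d" "x / l = x * m" for x by (simp_all add: d_def m_def)
    have "(s has_field_derivative - (3 / 2) * m * z) (at z)"
      unfolding s_def by (auto intro!: derivative_eq_intros)
    \<comment> \<open>Factors equal to 1 are spelled out so that both sides agree as polynomials in
      z and the independent symbols \<open>l\<close>, \<open>m\<close> and \<open>d\<close>.\<close>
    moreover have "l * d * (5 * Q z - (s z)\<^sup>2) + - z * m = - (1 / 2) * m * z * (l * m) * ((1 + z ^ 3) * d) + - z * m"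
      by (simp add: s_def Q_def P_def field_simps power_numeral_reduce)
    ultimately show "(s has_field_derivative l / (1 + z ^ 3) * (5 * Q z - (s z)\<^sup>2) + - z / l) (at z)"
      by (elim DERIV_cong) (simp add: ld lm d)
    have "(Q has_field_derivative - (1 / 10) * m ^ 2 * (1 - z ^ 3 / 2)) (at z)"
      unfolding Q_def by (auto intro!: derivative_eq_intros)
    moreover have "l * d * (14 * P z - 4 * s z * Q z) = - (1 / 10) * m ^ 2 * (1 - z ^ 3 / 2) * (l * m) * ((1 + z ^ 3) * d)"
      by (simp add: s_def Q_def P_def field_simps power_numeral_reduce)
    ultimately show "(Q has_field_derivative l / (1 + z ^ 3) * (14 * P z - 4 * s z * Q z)) (at z)"
      by (elim DERIV_cong) (simp add: ld lm d)
    have "(P has_field_derivative - (1 / 140) * m ^ 3 * (- (15 / 2) * z ^ 2 - 3 / 4 * z ^ 5)) (at z)"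
      unfolding P_def by (auto intro!: derivative_eq_intros)
    moreover have "l * d * (60 / 7 * (Q z)\<^sup>2 - 6 * s z * P z) = - (1 / 140) * m ^ 3 * (- (15 / 2) * z ^ 2 - 3 / 4 * z ^ 5) * (l * m) * ((1 + z ^ 3) * d)"
      by (simp add: s_def Q_def P_def field_simps power_numeral_reduce)
    ultimately show "(P has_field_derivative l / (1 + z ^ 3) * (60 / 7 * (Q z)\<^sup>2 - 6 * s z * P z)) (at z)"
      by (elim DERIV_cong) (simp add: ld lm d)
  next
    show "g_rho 0 = 1" "h_rho 0 = 0"
      using g_h_eq_eval_fps(1,2)[of 0] by (simp_all add: eval_fps_at_0)
    show "eval_fps (fps_deriv (Abs_fps (hyp3 1 0))) 0 = 0" "eval_fps (fps_deriv (Abs_fps (hyp3 0 1))) 0 = 1"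
      by (simp_all add: eval_fps_at_0)
    have "m ^ 3 = 140 * of_real r" using l3 r by (simp add: m_def power_divide)
    thus "P 0 = eis 6 tau_rho" by (simp add: P_def r)
    show "Q 0 = eis 4 tau_rho" by (simp add: Q_def r)
  qed (use Im \<kappa> r in \<open>auto simp: l_def s_def intro!: holomorphic_intros\<close>)
  have "norm (of_real \<kappa> * of_real (- (2 * pi * Omega_rho\<^sup>2)) :: complex) = 1"
  \<comment> \<open>The ray ends at the singular point t = -1, where \<open>Q\<close> does not
    vanish.\<close>
  proof (rule limit_on_circle[where \<F> = "at_left (1 :: real)" and t = "\<lambda>r. of_real (- r)" and ?Q0.0 = "Q (-1)"])
    show "eventually (\<lambda>r::real. of_real (- r) \<in> ball (0 :: complex) 1) (at_left 1)"
      using eventually_at_left_real[of 0 1] by (auto elim!: eventually_mono)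
    show "filterlim (\<lambda>r::real. norm (g_rho (of_real (- r)))) at_top (at_left 1)"
      by (rule rho_limits)
    show "((\<lambda>r::real. h_rho (of_real (- r)) / g_rho (of_real (- r))) \<longlongrightarrow> of_real (- (2 * pi * Omega_rho\<^sup>2))) (at_left 1)"
      using rho_limits(2) by (simp add: c_rho_def)
    have "((\<lambda>r::real. Q (of_real (- r))) \<longlongrightarrow> Q (of_real (- 1))) (at_left 1)"
      unfolding Q_def by (intro tendsto_intros) auto
    thus "((\<lambda>r::real. Q (of_real (- r))) \<longlongrightarrow> Q (-1)) (at_left 1)" by simp
    show "Q (-1) \<noteq> 0" using l0 by (simp add: Q_def m_def)
  qed auto
  hence "\<kappa> * (2 * pi * Omega_rho\<^sup>2) = 1"
    unfolding of_real_mult[symmetric] norm_of_real using \<kappa> by (simp add: abs_mult)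
  hence W: "W z = c_rho z / of_real (2 * pi * Omega_rho\<^sup>2)" for z
  proof -
    assume *: "\<kappa> * (2 * pi * Omega_rho\<^sup>2) = 1"
    hence "\<kappa> = 1 / (2 * pi * Omega_rho\<^sup>2)" by (intro nonzero_eq_divide_eq[THEN iffD2]) auto
    thus ?thesis unfolding W_def c_rho_def by simp
  qed
  have tb: "t \<in> ball 0 1" using t by simp
  note main = schwarz_main[OF tb]
  note D = Dom_D[OF main(1)]
  show "g_rho t \<noteq> 0" by (rule D)
  have tau: "(s_inv rho Omega_rho (c_rho t) + 1) / 3 = tau t"
    unfolding s_inv_eq tau_def W[symmetric] by (rule disc_map_inv_affine) (rule D)
  show "Im ((s_inv rho Omega_rho (c_rho t) + 1) / 3) > 0"
    unfolding tau by (rule Im_tau_pos) (rule main)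
  have nz: "1 + t ^ 3 \<noteq> 0" using t by (rule one_plus_cube_nz)
  have m0: "m \<noteq> 0" using l0 by (simp add: m_def)
  have q: "216000 * Q t ^ 3 = - (27 / 64) * m ^ 6 * (t ^ 3 * (8 - t ^ 3) ^ 3)"
    unfolding Q_def by (simp add: field_simps power_numeral_reduce)
  \<comment> \<open>The discriminant of the Hesse cubic, a constant multiple of (1 + t^3)^3.\<close>
  have p: "216000 * Q t ^ 3 - 529200 * P t ^ 2 = - 27 * m ^ 6 * (1 + t ^ 3) ^ 3"
    unfolding Q_def P_def by (simp add: field_simps power_numeral_reduce)
  have "klein_j (tau t) = 1728 * (- (27 / 64) * m ^ 6 * (t ^ 3 * (8 - t ^ 3) ^ 3)) / (- 27 * m ^ 6 * (1 + t ^ 3) ^ 3)"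
    using klein_j_eq[OF Im_tau_pos[OF main(1)] D(3) main(2,3)] unfolding p unfolding q .
  also have "\<dots> = 27 * t ^ 3 * ((8 - t ^ 3) / (1 + t ^ 3)) ^ 3"
    using nz m0 by (simp add: power_divide)
  finally show "klein_j ((s_inv rho Omega_rho (c_rho t) + 1) / 3) = 27 * t ^ 3 * ((8 - t ^ 3) / (1 + t ^ 3)) ^ 3"
    unfolding tau .
qed

lemma i_part:
  assumes t: "norm t < 1 / 2"
  shows "g_i t \<noteq> 0"
    and "Im (s_inv \<i> Omega_i (c_i t)) > 0"
    and "klein_j (s_inv \<i> Omega_i (c_i t)) = 64 * ((3 + 4 * t ^ 2) ^ 3 / (1 - 4 * t ^ 2) ^ 2)"
proof -
  obtain r where r: "r > 0" "eis 4 \<i> = of_real r" "eis 6 \<i> = 0" "eis 2 \<i> = of_real (pi / Im \<i>)"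
    by (rule eis_at_i)
  \<comment> \<open>Chosen to solve \<open>Q 0 = eis 4 \<i>\<close>, that is 15 r l^2 = 1.\<close>
  define \<kappa> where "\<kappa> = pi * sqrt (1 / (15 * r))"
  have \<kappa>: "\<kappa> > 0" using r by (simp add: \<kappa>_def)
  define l :: complex where "l = of_real (\<kappa> * Im \<i> / pi)"
  have l: "l = of_real (sqrt (1 / (15 * r)))" by (simp add: l_def \<kappa>_def)
  have l2: "l ^ 2 = of_real (1 / (15 * r))"
    unfolding l of_real_power[symmetric] using r by (subst real_sqrt_pow2) auto
  have l0: "l \<noteq> 0" using l2 r by auto
  define m where "m = 1 / l"
  have lm: "l * m = 1" using l0 by (simp add: m_def)
  \<comment> \<open>\<open>Q\<close> and \<open>P\<close> are multiples of the invariants I = 1 + 3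
    c^2 and J = c - c^3 of the binary quartic x^4 + 6 c x^2 y^2 + y^4 with c = 2 z / 3. The symmetry
    z -> -z makes \<open>s\<close> and \<open>P\<close> odd and \<open>Q\<close> even.\<close>
  define s where "s = (\<lambda>z. (4 / 3) * m * z)"
  define Q where "Q = (\<lambda>z. (1 / 15) * m ^ 2 * (1 + 4 / 3 * z ^ 2))"
  define P where "P = (\<lambda>z. (4 / 105) * m ^ 3 * (z - 4 / 9 * z ^ 3))"
  interpret schwarz_family "1 / 2" \<kappa> \<i> l g_i h_i "eval_fps (fps_deriv (Abs_fps (hyp2 1 0)))"
    "eval_fps (fps_deriv (Abs_fps (hyp2 0 1)))" "\<lambda>z. 1 - 4 * z ^ 2" "\<lambda>z. 1" s Q P
  proof
    fix z :: complex assume "z \<in> ball 0 (1 / 2)"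
    hence z: "norm z < 1 / 2" by simp
    have D: "1 - 4 * z ^ 2 \<noteq> 0" using z by (rule one_minus_square_nz)
    show "(g_i has_field_derivative eval_fps (fps_deriv (Abs_fps (hyp2 1 0))) z) (at z)"
      "(h_i has_field_derivative eval_fps (fps_deriv (Abs_fps (hyp2 0 1))) z) (at z)"
      using hyp_fun_derivs z by blast+
    show "((\<lambda>t. (1 - 4 * t ^ 2) * eval_fps (fps_deriv (Abs_fps (hyp2 1 0))) t) has_field_derivative 1 * g_i z) (at z)"
      "((\<lambda>t. (1 - 4 * t ^ 2) * eval_fps (fps_deriv (Abs_fps (hyp2 0 1))) t) has_field_derivative 1 * h_i z) (at z)"
      using hyp2_ode(2)[OF z] g_h_eq_eval_fps(3,4)[OF z] by simp_all
    show "1 - 4 * z ^ 2 \<noteq> 0" by (rule D)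
    define d where "d = 1 / (1 - 4 * z ^ 2)"
    have d: "(1 - 4 * z ^ 2) * d = 1" using D by (simp add: d_def)
    have ld: "l / (1 - 4 * z ^ 2) = l * d" "x / l = x * m" for x by (simp_all add: d_def m_def)
    have "(s has_field_derivative (4 / 3) * m) (at z)"
      unfolding s_def by (auto intro!: derivative_eq_intros)
    moreover have "l * d * (5 * Q z - (s z)\<^sup>2) + 1 * m = (1 / 3) * m * (l * m) * ((1 - 4 * z ^ 2) * d) + 1 * m"
      by (simp add: s_def Q_def P_def field_simps power_numeral_reduce)
    ultimately show "(s has_field_derivative l / (1 - 4 * z ^ 2) * (5 * Q z - (s z)\<^sup>2) + 1 / l) (at z)"
      by (elim DERIV_cong) (simp add: ld lm d)
    have "(Q has_field_derivative (1 / 15) * m ^ 2 * (8 / 3 * z)) (at z)"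
      unfolding Q_def by (auto intro!: derivative_eq_intros)
    moreover have "l * d * (14 * P z - 4 * s z * Q z) = (1 / 15) * m ^ 2 * (8 / 3 * z) * (l * m) * ((1 - 4 * z ^ 2) * d)"
      by (simp add: s_def Q_def P_def field_simps power_numeral_reduce)
    ultimately show "(Q has_field_derivative l / (1 - 4 * z ^ 2) * (14 * P z - 4 * s z * Q z)) (at z)"
      by (elim DERIV_cong) (simp add: ld lm d)
    have "(P has_field_derivative (4 / 105) * m ^ 3 * (1 - 4 / 3 * z ^ 2)) (at z)"
      unfolding P_def by (auto intro!: derivative_eq_intros)
    moreover have "l * d * (60 / 7 * (Q z)\<^sup>2 - 6 * s z * P z) = (4 / 105) * m ^ 3 * (1 - 4 / 3 * z ^ 2) * (l * m) * ((1 - 4 * z ^ 2) * d)"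
      by (simp add: s_def Q_def P_def field_simps power_numeral_reduce)
    ultimately show "(P has_field_derivative l / (1 - 4 * z ^ 2) * (60 / 7 * (Q z)\<^sup>2 - 6 * s z * P z)) (at z)"
      by (elim DERIV_cong) (simp add: ld lm d)
  next
    show "g_i 0 = 1" "h_i 0 = 0"
      using g_h_eq_eval_fps(3,4)[of 0] by (simp_all add: eval_fps_at_0)
    show "eval_fps (fps_deriv (Abs_fps (hyp2 1 0))) 0 = 0" "eval_fps (fps_deriv (Abs_fps (hyp2 0 1))) 0 = 1"
      by (simp_all add: eval_fps_at_0)
    have "m ^ 2 = 15 * of_real r" using l2 r by (simp add: m_def power_divide)
    thus "Q 0 = eis 4 \<i>" by (simp add: Q_def r)
    show "P 0 = eis 6 \<i>" by (simp add: P_def r)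
  qed (use \<kappa> r in \<open>auto simp: l_def s_def intro!: holomorphic_intros\<close>)
  have "norm (of_real \<kappa> * of_real (2 * pi * Omega_i\<^sup>2) :: complex) = 1"
  proof (rule limit_on_circle[where \<F> = "at_left (1 / 2 :: real)" and t = "\<lambda>r. of_real r" and ?Q0.0 = "Q (1 / 2)"])
    show "eventually (\<lambda>r::real. of_real r \<in> ball (0 :: complex) (1 / 2)) (at_left (1 / 2))"
      using eventually_at_left_real[of 0 "1 / 2"] by (auto elim!: eventually_mono)
    show "filterlim (\<lambda>r::real. norm (g_i (of_real r))) at_top (at_left (1 / 2))"
      by (rule i_limits)
    show "((\<lambda>r::real. h_i (of_real r) / g_i (of_real r)) \<longlongrightarrow> of_real (2 * pi * Omega_i\<^sup>2)) (at_left (1 / 2))"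
      using i_limits(2) by (simp add: c_i_def)
    have "((\<lambda>r::real. Q (of_real r)) \<longlongrightarrow> Q (of_real (1 / 2))) (at_left (1 / 2))"
      unfolding Q_def by (intro tendsto_intros) auto
    thus "((\<lambda>r::real. Q (of_real r)) \<longlongrightarrow> Q (1 / 2)) (at_left (1 / 2))" by simp
    show "Q (1 / 2) \<noteq> 0" using l0 by (simp add: Q_def m_def power2_eq_square)
  qed auto
  hence "\<kappa> * (2 * pi * Omega_i\<^sup>2) = 1"
    unfolding of_real_mult[symmetric] norm_of_real using \<kappa> by (simp add: abs_mult)
  hence W: "W z = c_i z / of_real (2 * pi * Omega_i\<^sup>2)" for z
  proof -
    assume *: "\<kappa> * (2 * pi * Omega_i\<^sup>2) = 1"
    hence "\<kappa> = 1 / (2 * pi * Omega_i\<^sup>2)" by (intro nonzero_eq_divide_eq[THEN iffD2]) auto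
    thus ?thesis unfolding W_def c_i_def by simp
  qed
  have tb: "t \<in> ball 0 (1 / 2)" using t by simp
  note main = schwarz_main[OF tb]
  note D = Dom_D[OF main(1)]
  show "g_i t \<noteq> 0" by (rule D)
  have tau: "s_inv \<i> Omega_i (c_i t) = tau t"
    unfolding s_inv_eq tau_def W ..
  show "Im (s_inv \<i> Omega_i (c_i t)) > 0"
    unfolding tau by (rule Im_tau_pos) (rule main)
  have nz: "1 - 4 * t ^ 2 \<noteq> 0" using t by (rule one_minus_square_nz)
  have m0: "m \<noteq> 0" using l0 by (simp add: m_def)
  have q: "216000 * Q t ^ 3 = 64 / 27 * m ^ 6 * (3 + 4 * t ^ 2) ^ 3"
    unfolding Q_def by (simp add: field_simps power_numeral_reduce)
  \<comment> \<open>A multiple of the discriminant I^3 - 27 J^2 = (1 - 9 c^2)^2 of that quartic,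
    with c = 2 t / 3.\<close>
  have p: "216000 * Q t ^ 3 - 529200 * P t ^ 2 = 64 * m ^ 6 * (1 - 4 * t ^ 2) ^ 2"
    unfolding Q_def P_def by (simp add: field_simps power_numeral_reduce)
  have "klein_j (tau t) = 1728 * (64 / 27 * m ^ 6 * (3 + 4 * t ^ 2) ^ 3) / (64 * m ^ 6 * (1 - 4 * t ^ 2) ^ 2)"
    using klein_j_eq[OF Im_tau_pos[OF main(1)] D(3) main(2,3)] unfolding p unfolding q .
  also have "\<dots> = 64 * ((3 + 4 * t ^ 2) ^ 3 / (1 - 4 * t ^ 2) ^ 2)"
    using nz m0 by simp
  finally show "klein_j (s_inv \<i> Omega_i (c_i t)) = 64 * ((3 + 4 * t ^ 2) ^ 3 / (1 - 4 * t ^ 2) ^ 2)"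
    unfolding tau .
qed

theorem theorem1:
  shows "(\<forall>t::complex. norm t < 1 \<longrightarrow>
            g_rho t \<noteq> 0 \<and>
            Im ((s_inv rho Omega_rho (c_rho t) + 1) / 3) > 0 \<and>
            klein_j ((s_inv rho Omega_rho (c_rho t) + 1) / 3)
              = 27 * t ^ 3 * ((8 - t ^ 3) / (1 + t ^ 3)) ^ 3)
       \<and> (\<forall>t::complex. norm t < 1 / 2 \<longrightarrow>
            g_i t \<noteq> 0 \<and>
            Im (s_inv \<i> Omega_i (c_i t)) > 0 \<and>
            klein_j (s_inv \<i> Omega_i (c_i t))
              = 64 * ((3 + 4 * t ^ 2) ^ 3 / (1 - 4 * t ^ 2) ^ 2))"
  using rho_part i_part by blast

end
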